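(* Let $\mathring\beta\in\mathbb{S}^{\mathcal L^2}$ have finite oscillation index $\mathrm{ind}_{\mathrm{osc.}}(\mathring\beta)=J\in\mathbb N$ and be contained in the minimal centered subspace $W=\bigoplus_NW_N$. Then $\mathring\beta$ gives rise to a global solution $t\mapsto\beta(t)$, $\beta(0)=\mathring\beta$, of the Harmonic Hartree equation $\partial_t\beta=X_{\mathcal H}(\beta)$ which always remains in $\mathbb{S}^W$ (the unit sphere of $W$), is relatively periodic for $J>1$, and is relatively constant for $J=1$. In the case $J\ge2$ the relative period is given by $$\frac{2\pi}{\gcd\left(\{|N-M|:\dim_{\mathbb C}W_M>0,\ \dim_{\mathbb C}W_N>0\}\right)}.$$ In particular, the solution is classically periodic (i.e. periodic in $\mathcal L^2$) if and only if $$\sum_{i=1}^d\langle\mathring\beta,(\mathfrak b_i^*\mathfrak b_i-\mathfrak a_i^*\mathfrak a_i)\mathring\beta\rangle=\langle\mathring\beta,\mathfrak N\mathring\beta\rangle\in\mathbb Q.$$ The classical period is a multiple of the relative period.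
   Context: $\mathcal{L}^2=L^2(\mathbb{R}^{2d};\mathbb{C})$ in the variables $(\mathbf q,\mathbf p)\in\mathbb{R}^d\times\mathbb{R}^d$, with $\langle\beta_1,\beta_2\rangle=\int\beta_1\bar\beta_2$; $\mathbb{S}^{\mathcal L^2}$ is its unit sphere. For $1\le i\le d$: $$\mathfrak a_i=\tfrac1{\sqrt2}(q_i+\partial_{q_i}),\ \ \mathfrak a_i^*=\tfrac1{\sqrt2}(q_i-\partial_{q_i}),\ \ \mathfrak b_i=\tfrac1{\sqrt2}(p_i+\partial_{p_i}),\ \ \mathfrak b_i^*=\tfrac1{\sqrt2}(p_i-\partial_{p_i}),\qquad\mathfrak N=\sum_{i=1}^d(\mathfrak b_i^*\mathfrak b_i-\mathfrak a_i^*\mathfrak a_i).$$ $\{|\mathbf a,\mathbf b\rangle:\mathbf a,\mathbf b\in\mathbb{N}_0^d\}$ is the orthonormal (Hermite) basis of joint eigenfunctions with $\mathfrak a_i^*\mathfrak a_i|\mathbf a,\mathbf b\rangle=a_i|\mathbf a,\mathbf b\rangle$, $\mathfrak b_i^*\mathfrak b_i|\mathbf a,\mathbf b\rangle=b_i|\mathbf a,\mathbf b\rangle$. $\mathcal F_{A,B}$ is the span of those with $\sum a_i=A$, $\sum b_i=B$; $\mathcal F_N=\bigoplus_{B-A=N}\mathcal F_{A,B}=\ker(\mathfrak N-N)$ for $N\in\mathbb Z$ (Hilbert direct sum). $\mathcal V=\{\beta=\sum_{A,B\ge0}\beta_{A,B}:\beta_{A,B}\in\mathcal F_{A,B},\ \sum(A^2+B^2)\|\beta_{A,B}\|^2<\infty\}$.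 The Harmonic Hartree vector field on $\mathcal V$ is $$X_{\mathcal H}(\beta)=\tfrac1{\mathrm i}\big(\mathfrak N+\tfrac12\langle\beta,\mathfrak N\beta\rangle\big)\beta+\tfrac1{2\mathrm i}\operatorname{Re}\Big\langle\beta,\sum_i(\mathfrak b_i^*\mathfrak b_i^*-\mathfrak a_i\mathfrak a_i)\beta\Big\rangle\beta-\tfrac1{\mathrm i}\sum_i\big(\operatorname{Re}\langle\beta,\mathfrak b_i\beta\rangle(\mathfrak b_i+\mathfrak b_i^* )-\operatorname{Re}\langle\beta,\mathfrak a_i\beta\rangle(\mathfrak a_i+\mathfrak a_i^* )\big)\beta+\tfrac1{4\mathrm i}(\|\beta\|^2-1)\Big(2\mathfrak N+\sum_i(\mathfrak b_i\mathfrak b_i+\mathfrak b_i^*\mathfrak b_i^*-\mathfrak a_i\mathfrak a_i-\mathfrak a_i^*\mathfrak a_i^* )\Big)\beta.$$ A finite-dimensional complex subspace $W\subset\mathcal V$ is *centered* if (i) $W=\bigoplus_{N\in\mathbb Z}W_N$ with $W_N\subseteq\mathcal F_N$, and (ii) $\operatorname{Re}\langle\beta,\mathfrak a_i\beta\rangle=\operatorname{Re}\langle\beta,\mathfrak b_i\beta\rangle=0$ for all $\beta\in W$, $1\le i\le d$. Its decomposition index is $\mathrm{ind}_{\mathrm{dec.}}(W)=\#\{N:\dim_{\mathbb C}W_N>0\}$. The oscillation index of $\beta\in\mathbb{S}^{\mathcal L^2}$ is $\mathrm{ind}_{\mathrm{osc.}}(\beta)=\inf\{\mathrm{ind}_{\mathrm{dec.}}(W):W\text{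 centered},\ \beta\in W\}\in\mathbb N_0\cup\{\infty\}$. If $\beta=\sum_N\beta_N$ ($\beta_N\in\mathcal F_N$) lies in some centered subspace, the minimal centered subspace containing it is $\bigoplus_N\mathbb C\beta_N$. A solution is *relatively periodic* (resp. *relatively constant* ) if its projection to the quotient $\mathbb{S}^{\mathcal L^2}/\mathbb{S}^1$ ($\mathbb{S}^1$ acting by multiplication by unimodular constants) is periodic (resp. constant); the *relative period* is the period of this projection. *)

theory Defs
  imports "HOL-Probability.Probability" "HOL-Library.Extended_Nat"
begin

section \<open>The complex Hilbert space of square-integrable functions\<close>

definition square_int :: "('a::euclidean_space \<Rightarrow> complex) \<Rightarrow> bool" where
  "square_int f \<longleftrightarrow> f \<in> borel_measurable lborel \<and> integrable lborel (\<lambda>x. (cmod (f x))\<^sup>2)"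

definition l2_eq :: "('a::euclidean_space \<Rightarrow> complex) \<Rightarrow> ('a \<Rightarrow> complex) \<Rightarrow> bool" where
  "l2_eq f g \<longleftrightarrow> square_int f \<and> square_int g \<and> (AE x in lborel. f x = g x)"

lemma square_int_zero: "square_int (\<lambda>_. 0)"
  by (simp add: square_int_def)

quotient_type (overloaded) 'a L2 = "('a::euclidean_space) \<Rightarrow> complex" / partial: l2_eq
proof (rule part_equivpI)
  show "\<exists>x. l2_eq x x"
    using square_int_zero by (auto simp: l2_eq_def)
  show "symp l2_eq"
    by (auto simp: symp_def l2_eq_def)
  show "transp l2_eq"
    by (auto simp: transp_def l2_eq_def)
qed

lemma square_int_scale: "square_int f \<Longrightarrow> square_int (\<lambda>x. c * f x)"
  by (auto simp: square_int_def norm_mult power_mult_distrib)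

lemma square_int_add:
  assumes "square_int f" "square_int g"
  shows "square_int (\<lambda>x. f x + g x)"
proof -
  have m [measurable]: "f \<in> borel_measurable lborel" "g \<in> borel_measurable lborel"
    using assms by (auto simp: square_int_def)
  have bound: "(cmod (f x + g x))\<^sup>2 \<le> 2 * (cmod (f x))\<^sup>2 + 2 * (cmod (g x))\<^sup>2" for x
  proof -
    have "(cmod (f x + g x))\<^sup>2 \<le> (cmod (f x) + cmod (g x))\<^sup>2"
      by (intro power_mono norm_triangle_ineq) auto
    also have "\<dots> \<le> 2 * (cmod (f x))\<^sup>2 + 2 * (cmod (g x))\<^sup>2"
      using sum_squares_bound[of "cmod (f x)" "cmod (g x)"] by (simp add: power2_sum)
    finally show ?thesis .
  qed
  have "integrable lborel (\<lambda>x. 2 * (cmod (f x))\<^sup>2 + 2 * (cmod (g x))\<^sup>2)"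
    using assms by (auto simp: square_int_def)
  then have "integrable lborel (\<lambda>x. (cmod (f x + g x))\<^sup>2)"
  proof (rule Bochner_Integration.integrable_bound)
    show "(\<lambda>x. (cmod (f x + g x))\<^sup>2) \<in> borel_measurable lborel" by measurable
    show "AE x in lborel. norm ((cmod (f x + g x))\<^sup>2) \<le> norm (2 * (cmod (f x))\<^sup>2 + 2 * (cmod (g x))\<^sup>2)"
      using bound by (intro AE_I2) simp
  qed
  moreover have "(\<lambda>x. f x + g x) \<in> borel_measurable lborel" by measurable
  ultimately show ?thesis by (simp add: square_int_def)
qed

lemma borel_measurable_cnj [measurable]: "cnj \<in> borel_measurable borel"
  by (intro borel_measurable_continuous_onI continuous_intros)

lemma integrable_mult_cnj:
  assumes "square_int f" "square_int g"
  shows "integrable lborel (\<lambda>x. f x * cnj (g x))"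
proof -
  have m [measurable]: "f \<in> borel_measurable lborel" "g \<in> borel_measurable lborel"
    using assms by (auto simp: square_int_def)
  have bound: "cmod (f x * cnj (g x)) \<le> (cmod (f x))\<^sup>2 + (cmod (g x))\<^sup>2" for x
  proof -
    have "0 \<le> cmod (f x) * cmod (g x)" by simp
    then show ?thesis
      using sum_squares_bound[of "cmod (f x)" "cmod (g x)"] unfolding norm_mult complex_mod_cnj
      by linarith
  qed
  have "integrable lborel (\<lambda>x. (cmod (f x))\<^sup>2 + (cmod (g x))\<^sup>2)"
    using assms by (auto simp: square_int_def)
  then show ?thesis
  proof (rule Bochner_Integration.integrable_bound)
    show "(\<lambda>x. f x * cnj (g x)) \<in> borel_measurable lborel" by measurable
    show "AE x in lborel. norm (f x * cnj (g x)) \<le> norm ((cmod (f x))\<^sup>2 + (cmod (g x))\<^sup>2)"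
      using bound by (intro AE_I2) simp
  qed
qed

lift_definition scaleC :: "complex \<Rightarrow> 'a::euclidean_space L2 \<Rightarrow> 'a L2" (infixr \<open>*\<^sub>C\<close> 75)
  is "\<lambda>c f x. c * f x"
  by (auto simp: l2_eq_def square_int_scale)

lift_definition cinner :: "'a::euclidean_space L2 \<Rightarrow> 'a L2 \<Rightarrow> complex"
  is "\<lambda>f g. LINT x|lborel. f x * cnj (g x)"
proof -
  fix f f' g g' :: "'a \<Rightarrow> complex"
  assume "l2_eq f f'" "l2_eq g g'"
  then have [measurable]: "f \<in> borel_measurable lborel" "f' \<in> borel_measurable lborel"
    "g \<in> borel_measurable lborel" "g' \<in> borel_measurable lborel"
    and ae: "AE x in lborel. f x = f' x" "AE x in lborel. g x = g' x"
    by (auto simp: l2_eq_def square_int_def)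
  then show "(LINT x|lborel. f x * cnj (g x)) = (LINT x|lborel. f' x * cnj (g' x))"
  proof (intro integral_cong_AE)
    show "AE x in lborel. f x * cnj (g x) = f' x * cnj (g' x)"
      using ae by eventually_elim simp
  qed measurable
qed

instantiation L2 :: (euclidean_space) real_vector
begin

lift_definition zero_L2 :: "'a L2" is "\<lambda>_. 0"
  by (simp add: l2_eq_def square_int_zero)

lift_definition plus_L2 :: "'a L2 \<Rightarrow> 'a L2 \<Rightarrow> 'a L2" is "\<lambda>f g x. f x + g x"
  by (auto simp: l2_eq_def square_int_add)

definition scaleR_L2 :: "real \<Rightarrow> 'a L2 \<Rightarrow> 'a L2" where
  "scaleR_L2 r f = complex_of_real r *\<^sub>C f"

definition uminus_L2 :: "'a L2 \<Rightarrow> 'a L2" where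
  "uminus_L2 f = (- 1) *\<^sub>C f"

definition minus_L2 :: "'a L2 \<Rightarrow> 'a L2 \<Rightarrow> 'a L2" where
  "minus_L2 f g = f + (- g)"

instance
proof
  fix f g h :: "'a L2" and r s :: real
  show "f + g + h = f + (g + h)"
    by transfer (auto simp: l2_eq_def square_int_add add.assoc)
  show "f + g = g + f"
    by transfer (auto simp: l2_eq_def square_int_add add.commute)
  show "0 + f = f"
    by transfer (auto simp: l2_eq_def)
  show "- f + f = 0"
    unfolding uminus_L2_def
    by transfer (auto simp: l2_eq_def square_int_zero)
  show "f - g = f + - g"
    by (simp add: minus_L2_def)
  show "r *\<^sub>R (f + g) = r *\<^sub>R f + r *\<^sub>R g"
    unfolding scaleR_L2_def
    by transfer (auto simp: l2_eq_def square_int_add square_int_scale distrib_left)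
  show "(r + s) *\<^sub>R f = r *\<^sub>R f + s *\<^sub>R f"
    unfolding scaleR_L2_def
    by transfer (auto simp: l2_eq_def distrib_right intro!: square_int_add square_int_scale)
  show "r *\<^sub>R s *\<^sub>R f = (r * s) *\<^sub>R f"
    unfolding scaleR_L2_def
    by transfer (auto simp: l2_eq_def mult.assoc intro!: square_int_scale)
  show "1 *\<^sub>R f = f"
    unfolding scaleR_L2_def by transfer (auto simp: l2_eq_def)
qed

end

instantiation L2 :: (euclidean_space) real_inner
begin

definition inner_L2 :: "'a L2 \<Rightarrow> 'a L2 \<Rightarrow> real" where
  "inner_L2 f g = Re (cinner f g)"

definition norm_L2 :: "'a L2 \<Rightarrow> real" where
  "norm_L2 f = sqrt (inner f f)"

definition dist_L2 :: "'a L2 \<Rightarrow> 'a L2 \<Rightarrow> real" where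
  "dist_L2 f g = norm (f - g)"

definition sgn_L2 :: "'a L2 \<Rightarrow> 'a L2" where
  "sgn_L2 f = f /\<^sub>R norm f"

definition uniformity_L2 :: "('a L2 \<times> 'a L2) filter" where
  "uniformity_L2 = (INF e\<in>{0 <..}. principal {(x, y). dist x y < e})"

definition open_L2 :: "'a L2 set \<Rightarrow> bool" where
  "open_L2 S = (\<forall>x\<in>S. \<forall>\<^sub>F (x', y) in uniformity. x' = x \<longrightarrow> y \<in> S)"

instance
proof
  fix f g h :: "'a L2" and r :: real and S :: "'a L2 set"
  show "dist f g = norm (f - g)" by (simp add: dist_L2_def)
  show "sgn f = f /\<^sub>R norm f" by (simp add: sgn_L2_def)
  show "uniformity = (INF e\<in>{0 <..}. principal {(x :: 'a L2, y). dist x y < e})"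
    by (simp add: uniformity_L2_def)
  show "open S = (\<forall>x\<in>S. \<forall>\<^sub>F (x', y) in uniformity. x' = x \<longrightarrow> y \<in> S)"
    by (simp add: open_L2_def)
  show "inner f g = inner g f"
    unfolding inner_L2_def
  proof transfer
    fix f g :: "'a \<Rightarrow> complex"
    have "(LINT x|lborel. g x * cnj (f x)) = (LINT x|lborel. cnj (f x * cnj (g x)))"
      by (simp add: mult.commute)
    also have "\<dots> = cnj (LINT x|lborel. f x * cnj (g x))"
      by (rule Bochner_Integration.integral_cnj)
    finally show "Re (LINT x|lborel. f x * cnj (g x)) = Re (LINT x|lborel. g x * cnj (f x))"
      by simp
  qed
  show "inner (f + g) h = inner f h + inner g h"
    unfolding inner_L2_def
    by transfer (simp add: l2_eq_def distrib_right integrable_mult_cnj)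
  show "inner (r *\<^sub>R f) g = r * inner f g"
    unfolding inner_L2_def scaleR_L2_def
    by transfer (simp add: mult.assoc)
  have sq: "(LINT x|lborel. u x * cnj (u x)) = of_real (LINT x|lborel. (cmod (u x))\<^sup>2)"
    for u :: "'a \<Rightarrow> complex"
    unfolding complex_norm_square[symmetric] by (rule integral_complex_of_real)
  show "0 \<le> inner f f"
    unfolding inner_L2_def
    by transfer (simp add: sq)
  show "(inner f f = 0) = (f = 0)"
    unfolding inner_L2_def
  proof transfer
    fix u :: "'a \<Rightarrow> complex" assume "l2_eq u u"
    then have u: "square_int u" by (simp add: l2_eq_def)
    then have [measurable]: "u \<in> borel_measurable lborel" by (simp add: square_int_def)
    have "integrable lborel (\<lambda>x. (cmod (u x))\<^sup>2)" using u by (simp add: square_int_def)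
    then have "((LINT x|lborel. (cmod (u x))\<^sup>2) = 0) = (AE x in lborel. (cmod (u x))\<^sup>2 = 0)"
      by (rule integral_nonneg_eq_0_iff_AE) auto
    then show "(Re (LINT x|lborel. u x * cnj (u x)) = 0) = l2_eq u (\<lambda>_. 0)"
      using u by (simp add: sq l2_eq_def square_int_zero)
  qed
  show "norm f = sqrt (inner f f)" by (simp add: norm_L2_def)
qed

end

interpretation L2: vector_space "scaleC :: complex \<Rightarrow> 'a::euclidean_space L2 \<Rightarrow> 'a L2"
proof
  fix a b :: complex and f g :: "'a L2"
  show "a *\<^sub>C (f + g) = a *\<^sub>C f + a *\<^sub>C g"
    by transfer (auto simp: l2_eq_def square_int_add square_int_scale distrib_left)
  show "(a + b) *\<^sub>C f = a *\<^sub>C f + b *\<^sub>C f"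
    by transfer (auto simp: l2_eq_def distrib_right intro!: square_int_add square_int_scale)
  show "a *\<^sub>C b *\<^sub>C f = (a * b) *\<^sub>C f"
    by transfer (auto simp: l2_eq_def mult.assoc intro!: square_int_scale)
  show "1 *\<^sub>C f = f"
    by transfer (auto simp: l2_eq_def)
qed


section \<open>Position and derivative operators\<close>

text \<open>The operators below are unbounded; each is represented by a total function on \<open>L2\<close> that
  takes the value \<open>0\<close> outside its maximal domain.\<close>

lift_definition coord_mult :: "'a::euclidean_space \<Rightarrow> 'a L2 \<Rightarrow> 'a L2"
  is "\<lambda>v f. if square_int (\<lambda>x. of_real (x \<bullet> v) * f x) then (\<lambda>x. of_real (x \<bullet> v) * f x) else (\<lambda>_. 0)"
proof -
  fix v :: 'a and f g :: "'a \<Rightarrow> complex"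
  assume fg: "l2_eq f g"
  then have [measurable]: "f \<in> borel_measurable lborel" "g \<in> borel_measurable lborel"
    by (auto simp: l2_eq_def square_int_def)
  have ae: "AE x in lborel. of_real (x \<bullet> v) * f x = of_real (x \<bullet> v) * g x"
    using fg by (auto simp: l2_eq_def)
  have "integrable lborel (\<lambda>x. (cmod (of_real (x \<bullet> v) * f x))\<^sup>2)
      \<longleftrightarrow> integrable lborel (\<lambda>x. (cmod (of_real (x \<bullet> v) * g x))\<^sup>2)"
  proof (rule integrable_cong_AE)
    show "AE x in lborel. (cmod (of_real (x \<bullet> v) * f x))\<^sup>2 = (cmod (of_real (x \<bullet> v) * g x))\<^sup>2"
      using ae by eventually_elim (simp only:)
  qed measurable
  moreover have "(\<lambda>x. of_real (x \<bullet> v) * f x) \<in> borel_measurable lborel"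
    "(\<lambda>x. of_real (x \<bullet> v) * g x) \<in> borel_measurable lborel"
    by measurable
  ultimately have "square_int (\<lambda>x. of_real (x \<bullet> v) * f x) \<longleftrightarrow> square_int (\<lambda>x. of_real (x \<bullet> v) * g x)"
    unfolding square_int_def by blast
  then show "l2_eq (if square_int (\<lambda>x. of_real (x \<bullet> v) * f x)
                then (\<lambda>x. of_real (x \<bullet> v) * f x) else (\<lambda>_. 0))
              (if square_int (\<lambda>x. of_real (x \<bullet> v) * g x)
                then (\<lambda>x. of_real (x \<bullet> v) * g x) else (\<lambda>_. 0))"
    using ae by (auto simp: l2_eq_def square_int_zero)
qed

text \<open>Distributional derivatives are tested against \<open>C\<^sup>1\<close> functions of compact support; by
  mollification this gives the same weak derivative as smooth test functions.
  \<open>\<phi>' x u\<close> is the derivative of \<open>\<phi>\<close> at \<open>x\<close> in direction \<open>u\<close>.\<close>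

definition test_function :: "('a::euclidean_space \<Rightarrow> real) \<Rightarrow> ('a \<Rightarrow> 'a \<Rightarrow> real) \<Rightarrow> bool" where
  "test_function \<phi> \<phi>' \<longleftrightarrow>
     (\<forall>x. (\<phi> has_derivative \<phi>' x) (at x)) \<and>
     (\<forall>u. continuous_on UNIV (\<lambda>x. \<phi>' x u)) \<and>
     compact (closure {x. \<phi> x \<noteq> 0})"

lift_definition has_weak_deriv :: "'a::euclidean_space L2 \<Rightarrow> 'a \<Rightarrow> 'a L2 \<Rightarrow> bool"
  is "\<lambda>f v g. \<forall>\<phi> \<phi>'. test_function \<phi> \<phi>' \<longrightarrow>
        (LINT x|lborel. g x * of_real (\<phi> x)) = - (LINT x|lborel. f x * of_real (\<phi>' x v))"
proof -
  fix f f' g g' :: "'a \<Rightarrow> complex" and v :: 'a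
  assume "l2_eq f f'" "l2_eq g g'"
  then have m [measurable]: "f \<in> borel_measurable lborel" "f' \<in> borel_measurable lborel"
    "g \<in> borel_measurable lborel" "g' \<in> borel_measurable lborel"
    and ae: "AE x in lborel. f x = f' x" "AE x in lborel. g x = g' x"
    by (auto simp: l2_eq_def square_int_def)
  have "(LINT x|lborel. g x * of_real (\<phi> x)) = (LINT x|lborel. g' x * of_real (\<phi> x))"
    "(LINT x|lborel. f x * of_real (\<phi>' x v)) = (LINT x|lborel. f' x * of_real (\<phi>' x v))"
    if t: "test_function \<phi> \<phi>'" for \<phi> \<phi>'
  proof -
    have "continuous_on UNIV \<phi>"
      using t unfolding test_function_def
      by (auto intro!: continuous_at_imp_continuous_on has_derivative_continuous)
    then have [measurable]: "\<phi> \<in> borel_measurable lborel"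
      by (simp add: borel_measurable_continuous_onI)
    have "continuous_on UNIV (\<lambda>x. \<phi>' x v)"
      using t by (simp add: test_function_def)
    then have [measurable]: "(\<lambda>x. \<phi>' x v) \<in> borel_measurable lborel"
      by (simp add: borel_measurable_continuous_onI)
    show "(LINT x|lborel. g x * of_real (\<phi> x)) = (LINT x|lborel. g' x * of_real (\<phi> x))"
      by (rule integral_cong_AE) (use ae(2) in auto)
    show "(LINT x|lborel. f x * of_real (\<phi>' x v)) = (LINT x|lborel. f' x * of_real (\<phi>' x v))"
      by (rule integral_cong_AE) (use ae(1) in auto)
  qed
  then show "(\<forall>\<phi> \<phi>'. test_function \<phi> \<phi>' \<longrightarrow>
        (LINT x|lborel. g x * of_real (\<phi> x)) = - (LINT x|lborel. f x * of_real (\<phi>' x v))) =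
      (\<forall>\<phi> \<phi>'. test_function \<phi> \<phi>' \<longrightarrow>
        (LINT x|lborel. g' x * of_real (\<phi> x)) = - (LINT x|lborel. f' x * of_real (\<phi>' x v)))"
    by simp
qed

definition weak_deriv :: "'a::euclidean_space \<Rightarrow> 'a L2 \<Rightarrow> 'a L2" where
  "weak_deriv v f = (if \<exists>g. has_weak_deriv f v g then THE g. has_weak_deriv f v g else 0)"


section \<open>Ladder operators on phase space\<close>

type_synonym 'd phase = "(real^'d) \<times> (real^'d)"

definition q_dir :: "'d::finite \<Rightarrow> 'd phase" where "q_dir i = (axis i 1, 0)"
definition p_dir :: "'d::finite \<Rightarrow> 'd phase" where "p_dir i = (0, axis i 1)"

definition lowering :: "'a::euclidean_space \<Rightarrow> 'a L2 \<Rightarrow> 'a L2" where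
  "lowering v \<beta> = (1 / sqrt 2) *\<^sub>R (coord_mult v \<beta> + weak_deriv v \<beta>)"

definition raising :: "'a::euclidean_space \<Rightarrow> 'a L2 \<Rightarrow> 'a L2" where
  "raising v \<beta> = (1 / sqrt 2) *\<^sub>R (coord_mult v \<beta> - weak_deriv v \<beta>)"

text \<open>\<open>op_a'\<close> and \<open>op_b'\<close> are the (starred) adjoints of \<open>op_a\<close> and \<open>op_b\<close>.\<close>

definition op_a :: "'d::finite \<Rightarrow> 'd phase L2 \<Rightarrow> 'd phase L2" where "op_a i = lowering (q_dir i)"
definition op_a' :: "'d::finite \<Rightarrow> 'd phase L2 \<Rightarrow> 'd phase L2" where "op_a' i = raising (q_dir i)"
definition op_b :: "'d::finite \<Rightarrow> 'd phase L2 \<Rightarrow> 'd phase L2" where "op_b i = lowering (p_dir i)"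
definition op_b' :: "'d::finite \<Rightarrow> 'd phase L2 \<Rightarrow> 'd phase L2" where "op_b' i = raising (p_dir i)"

definition op_N :: "'d::finite phase L2 \<Rightarrow> 'd phase L2" where
  "op_N \<beta> = (\<Sum>i\<in>UNIV. op_b' i (op_b i \<beta>) - op_a' i (op_a i \<beta>))"


section \<open>Hermite basis\<close>

text \<open>Physicists' Hermite polynomials and the normalized Hermite functions.\<close>

fun hermite :: "nat \<Rightarrow> real \<Rightarrow> real" where
  "hermite 0 x = 1"
| "hermite (Suc 0) x = 2 * x"
| "hermite (Suc (Suc n)) x = 2 * x * hermite (Suc n) x - 2 * real (Suc n) * hermite n x"

definition hermite_fun :: "nat \<Rightarrow> real \<Rightarrow> real" where
  "hermite_fun n x = hermite n x * exp (- x\<^sup>2 / 2) / sqrt (2 ^ n * fact n * sqrt pi)"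

lemma hermite_polynomial: "real_polynomial_function (hermite n)"
proof (induction n rule: induct_nat_012)
  case 0
  have "hermite 0 = (\<lambda>x. 1)" by (simp add: fun_eq_iff)
  then show ?case by (simp add: real_polynomial_function.intros(2))
next
  case 1
  have "hermite (Suc 0) = (\<lambda>x. 2 * x)" by (simp add: fun_eq_iff)
  then show ?case
    by (metis bounded_linear_mult_right real_polynomial_function.intros(1))
next
  case (ge2 n)
  have "hermite (Suc (Suc n)) = (\<lambda>x. 2 * x * hermite (Suc n) x + (- (2 * real (Suc n))) * hermite n x)"
    by (simp add: fun_eq_iff algebra_simps)
  moreover have "real_polynomial_function (\<lambda>x. 2 * x)"
    by (intro real_polynomial_function.intros(1) bounded_linear_mult_right)
  ultimately show ?case
    using ge2 by (auto intro!: real_polynomial_function.intros(2-4))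
qed

lemma integrable_hermite_fun_sq: "integrable lborel (\<lambda>x. (hermite_fun n x)\<^sup>2)"
proof -
  have "real_polynomial_function (\<lambda>x. (hermite n x)\<^sup>2)"
    using hermite_polynomial[of n] by (simp add: real_polynomial_function_power)
  then obtain c k where ck: "(\<lambda>x. (hermite n x)\<^sup>2) = (\<lambda>x. \<Sum>i\<le>k. c i * x ^ i)"
    unfolding real_polynomial_function_iff_sum by blast
  define K where "K = 2 ^ n * fact n * sqrt pi"
  have K: "K > 0" by (simp add: K_def)
  define D where "D = normal_density 0 (1 / sqrt 2)"
  have D: "exp (- x\<^sup>2) = sqrt pi * D x" for x
    by (simp add: D_def normal_density_def power_divide)
  have *: "(hermite_fun n x)\<^sup>2 = (hermite n x)\<^sup>2 * exp (- x\<^sup>2) / K" for x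
  proof -
    have "(exp (- x\<^sup>2 / 2))\<^sup>2 = exp (- x\<^sup>2)"
      by (simp add: power2_eq_square flip: exp_add)
    then show ?thesis
      using K unfolding hermite_fun_def K_def[symmetric] power_divide power_mult_distrib by simp
  qed
  have eq: "(\<lambda>x. (hermite_fun n x)\<^sup>2) = (\<lambda>x. \<Sum>i\<le>k. (c i * sqrt pi / K) * (D x * (x - 0) ^ i))"
    by (rule ext)
       (simp add: * ck[THEN fun_cong] D sum_distrib_left sum_distrib_right sum_divide_distrib mult_ac)
  have "integrable lborel (\<lambda>x. D x * (x - 0) ^ i)" for i
    unfolding D_def by (rule integrable_normal_moment) simp
  then show ?thesis
    unfolding eq by (intro Bochner_Integration.integrable_sum integrable_mult_right)
qed

lemma hermite_fun_measurable [measurable]: "hermite_fun n \<in> borel_measurable borel"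
proof -
  have "continuous_on UNIV (hermite n)"
    by (rule continuous_on_polymonial_function) (use hermite_polynomial in \<open>simp add: real_polynomial_function_eq\<close>)
  then have [measurable]: "hermite n \<in> borel_measurable borel"
    by (rule borel_measurable_continuous_onI)
  show ?thesis
    unfolding hermite_fun_def by measurable
qed

lemma integrable_prod_hermite:
  "integrable lborel (\<lambda>x::real^'d::finite. (\<Prod>i\<in>UNIV. hermite_fun (a i) (x $ i))\<^sup>2)"
proof (rule integrableI_nonneg)
  show "(\<lambda>x::real^'d. (\<Prod>i\<in>UNIV. hermite_fun (a i) (x $ i))\<^sup>2) \<in> borel_measurable lborel"
    by measurable
  define f :: "real^'d \<Rightarrow> real \<Rightarrow> ennreal"
    where "f b t = ennreal ((hermite_fun (a (axis_index b)) t)\<^sup>2)" for b t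
  have "ennreal ((\<Prod>i\<in>UNIV. hermite_fun (a i) (x $ i))\<^sup>2) = (\<Prod>b\<in>Basis. f b (x \<bullet> b))"
    for x :: "real^'d"
  proof -
    have B: "(Basis :: (real^'d) set) = (\<lambda>i. axis i 1) ` UNIV"
      by (auto simp: Basis_vec_def)
    have inj: "inj (\<lambda>i::'d. axis i (1::real))"
      by (auto simp: inj_on_def axis_eq_axis)
    have "(\<Prod>b\<in>Basis. f b (x \<bullet> b)) = (\<Prod>i\<in>UNIV. f (axis i 1) (x $ i))"
      unfolding B by (subst prod.reindex[OF inj]) (simp add: inner_axis)
    also have "\<dots> = (\<Prod>i\<in>UNIV. ennreal ((hermite_fun (a i) (x $ i))\<^sup>2))"
      by (simp add: f_def axis_index_axis)
    finally show ?thesis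
      by (simp add: prod_ennreal prod_power_distrib)
  qed
  moreover have [measurable]: "f b \<in> borel_measurable borel" for b
    unfolding f_def by measurable
  ultimately have "nn_integral lborel (\<lambda>x::real^'d. ennreal ((\<Prod>i\<in>UNIV. hermite_fun (a i) (x $ i))\<^sup>2))
      = (\<Prod>b\<in>Basis. nn_integral lborel (f b))"
    by (simp add: nn_integral_lborel_prod)
  also have "\<dots> < \<infinity>"
  proof -
    have "nn_integral lborel (f b) < \<infinity>" for b
      using integrable_hermite_fun_sq[of "a (axis_index b)"]
      by (simp add: f_def[abs_def] integrable_iff_bounded)
    then show ?thesis
      by (simp add: ennreal_prod_eq_top flip: less_top)
  qed
  finally show "nn_integral lborel (\<lambda>x::real^'d. ennreal ((\<Prod>i\<in>UNIV. hermite_fun (a i) (x $ i))\<^sup>2)) < \<infinity>" .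
qed auto

lift_definition ket :: "('d::finite \<Rightarrow> nat) \<Rightarrow> ('d \<Rightarrow> nat) \<Rightarrow> 'd phase L2"
  is "\<lambda>a b (q, p). complex_of_real
        ((\<Prod>i\<in>UNIV. hermite_fun (a i) (q $ i)) * (\<Prod>i\<in>UNIV. hermite_fun (b i) (p $ i)))"
proof -
  fix a b :: "'d \<Rightarrow> nat"
  interpret lborel_pair: pair_sigma_finite "lborel :: (real^'d) measure" "lborel :: (real^'d) measure" ..
  define A where "A q = (\<Prod>i\<in>UNIV. hermite_fun (a i) (q $ i))" for q :: "real^'d"
  define B where "B p = (\<Prod>i\<in>UNIV. hermite_fun (b i) (p $ i))" for p :: "real^'d"
  have [measurable]: "A \<in> borel_measurable borel" "B \<in> borel_measurable borel"
    unfolding A_def B_def by measurable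
  have i: "integrable lborel (\<lambda>q. (A q)\<^sup>2)" "integrable lborel (\<lambda>p. (B p)\<^sup>2)"
    unfolding A_def B_def by (rule integrable_prod_hermite)+
  have "integrable (lborel \<Otimes>\<^sub>M lborel) (\<lambda>(q, p). (A q)\<^sup>2 * (B p)\<^sup>2)"
    by (rule lborel_pair.Fubini_integrable)
       (use i in \<open>auto simp: abs_mult\<close>)
  then have "integrable lborel (\<lambda>(q, p). (A q)\<^sup>2 * (B p)\<^sup>2)"
    by (simp add: lborel_prod)
  moreover have "(\<lambda>(q, p). complex_of_real (A q * B p)) \<in> borel_measurable (borel \<Otimes>\<^sub>M borel)"
    by measurable
  ultimately have "square_int (\<lambda>(q, p). complex_of_real (A q * B p))"
    by (simp add: square_int_def case_prod_beta' power_mult_distrib norm_mult borel_prod)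
  then show "l2_eq (\<lambda>(q, p). complex_of_real
        ((\<Prod>i\<in>UNIV. hermite_fun (a i) (q $ i)) * (\<Prod>i\<in>UNIV. hermite_fun (b i) (p $ i))))
     (\<lambda>(q, p). complex_of_real
        ((\<Prod>i\<in>UNIV. hermite_fun (a i) (q $ i)) * (\<Prod>i\<in>UNIV. hermite_fun (b i) (p $ i))))"
    by (simp add: l2_eq_def A_def B_def)
qed

definition F_AB :: "nat \<Rightarrow> nat \<Rightarrow> 'd::finite phase L2 set" where
  "F_AB A B = L2.span {ket a b | a b. (\<Sum>i\<in>UNIV. a i) = A \<and> (\<Sum>i\<in>UNIV. b i) = B}"

text \<open>The Hilbert direct sum is the closure of the algebraic sum.\<close>

definition F_N :: "int \<Rightarrow> 'd::finite phase L2 set" where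
  "F_N N = closure (L2.span (\<Union>{F_AB A B | A B. int B - int A = N}))"

definition V_space :: "'d::finite phase L2 set" where
  "V_space = {\<beta>. \<exists>\<gamma>. (\<forall>A B. \<gamma> (A, B) \<in> F_AB A B) \<and>
      (\<gamma> has_sum \<beta>) UNIV \<and>
      (\<lambda>(A, B). (real A ^ 2 + real B ^ 2) * (norm (\<gamma> (A, B)))\<^sup>2) summable_on UNIV}"


section \<open>The Harmonic Hartree equation\<close>

definition X_H :: "'d::finite phase L2 \<Rightarrow> 'd phase L2" where
  "X_H \<beta> =
     (1 / \<i>) *\<^sub>C (op_N \<beta> + (1 / 2 * cinner \<beta> (op_N \<beta>)) *\<^sub>C \<beta>)
   + (1 / (2 * \<i>) * of_real (Re (cinner \<beta> (\<Sum>i\<in>UNIV. op_b' i (op_b' i \<beta>) - op_a i (op_a i \<beta>))))) *\<^sub>C \<beta>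
   - (1 / \<i>) *\<^sub>C (\<Sum>i\<in>UNIV. Re (cinner \<beta> (op_b i \<beta>)) *\<^sub>R (op_b i \<beta> + op_b' i \<beta>)
                        - Re (cinner \<beta> (op_a i \<beta>)) *\<^sub>R (op_a i \<beta> + op_a' i \<beta>))
   + (1 / (4 * \<i>) * of_real ((norm \<beta>)\<^sup>2 - 1)) *\<^sub>C
       (2 *\<^sub>R op_N \<beta> + (\<Sum>i\<in>UNIV. op_b i (op_b i \<beta>) + op_b' i (op_b' i \<beta>)
                                - op_a i (op_a i \<beta>) - op_a' i (op_a' i \<beta>)))"

definition global_solution :: "(real \<Rightarrow> 'd::finite phase L2) \<Rightarrow> bool" where
  "global_solution \<beta> \<longleftrightarrow>
     (\<forall>t. \<beta> t \<in> V_space \<and> (\<beta> has_vector_derivative X_H (\<beta> t)) (at t))"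


section \<open>Centered subspaces and the oscillation index\<close>

text \<open>Since the spaces \<open>F_N N\<close> are mutually orthogonal, a decomposition of \<open>W\<close> into a direct sum
  of subspaces of the \<open>F_N N\<close> can only be the one with the summands \<open>W \<inter> F_N N\<close>.\<close>

definition component :: "'d::finite phase L2 set \<Rightarrow> int \<Rightarrow> 'd phase L2 set" where
  "component W N = W \<inter> F_N N"

definition centered :: "'d::finite phase L2 set \<Rightarrow> bool" where
  "centered W \<longleftrightarrow>
     L2.subspace W \<and> (\<exists>S. finite S \<and> W = L2.span S) \<and> W \<subseteq> V_space \<and>
     W = L2.span (\<Union>N. component W N) \<and>
     (\<forall>\<beta>\<in>W. \<forall>i. Re (cinner \<beta> (op_a i \<beta>)) = 0 \<and> Re (cinner \<beta> (op_b i \<beta>)) = 0)"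

text \<open>For finite-dimensional \<open>W\<close> only finitely many components are nonzero, so \<open>card\<close> counts
  them correctly; \<open>Inf {} = \<infinity>\<close> in \<open>enat\<close>.\<close>

definition ind_dec :: "'d::finite phase L2 set \<Rightarrow> nat" where
  "ind_dec W = card {N. L2.dim (component W N) > 0}"

definition ind_osc :: "'d::finite phase L2 \<Rightarrow> enat" where
  "ind_osc \<beta> = Inf {enat (ind_dec W) | W. centered W \<and> \<beta> \<in> W}"

definition minimal_centered :: "'d::finite phase L2 set \<Rightarrow> 'd phase L2 \<Rightarrow> bool" where
  "minimal_centered W \<beta> \<longleftrightarrow>
     centered W \<and> \<beta> \<in> W \<and> (\<forall>W'. centered W' \<and> \<beta> \<in> W' \<longrightarrow> W \<subseteq> W')"


section \<open>Periodicity\<close>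

definition has_period :: "(real \<Rightarrow> 'a) \<Rightarrow> real \<Rightarrow> bool" where
  "has_period f T \<longleftrightarrow> T > 0 \<and> (\<forall>t. f (t + T) = f t)"

definition periodic :: "(real \<Rightarrow> 'a) \<Rightarrow> bool" where
  "periodic f \<longleftrightarrow> (\<exists>T. has_period f T)"

definition minimal_period :: "(real \<Rightarrow> 'a) \<Rightarrow> real \<Rightarrow> bool" where
  "minimal_period f T \<longleftrightarrow> has_period f T \<and> (\<forall>S. has_period f S \<longrightarrow> T \<le> S)"

text \<open>The image of \<open>\<beta>\<close> in the quotient by the circle action is the orbit of \<open>\<beta>\<close>.\<close>

definition circle_orbit :: "'a::euclidean_space L2 \<Rightarrow> 'a L2 set" where
  "circle_orbit \<beta> = {z *\<^sub>C \<beta> | z. cmod z = 1}"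

definition relatively_periodic :: "(real \<Rightarrow> 'a::euclidean_space L2) \<Rightarrow> bool" where
  "relatively_periodic \<beta> \<longleftrightarrow> periodic (\<lambda>t. circle_orbit (\<beta> t))"

definition relatively_constant :: "(real \<Rightarrow> 'a::euclidean_space L2) \<Rightarrow> bool" where
  "relatively_constant \<beta> \<longleftrightarrow> (\<forall>s t. circle_orbit (\<beta> s) = circle_orbit (\<beta> t))"

definition relative_period :: "(real \<Rightarrow> 'a::euclidean_space L2) \<Rightarrow> real \<Rightarrow> bool" where
  "relative_period \<beta> T \<longleftrightarrow> minimal_period (\<lambda>t. circle_orbit (\<beta> t)) T"

end

theory Submission
  imports Defs "HOL-Library.Real_Mod"
begin

text \<open>On the unit sphere of a centered subspace the field \<^term>\<open>X_H\<close> reduces to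
\<open>- \<i> (op_N + r(\<beta>)) \<beta>\<close> with a real scalar \<open>r(\<beta>)\<close>: the first order moments vanish, and so does
the term with \<open>\<parallel>\<beta>\<parallel>\<^sup>2 - 1\<close>. Minimality forces \<open>W\<close> to be spanned by the components \<open>b N\<close> of
\<open>\<beta>\<^sub>0\<close> in the eigenspaces \<open>F_N N\<close> of \<open>op_N\<close>, \<open>N\<close> in a finite set \<open>S\<close> (minimal_centered_structure). Hence
\<open>\<beta>(t) = \<Sum>N\<in>S. e^{-i(N t + \<phi>(t))} b N\<close>
solves the equation as soon as \<open>\<phi>' = r(\<beta>)\<close>. Two contributions make up \<open>r\<close>. One is half the
expectation of \<open>op_N\<close>, a constant \<open>mean_N / 2\<close> of the motion. The other is
half the real part of \<open>\<langle>\<beta>, K \<beta>\<rangle>\<close> with \<open>K = \<Sum>i. op_b' i op_b' i - op_a i op_a i\<close>. The latter need not vanish,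
but a common phase cancels in it, so along \<open>\<beta>(t)\<close> it is an explicit trigonometric polynomial in the
frequencies \<open>M - N\<close>. As \<open>K\<close> maps \<open>F_N N\<close> into \<open>F_N (N + 2)\<close>, the frequency \<open>0\<close> is
absent, and \<open>\<phi>\<close> is \<open>mean_N t / 2\<close> plus a function that every relative period leaves invariant.

All statements on periods follow. A number \<open>T > 0\<close> is a relative period iff \<open>e^{i(M-N)T} = 1\<close> for all
\<open>M, N\<close> in \<open>S\<close>; when \<open>S\<close> has two elements or more, this says that \<open>T\<close> is a multiple of \<open>2\<pi>/g\<close>
with \<open>g\<close> the gcd of the differences
(common_period_multiple). Over such a \<open>T\<close> the solution is multiplied by the single number
\<open>e^{-i(N + mean_N/2)T}\<close> (sol_shift), so a relative period is a classical one iff this number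
is \<open>1\<close>, which happens for some \<open>T\<close> iff \<open>mean_N\<close> is rational (periodic_sol_iff).

Most of the work is to show that the operators, given by maximal domains and distributional
derivatives, act on \<^const>\<open>V_space\<close> as expected. Multiplication by a coordinate and weak
differentiation are relations defined by duality, hence linear and stable under convergent series
(dual_rel_has_sum). On Hermite functions they are computed classically (ladder_ketc). Orthogonality
of the joint eigenspaces and the bounds on ladder operators come from adjointness and the
commutation relation
(sector_orthogonal, sector_lower_norms, sector_raise_bound). These bounds, together with the
completeness of \<open>L\<^sup>2\<close>, let the operators of order two be applied termwise to the expansion of an
element of \<^const>\<open>V_space\<close> (expansion_ladder).\<close>

section \<open>Sesquilinear algebra of square-integrable functions\<close>

lemma l2_eq_refl [simp]: "l2_eq f f \<longleftrightarrow> square_int f"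
  by (simp add: l2_eq_def)

lemma L2_cases: obtains u where "square_int u" "f = abs_L2 u"
proof
  show "square_int (rep_L2 f)" "f = abs_L2 (rep_L2 f)"
    using Quotient3_rep_reflp[OF Quotient3_L2, of f] Quotient3_abs_rep[OF Quotient3_L2, of f]
    by simp_all
qed

lemma cinner_abs_L2:
  "square_int u \<Longrightarrow> square_int w \<Longrightarrow> cinner (abs_L2 u) (abs_L2 w) = (LINT x|lborel. u x * cnj (w x))"
  by (simp add: cinner.abs_eq)

lemma abs_L2_eq_iff: "square_int u \<Longrightarrow> square_int w \<Longrightarrow>
    abs_L2 u = abs_L2 w \<longleftrightarrow> (AE x in lborel. u x = w x)"
  using Quotient3_rel[OF Quotient3_L2, of u w] by (auto simp: l2_eq_def)

lemma abs_L2_add: "square_int u \<Longrightarrow> square_int w \<Longrightarrow> abs_L2 u + abs_L2 w = abs_L2 (\<lambda>x. u x + w x)"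
  by (simp add: plus_L2.abs_eq)

lemma abs_L2_scaleC: "square_int u \<Longrightarrow> c *\<^sub>C abs_L2 u = abs_L2 (\<lambda>x. c * u x)"
  by (simp add: scaleC.abs_eq)

lemma square_int_diff: "square_int f \<Longrightarrow> square_int g \<Longrightarrow> square_int (\<lambda>x. f x - g x)"
  using square_int_add[of f "\<lambda>x. - 1 * g x"] square_int_scale[of g "-1"] by simp

lemma abs_L2_diff: "square_int u \<Longrightarrow> square_int w \<Longrightarrow> abs_L2 u - abs_L2 w = abs_L2 (\<lambda>x. u x - w x)"
proof -
  assume u: "square_int u" and w: "square_int w"
  have "abs_L2 u - abs_L2 w = abs_L2 u + abs_L2 (\<lambda>x. - 1 * w x)"
    unfolding minus_L2_def uminus_L2_def by (simp only: abs_L2_scaleC[OF w])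
  also have "\<dots> = abs_L2 (\<lambda>x. u x + - 1 * w x)"
    by (rule abs_L2_add[OF u square_int_scale[OF w]])
  finally show ?thesis by simp
qed

lemma scaleR_scaleC: "r *\<^sub>R (f :: 'a::euclidean_space L2) = complex_of_real r *\<^sub>C f"
  by (simp add: scaleR_L2_def)

lemma cinner_add_left: "cinner (f + g) h = cinner f h + cinner g h"
  by transfer (simp add: distrib_right integrable_mult_cnj)

lemma cinner_scaleC_left [simp]: "cinner (c *\<^sub>C f) h = c * cinner f h"
  by transfer (simp add: mult.assoc)

lemma cinner_commute: "cinner g f = cnj (cinner f g)"
proof transfer
  fix f g :: "'a \<Rightarrow> complex"
  have "(LINT x|lborel. g x * cnj (f x)) = (LINT x|lborel. cnj (f x * cnj (g x)))"
    by (simp add: mult.commute)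
  also have "\<dots> = cnj (LINT x|lborel. f x * cnj (g x))"
    by (rule Bochner_Integration.integral_cnj)
  finally show "(LINT x|lborel. g x * cnj (f x)) = cnj (LINT x|lborel. f x * cnj (g x))" .
qed

lemma cinner_add_right: "cinner f (g + h) = cinner f g + cinner f h"
  by (subst (1 2 3) cinner_commute) (simp add: cinner_add_left)

lemma cinner_scaleC_right [simp]: "cinner f (c *\<^sub>C g) = cnj c * cinner f g"
  by (subst (1 2) cinner_commute) simp

lemma cinner_scaleR_left [simp]: "cinner (r *\<^sub>R f) h = of_real r * cinner f h"
  by (simp add: scaleR_scaleC)

lemma cinner_scaleR_right [simp]: "cinner f (r *\<^sub>R g) = of_real r * cinner f g"
  by (simp add: scaleR_scaleC)

lemma cinner_self: "cinner f f = of_real ((norm f)\<^sup>2)"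
proof -
  have "Im (cinner f f) = 0"
    using arg_cong[OF cinner_commute[of f f], of Im] by simp
  moreover have "Re (cinner f f) = (norm f)\<^sup>2"
    by (simp add: power2_norm_eq_inner inner_L2_def)
  ultimately show ?thesis
    by (simp add: complex_eq_iff)
qed

lemma norm_scaleC [simp]: "norm (c *\<^sub>C f) = cmod c * norm f"
proof -
  have "complex_of_real ((norm (c *\<^sub>C f))\<^sup>2) = c * cnj c * of_real ((norm f)\<^sup>2)"
    unfolding cinner_self[symmetric] by simp
  then have "complex_of_real ((norm (c *\<^sub>C f))\<^sup>2) = of_real ((cmod c * norm f)\<^sup>2)"
    by (simp add: power_mult_distrib flip: complex_norm_square)
  then have "(norm (c *\<^sub>C f))\<^sup>2 = (cmod c * norm f)\<^sup>2"
    by (simp only: of_real_eq_iff)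
  then show ?thesis
    by (simp add: power2_eq_iff_nonneg)
qed

lemma cinner_bound: "cmod (cinner f g) \<le> norm f * norm g"
proof (cases "cinner f g = 0")
  case False
  define c where "c = cnj (sgn (cinner f g))"
  have c: "cmod c = 1" using False by (simp add: c_def norm_sgn)
  have "cmod (cinner f g) = Re (cinner (c *\<^sub>C f) g)"
  proof -
    have "cinner f g * cnj (cinner f g) = of_real (cmod (cinner f g)) * of_real (cmod (cinner f g))"
      by (simp add: power2_eq_square flip: complex_norm_square)
    then have "cinner (c *\<^sub>C f) g = of_real (cmod (cinner f g))"
      using False by (simp add: c_def sgn_eq mult.commute)
    then show ?thesis by simp
  qed
  also have "\<dots> = inner (c *\<^sub>C f) g" by (simp add: inner_L2_def)
  also have "\<dots> \<le> norm (c *\<^sub>C f) * norm g" by (rule norm_cauchy_schwarz)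
  finally show ?thesis by (simp add: c)
qed auto

lemma bounded_linear_cinner_left: "bounded_linear (\<lambda>f. cinner f g)"
  by (rule bounded_linear_intro[of _ "norm g"])
     (use cinner_bound in \<open>auto simp: cinner_add_left scaleR_conv_of_real\<close>)

lemma bounded_linear_cinner_right: "bounded_linear (\<lambda>g. cinner f g)"
  by (rule bounded_linear_intro[of _ "norm f"])
     (use cinner_bound[of f] in \<open>auto simp: cinner_add_right scaleR_conv_of_real mult.commute\<close>)

lemma bounded_linear_scaleC: "bounded_linear (\<lambda>f::'a::euclidean_space L2. c *\<^sub>C f)"
  by (rule bounded_linear_intro[of _ "cmod c"])
     (auto simp: L2.scale_right_distrib scaleR_scaleC mult.commute)

lemma bounded_linear_scaleC_left: "bounded_linear (\<lambda>c. c *\<^sub>C (f::'a::euclidean_space L2))"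
  by (rule bounded_linear_intro[of _ "norm f"])
     (auto simp: L2.scale_left_distrib scaleR_scaleC scaleR_conv_of_real)

lemma scaleR_L2_scaleC_commute: "c *\<^sub>C r *\<^sub>R (f :: 'a::euclidean_space L2) = r *\<^sub>R c *\<^sub>C f"
  by (simp add: scaleR_scaleC mult.commute)

lemma cinner_zero_left [simp]: "cinner 0 g = 0"
  using cinner_scaleC_left[of 0 0 g] by simp

lemma cinner_zero_right [simp]: "cinner f 0 = 0"
  using cinner_scaleC_right[of f 0 0] by simp

lemma cinner_diff_left: "cinner (f - g) h = cinner f h - cinner g h"
  by (rule bounded_linear.linear[OF bounded_linear_cinner_left, THEN linear_diff])

lemma cinner_diff_right: "cinner f (g - h) = cinner f g - cinner f h"
  by (rule bounded_linear.linear[OF bounded_linear_cinner_right, THEN linear_diff])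

lemma cinner_sum_left: "cinner (\<Sum>i\<in>I. f i) h = (\<Sum>i\<in>I. cinner (f i) h)"
  by (rule bounded_linear.linear[OF bounded_linear_cinner_left, THEN linear_sum])

lemma cinner_sum_right: "cinner h (\<Sum>i\<in>I. f i) = (\<Sum>i\<in>I. cinner h (f i))"
  by (rule bounded_linear.linear[OF bounded_linear_cinner_right, THEN linear_sum])

lemma norm_abs_L2: 
  assumes "square_int u" shows "(norm (abs_L2 u))\<^sup>2 = (LINT x|lborel. (cmod (u x))\<^sup>2)"
proof -
  have "complex_of_real ((norm (abs_L2 u))\<^sup>2) = (LINT x|lborel. u x * cnj (u x))"
    using assms by (simp only: cinner_abs_L2 flip: cinner_self)
  also have "\<dots> = of_real (LINT x|lborel. (cmod (u x))\<^sup>2)"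
    unfolding complex_norm_square[symmetric] by (rule integral_complex_of_real)
  finally show ?thesis by (simp only: of_real_eq_iff)
qed

section \<open>Completeness and orthogonal series\<close>

lemma square_int_of_nn_bound:
  fixes u :: "'a::euclidean_space \<Rightarrow> complex"
  assumes [measurable]: "u \<in> borel_measurable lborel"
    and le: "(\<integral>\<^sup>+x. ennreal ((cmod (u x))\<^sup>2) \<partial>lborel) \<le> ennreal c" and c: "c \<ge> 0"
  shows "square_int u" "(norm (abs_L2 u))\<^sup>2 \<le> c"
proof -
  have i: "integrable lborel (\<lambda>x. (cmod (u x))\<^sup>2)"
  proof (rule integrableI_nonneg)
    show "(\<integral>\<^sup>+x. ennreal ((cmod (u x))\<^sup>2) \<partial>lborel) < \<infinity>"
      using le by (rule order.strict_trans1) simp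
  qed auto
  then show sq: "square_int u" by (simp add: square_int_def)
  have "ennreal (LINT x|lborel. (cmod (u x))\<^sup>2) \<le> ennreal c"
    using le by (subst (asm) nn_integral_eq_integral[OF i]) auto
  then show "(norm (abs_L2 u))\<^sup>2 \<le> c"
    using c by (simp add: norm_abs_L2[OF sq])
qed

lemma nn_integral_square_int:
  "square_int u \<Longrightarrow> (\<integral>\<^sup>+x. ennreal ((cmod (u x))\<^sup>2) \<partial>lborel) = ennreal ((norm (abs_L2 u))\<^sup>2)"
  by (simp add: norm_abs_L2 nn_integral_eq_integral square_int_def)

text \<open>Weighting the squared increments by \<open>2\<^sup>n\<close> leaves their integrals summable, so almost everywhere the
weighted squares are bounded in \<open>n\<close>. The increments then decay geometrically. Working with squares
avoids the \<open>L\<^sup>2\<close> triangle inequality for infinite sums.\<close>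

lemma rapid_Cauchy_AE_convergent:
  fixes u :: "nat \<Rightarrow> 'a::euclidean_space \<Rightarrow> complex"
  assumes u: "\<And>n. square_int (u n)"
    and close: "\<And>n. norm (abs_L2 (\<lambda>x. u (Suc n) x - u n x)) \<le> (1/2) ^ n"
  shows "AE x in lborel. convergent (\<lambda>n. u n x)"
proof -
  have [measurable]: "u n \<in> borel_measurable lborel" for n
    using u by (simp add: square_int_def)
  define D where "D n x = 2 ^ n * (cmod (u (Suc n) x - u n x))\<^sup>2" for n x
  have [measurable]: "D n \<in> borel_measurable lborel" for n
    unfolding D_def by measurable
  have D: "(\<integral>\<^sup>+x. ennreal (D n x) \<partial>lborel) \<le> ennreal ((1/2) ^ n)" for n
  proof -
    have "(\<integral>\<^sup>+x. ennreal (D n x) \<partial>lborel)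
        = ennreal (2 ^ n) * (\<integral>\<^sup>+x. ennreal ((cmod (u (Suc n) x - u n x))\<^sup>2) \<partial>lborel)"
      unfolding D_def by (simp add: ennreal_mult nn_integral_cmult)
    also have "\<dots> = ennreal (2 ^ n * (norm (abs_L2 (\<lambda>x. u (Suc n) x - u n x)))\<^sup>2)"
      by (simp add: nn_integral_square_int square_int_diff u ennreal_mult)
    also have "\<dots> \<le> ennreal (2 ^ n * ((1/2) ^ n)\<^sup>2)"
      using close by (intro ennreal_leI mult_left_mono power_mono) auto
    also have "2 ^ n * ((1/2) ^ n)\<^sup>2 = ((1/2) ^ n :: real)"
      by (simp add: power2_eq_square power_divide)
    finally show ?thesis .
  qed
  have "(\<integral>\<^sup>+x. (\<Sum>n. ennreal (D n x)) \<partial>lborel) = (\<Sum>n. \<integral>\<^sup>+x. ennreal (D n x) \<partial>lborel)"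
    by (rule nn_integral_suminf) measurable
  also have "\<dots> \<le> (\<Sum>n. ennreal ((1/2) ^ n))"
    by (rule suminf_le) (use D in auto)
  also have "\<dots> = ennreal (\<Sum>n. (1/2) ^ n)"
    by (rule suminf_ennreal2) (auto intro: summable_geometric)
  also have "\<dots> < \<infinity>" by simp
  finally have "AE x in lborel. (\<Sum>n. ennreal (D n x)) \<noteq> \<infinity>"
    by (intro nn_integral_noteq_infinite) auto
  then show ?thesis
  proof eventually_elim
    case (elim x)
    then have "summable (\<lambda>n. D n x)"
      by (intro summable_suminf_not_top) (auto simp: D_def)
    then have "Bseq (\<lambda>n. D n x)"
      using summable_LIMSEQ_zero convergentI Bseq_eq_bounded by (blast intro: convergent_imp_Bseq)
    then obtain K where K: "K > 0" "\<And>n. norm (D n x) \<le> K"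
      by (auto simp: Bseq_def)
    have bd: "norm (u (Suc n) x - u n x) \<le> sqrt K * (1 / sqrt 2) ^ n" for n
    proof -
      have "2 ^ n * (cmod (u (Suc n) x - u n x))\<^sup>2 \<le> K"
        using K(2)[of n] by (simp add: D_def)
      then have "(cmod (u (Suc n) x - u n x))\<^sup>2 \<le> K / 2 ^ n"
        by (simp add: field_simps)
      then have "cmod (u (Suc n) x - u n x) \<le> sqrt (K / 2 ^ n)"
        by (rule real_le_rsqrt)
      then show ?thesis
        by (simp add: real_sqrt_divide real_sqrt_power power_divide)
    qed
    have geo: "summable (\<lambda>n. sqrt K * (1 / sqrt 2) ^ n)"
      by (intro summable_mult summable_geometric) (simp add: real_less_lsqrt)
    have "summable (\<lambda>n. u (Suc n) x - u n x)"
      by (rule summable_comparison_test'[OF geo, of 0]) (rule bd)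
    then have "convergent (\<lambda>n. (\<Sum>i<n. u (Suc i) x - u i x) + u 0 x)"
      by (intro convergent_add convergent_const) (auto simp: summable_iff_convergent)
    then show ?case
      by (simp add: sum_lessThan_telescope[of "\<lambda>n. u n x"])
  qed
qed

text \<open>Riesz--Fischer: a rapidly convergent subsequence converges almost everywhere, and Fatou's lemma
turns the pointwise limit into an \<open>L\<^sup>2\<close> limit.\<close>

instance L2 :: (euclidean_space) banach
proof
  fix X :: "nat \<Rightarrow> 'a L2" assume X: "Cauchy X"
  have "\<exists>M. \<forall>m\<ge>M. \<forall>n\<ge>M. dist (X m) (X n) < (1/2) ^ k" for k
    using X by (intro metric_CauchyD) auto
  then obtain M where M: "\<And>k m n. m \<ge> M k \<Longrightarrow> n \<ge> M k \<Longrightarrow> dist (X m) (X n) < (1/2) ^ k"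
    by metis
  define r where "r n = n + (\<Sum>k\<le>n. M k)" for n
  have r: "strict_mono r"
    by (rule strict_monoI_Suc) (simp add: r_def)
  have rM: "r m \<ge> M k" if "m \<ge> k" for m k
    using member_le_sum[of k "{..m}" M] that by (simp add: r_def)
  define u where "u n = rep_L2 (X (r n))" for n
  have u: "square_int (u n)" "abs_L2 (u n) = X (r n)" for n
    using Quotient3_rep_reflp[OF Quotient3_L2, of "X (r n)"]
      Quotient3_abs_rep[OF Quotient3_L2, of "X (r n)"]
    by (simp_all add: u_def)
  have [measurable]: "u n \<in> borel_measurable lborel" for n
    using u by (simp add: square_int_def)
  have close: "norm (abs_L2 (\<lambda>x. u m x - u n x)) \<le> (1/2) ^ n" if "m \<ge> n" for m n
    using M[OF rM[OF that] rM[of n n]] that by (simp add: u dist_norm flip: abs_L2_diff)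
  have AE: "AE x in lborel. convergent (\<lambda>n. u n x)"
    by (rule rapid_Cauchy_AE_convergent) (use u close in auto)
  define f where "f x = lim (\<lambda>n. u n x)" for x
  have [measurable]: "f \<in> borel_measurable lborel"
    unfolding f_def by measurable
  have le: "(\<integral>\<^sup>+x. ennreal ((cmod (f x - u n x))\<^sup>2) \<partial>lborel) \<le> ennreal (((1/2) ^ n)\<^sup>2)" for n
  proof -
    have "(\<integral>\<^sup>+x. ennreal ((cmod (f x - u n x))\<^sup>2) \<partial>lborel)
        = (\<integral>\<^sup>+x. liminf (\<lambda>m. ennreal ((cmod (u m x - u n x))\<^sup>2)) \<partial>lborel)"
    proof (rule nn_integral_cong_AE, use AE in eventually_elim)
      case (elim x)
      then have "(\<lambda>m. u m x) \<longlonglongrightarrow> f x"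
        by (simp add: f_def convergent_LIMSEQ_iff)
      then have "(\<lambda>m. ennreal ((cmod (u m x - u n x))\<^sup>2)) \<longlonglongrightarrow> ennreal ((cmod (f x - u n x))\<^sup>2)"
        by (intro tendsto_intros tendsto_ennrealI)
      then show ?case
        by (intro lim_imp_Liminf[symmetric]) auto
    qed
    also have "\<dots> \<le> liminf (\<lambda>m. \<integral>\<^sup>+x. ennreal ((cmod (u m x - u n x))\<^sup>2) \<partial>lborel)"
      by (rule nn_integral_liminf) measurable
    also have "\<dots> \<le> liminf (\<lambda>m::nat. ennreal (((1/2) ^ n)\<^sup>2))"
    proof (rule Liminf_mono)
      show "\<forall>\<^sub>F m in sequentially. (\<integral>\<^sup>+x. ennreal ((cmod (u m x - u n x))\<^sup>2) \<partial>lborel)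
          \<le> ennreal (((1/2) ^ n)\<^sup>2)"
        using eventually_ge_at_top[of n]
      proof eventually_elim
        case (elim m)
        show ?case
          unfolding nn_integral_square_int[OF square_int_diff[OF u(1) u(1)]]
          using close[OF elim] by (intro ennreal_leI power_mono) auto
      qed
    qed
    finally show ?thesis by (simp add: Liminf_const)
  qed
  have sq: "square_int (\<lambda>x. f x - u n x)" and nb: "(norm (abs_L2 (\<lambda>x. f x - u n x)))\<^sup>2 \<le> ((1/2) ^ n)\<^sup>2" for n
    using square_int_of_nn_bound[OF _ le] by auto
  have f: "square_int f"
    using square_int_add[OF sq[of 0] u(1)[of 0]] by simp
  have "norm (X (r n) - abs_L2 f) \<le> (1/2) ^ n" for n
    using power2_le_imp_le[OF nb[of n]] unfolding abs_L2_diff[OF f u(1), symmetric] u(2)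
    by (simp add: norm_minus_commute)
  then have "(\<lambda>n. X (r n) - abs_L2 f) \<longlonglongrightarrow> 0"
    by (intro Lim_null_comparison[OF _ LIMSEQ_realpow_zero[of "1/2"]]) auto
  then have "(X \<circ> r) \<longlonglongrightarrow> abs_L2 f"
    by (simp add: LIM_zero_iff o_def)
  then show "convergent X"
    using Cauchy_converges_subseq[OF X r] by (auto simp: convergent_def)
qed

text \<open>By Pythagoras, the norm of a block of the series is controlled by the corresponding block of the
series of squared norms. Absolute summability would not do: for elements of \<^const>\<open>V_space\<close> the norms
themselves need not be summable.\<close>

lemma orthogonal_summable:
  fixes f :: "'i \<Rightarrow> 'b::{real_inner,banach}"
  assumes orth: "\<And>i j. i \<noteq> j \<Longrightarrow> inner (f i) (f j) = 0"
    and summ: "(\<lambda>i. (norm (f i))\<^sup>2) summable_on UNIV"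
  shows "f summable_on UNIV"
proof -
  have "\<exists>P. eventually P (finite_subsets_at_top UNIV) \<and>
              (\<forall>F F'. P F \<and> P F' \<longrightarrow> dist (sum f F) (sum f F') < e)" if "e > 0" for e
  proof -
    define s where "s = infsum (\<lambda>i. (norm (f i))\<^sup>2) UNIV"
    have hs: "((\<lambda>i. (norm (f i))\<^sup>2) has_sum s) UNIV"
      using summ by (simp add: s_def)
    have "(e / 2)\<^sup>2 > 0" using that by simp
    then have "\<forall>\<^sub>F F in finite_subsets_at_top UNIV. dist (\<Sum>i\<in>F. (norm (f i))\<^sup>2) s < (e / 2)\<^sup>2"
      using hs unfolding has_sum_def tendsto_iff by blast
    then obtain F0 where F0: "finite F0" "dist (\<Sum>i\<in>F0. (norm (f i))\<^sup>2) s < (e / 2)\<^sup>2"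
      unfolding eventually_finite_subsets_at_top by blast
    have tail: "norm (sum f F - sum f F0) < e / 2" if F: "finite F" "F0 \<subseteq> F" for F
    proof -
      have eq: "sum f F - sum f F0 = sum f (F - F0)"
        using F by (simp add: sum_diff)
      have "(norm (sum f (F - F0)))\<^sup>2 = (\<Sum>i\<in>F - F0. (norm (f i))\<^sup>2)"
        by (rule norm_sum_Pythagorean) (use F orth in \<open>auto simp: pairwise_def orthogonal_def\<close>)
      also have "\<dots> = (\<Sum>i\<in>F. (norm (f i))\<^sup>2) - (\<Sum>i\<in>F0. (norm (f i))\<^sup>2)"
        using F by (simp add: sum_diff)
      also have "\<dots> \<le> s - (\<Sum>i\<in>F0. (norm (f i))\<^sup>2)"
        using finite_sum_le_has_sum[OF hs F(1)] by simp
      also have "\<dots> < (e / 2)\<^sup>2"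
        using F0(2) by (simp add: dist_real_def)
      finally show ?thesis
        using \<open>e > 0\<close> unfolding eq by (intro power2_less_imp_less[of _ "e/2"]) auto
    qed
    define P where "P F \<longleftrightarrow> finite F \<and> F0 \<subseteq> F" for F
    have "eventually P (finite_subsets_at_top UNIV)"
      using F0(1) by (auto simp: eventually_finite_subsets_at_top P_def)
    moreover have "dist (sum f F) (sum f F') < e" if "P F" "P F'" for F F'
    proof -
      have "dist (sum f F) (sum f F') \<le> dist (sum f F) (sum f F0) + dist (sum f F') (sum f F0)"
        by (rule dist_triangle2)
      also have "\<dots> < e / 2 + e / 2"
        using that tail by (intro add_strict_mono) (auto simp: P_def dist_norm)
      finally show ?thesis by simp
    qed
    ultimately show ?thesis by blast
  qed
  then have "cauchy_filter (filtermap (sum f) (finite_subsets_at_top UNIV))"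
    by (simp add: cauchy_filter_metric_filtermap)
  moreover have "uniform_space_class.complete (UNIV :: 'b set)"
    by (rule complete_UNIV)
  ultimately obtain L where "(sum f \<longlongrightarrow> L) (finite_subsets_at_top UNIV)"
    using complete_uniform[where S=UNIV] by (force simp add: filterlim_def)
  then show ?thesis
    using summable_on_def has_sum_def by blast
qed

section \<open>Operators defined by duality\<close>

lemma square_int_bounded_mult:
  assumes "square_int f" and [measurable]: "m \<in> borel_measurable lborel" and C: "\<And>x. cmod (m x) \<le> C"
  shows "square_int (\<lambda>x. m x * f x)"
proof -
  have [measurable]: "f \<in> borel_measurable lborel" using assms(1) by (simp add: square_int_def)
  have "integrable lborel (\<lambda>x. C\<^sup>2 * (cmod (f x))\<^sup>2)"
    using assms(1) by (auto simp: square_int_def)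
  then have "integrable lborel (\<lambda>x. (cmod (m x * f x))\<^sup>2)"
  proof (rule Bochner_Integration.integrable_bound)
    have "(cmod (m x))\<^sup>2 \<le> C\<^sup>2" for x
      using C by (intro power_mono) auto
    then show "AE x in lborel. norm ((cmod (m x * f x))\<^sup>2) \<le> norm (C\<^sup>2 * (cmod (f x))\<^sup>2)"
      by (auto simp: norm_mult power_mult_distrib abs_mult intro!: mult_right_mono AE_I2)
  qed measurable
  then show ?thesis by (simp add: square_int_def)
qed

lemma square_int_AE_cong:
  assumes "square_int f" and [measurable]: "g \<in> borel_measurable lborel"
    and ae: "AE x in lborel. f x = g x"
  shows "square_int g"
proof -
  have [measurable]: "f \<in> borel_measurable lborel" using assms(1) by (simp add: square_int_def)
  have "integrable lborel (\<lambda>x. (cmod (f x))\<^sup>2) \<longleftrightarrow> integrable lborel (\<lambda>x. (cmod (g x))\<^sup>2)"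
    by (rule integrable_cong_AE) (use ae in auto)
  then show ?thesis using assms(1) by (simp add: square_int_def)
qed

lemma square_int_zero_AE:
  assumes "square_int f" "cinner (abs_L2 f) (abs_L2 f) = 0"
  shows "AE x in lborel. f x = 0"
proof -
  have "abs_L2 f = 0" using assms(2) by (simp add: cinner_self)
  then show ?thesis
    using abs_L2_eq_iff[OF assms(1) square_int_zero] by (simp add: zero_L2_def)
qed

text \<open>The unbounded operators are adjoints of operators on test vectors: \<open>g\<close> is the image of \<open>f\<close> iff
\<open>\<langle>g, h\<rangle> = \<langle>f, h'\<rangle>\<close> for every test vector \<open>h\<close> with image \<open>h'\<close>. In this form linearity and
closedness need no analysis.\<close>

definition dual_rel :: "('a::euclidean_space L2 \<times> 'a L2) set \<Rightarrow> 'a L2 \<Rightarrow> 'a L2 \<Rightarrow> bool" where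
  "dual_rel T f g \<longleftrightarrow> (\<forall>(h, h')\<in>T. cinner g h = cinner f h')"

lemma dual_rel_zero: "dual_rel T 0 0"
  by (simp add: dual_rel_def)

lemma dual_rel_add: "dual_rel T f g \<Longrightarrow> dual_rel T f' g' \<Longrightarrow> dual_rel T (f + f') (g + g')"
  by (fastforce simp: dual_rel_def cinner_add_left)

lemma dual_rel_scaleC: "dual_rel T f g \<Longrightarrow> dual_rel T (c *\<^sub>C f) (c *\<^sub>C g)"
  by (fastforce simp: dual_rel_def)

text \<open>Closedness of an adjoint operator, in the form needed for series: both sides of the defining
identity are continuous in the first argument.\<close>

lemma dual_rel_has_sum:
  assumes "(f has_sum F) A" "(g has_sum G) A" "\<And>k. k \<in> A \<Longrightarrow> dual_rel T (f k) (g k)"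
  shows "dual_rel T F G"
  unfolding dual_rel_def
proof clarify
  fix h h' assume h: "(h, h') \<in> T"
  have 1: "((\<lambda>k. cinner (g k) h) has_sum cinner G h) A"
    using has_sum_bounded_linear[OF bounded_linear_cinner_left assms(2)] .
  have "((\<lambda>k. cinner (f k) h') has_sum cinner F h') A"
    using has_sum_bounded_linear[OF bounded_linear_cinner_left assms(1)] .
  also have "?this \<longleftrightarrow> ((\<lambda>k. cinner (g k) h) has_sum cinner F h') A"
    by (rule has_sum_cong) (use assms(3) h in \<open>fastforce simp: dual_rel_def\<close>)
  finally show "cinner G h = cinner F h'"
    using 1 has_sum_unique by blast
qed

definition mult_rel :: "'a::euclidean_space \<Rightarrow> 'a L2 \<Rightarrow> 'a L2 \<Rightarrow> bool" where
  "mult_rel v f g \<longleftrightarrow> (\<exists>u. square_int u \<and> square_int (\<lambda>x. of_real (x \<bullet> v) * u x) \<and>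
     f = abs_L2 u \<and> g = abs_L2 (\<lambda>x. of_real (x \<bullet> v) * u x))"

definition mult_tests :: "'a::euclidean_space \<Rightarrow> ('a L2 \<times> 'a L2) set" where
  "mult_tests v = {(abs_L2 w, abs_L2 (\<lambda>x. of_real (x \<bullet> v) * w x)) | w.
     square_int w \<and> square_int (\<lambda>x. of_real (x \<bullet> v) * w x)}"

lemma mult_rel_coord_mult: "mult_rel v f g \<Longrightarrow> coord_mult v f = g"
  by (auto simp: mult_rel_def coord_mult.abs_eq)

text \<open>The weak description determines the product, because the difference \<open>g - x_v f\<close>, cut down to a ball,
is itself an admissible test vector.\<close>

lemma mult_rel_iff: "mult_rel v f g \<longleftrightarrow> dual_rel (mult_tests v) f g"
proof
  assume "mult_rel v f g"
  then show "dual_rel (mult_tests v) f g"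
    by (auto simp: mult_rel_def dual_rel_def mult_tests_def cinner_abs_L2 mult_ac)
next
  assume d: "dual_rel (mult_tests v) f g"
  obtain u where u: "square_int u" "f = abs_L2 u" by (rule L2_cases)
  obtain k where k: "square_int k" "g = abs_L2 k" by (rule L2_cases)
  have [measurable]: "u \<in> borel_measurable lborel" "k \<in> borel_measurable lborel"
    using u k by (auto simp: square_int_def)
  have "AE x in lborel. x \<in> ball 0 (real n) \<longrightarrow> k x = of_real (x \<bullet> v) * u x" for n
  proof -
    let ?m = "\<lambda>x. indicator (ball 0 (real n)) x * complex_of_real (x \<bullet> v)"
    have m [measurable]: "?m \<in> borel_measurable lborel"
      by (intro borel_measurable_times borel_measurable_indicator) auto
    have ib: "(indicator (ball 0 (real n)) :: 'a \<Rightarrow> complex) \<in> borel_measurable lborel"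
      by (intro borel_measurable_indicator) auto
    \<comment> \<open>the difference restricted to a ball, on which the multiplier is bounded\<close>
    define w where "w x = indicator (ball 0 (real n)) x * k x - ?m x * u x" for x
    have mb: "cmod (?m x) \<le> real n * norm v" for x
    proof (cases "x \<in> ball 0 (real n)")
      case True
      have "\<bar>x \<bullet> v\<bar> \<le> norm x * norm v" by (rule Cauchy_Schwarz_ineq2)
      also have "\<dots> \<le> real n * norm v" using True by (intro mult_right_mono) auto
      finally show ?thesis using True by simp
    qed simp
    have w: "square_int w"
      unfolding w_def by (intro square_int_diff square_int_bounded_mult[where C=1] 
         square_int_bounded_mult[where C="real n * norm v"] u(1) k(1) mb m ib) (auto simp: indicator_def)
    have eq: "of_real (x \<bullet> v) * w x = ?m x * w x" for x
      by (simp add: w_def indicator_def)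
    have xw: "square_int (\<lambda>x. of_real (x \<bullet> v) * w x)"
      unfolding eq by (intro square_int_bounded_mult[where C="real n * norm v"] w mb) measurable
    have "cinner g (abs_L2 w) = cinner f (abs_L2 (\<lambda>x. of_real (x \<bullet> v) * w x))"
      using d w xw by (auto simp: dual_rel_def mult_tests_def)
    then have "(LINT x|lborel. k x * cnj (w x)) - (LINT x|lborel. u x * cnj (of_real (x \<bullet> v) * w x)) = 0"
      by (simp add: u k w xw cinner_abs_L2)
    then have "(LINT x|lborel. k x * cnj (w x) - u x * cnj (of_real (x \<bullet> v) * w x)) = 0"
      using integrable_mult_cnj[OF k(1) w] integrable_mult_cnj[OF u(1) xw] by simp
    also have "(\<lambda>x. k x * cnj (w x) - u x * cnj (of_real (x \<bullet> v) * w x)) = (\<lambda>x. w x * cnj (w x))"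
      by (auto simp: fun_eq_iff w_def indicator_def algebra_simps)
    finally have "cinner (abs_L2 w) (abs_L2 w) = 0"
      by (simp add: cinner_abs_L2 w)
    from square_int_zero_AE[OF w this] show ?thesis
      by eventually_elim (auto simp: w_def)
  qed
  then have "AE x in lborel. \<forall>n. x \<in> ball 0 (real n) \<longrightarrow> k x = of_real (x \<bullet> v) * u x"
    unfolding AE_all_countable by blast
  then have ae: "AE x in lborel. k x = of_real (x \<bullet> v) * u x"
  proof eventually_elim
    case (elim x)
    obtain n where "norm x < real n" using reals_Archimedean2 by blast
    then show ?case using elim by (auto dest!: spec[of _ n])
  qed
  have "square_int (\<lambda>x. of_real (x \<bullet> v) * u x)"
    by (rule square_int_AE_cong[OF k(1) _ ae]) measurable
  then show "mult_rel v f g"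
    unfolding mult_rel_def using u k ae by (intro exI[of _ u]) (simp add: abs_L2_eq_iff)
qed

section \<open>Test functions and uniqueness of weak derivatives\<close>

lemma test_function_continuous: "test_function \<phi> \<phi>' \<Longrightarrow> continuous_on UNIV \<phi>"
  unfolding test_function_def
  by (auto intro!: continuous_at_imp_continuous_on has_derivative_continuous)

lemma test_function_deriv_outside:
  assumes "test_function \<phi> \<phi>'" "x \<notin> closure {x. \<phi> x \<noteq> 0}"
  shows "\<phi>' x v = 0"
proof -
  have d: "(\<phi> has_derivative \<phi>' x) (at x)" using assms(1) by (simp add: test_function_def)
  have "((\<lambda>_. 0) has_derivative \<phi>' x) (at x)"
    by (rule has_derivative_transform_within_open[OF d, of "- closure {x. \<phi> x \<noteq> 0}"])
       (use assms(2) closure_subset[of "{x. \<phi> x \<noteq> 0}"] in auto)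
  then have "\<phi>' x = (\<lambda>_. 0)"
    using has_derivative_unique has_derivative_const by blast
  then show ?thesis by simp
qed

lemma compact_support_integrable:
  fixes f :: "'a::euclidean_space \<Rightarrow> 'b::{banach, second_countable_topology}"
  assumes "compact K" "continuous_on UNIV f" "\<And>x. x \<notin> K \<Longrightarrow> f x = 0"
  shows "integrable lborel f"
proof -
  have "integrable lborel (\<lambda>x. indicator K x *\<^sub>R f x)"
    by (rule borel_integrable_compact[OF assms(1)]) (use assms(2) continuous_on_subset in blast)
  also have "(\<lambda>x. indicator K x *\<^sub>R f x) = f"
    using assms(3) by (auto simp: fun_eq_iff indicator_def)
  finally show ?thesis .
qed

lemma compact_support_square_int:
  fixes f :: "'a::euclidean_space \<Rightarrow> complex"
  assumes "compact K" "continuous_on UNIV f" "\<And>x. x \<notin> K \<Longrightarrow> f x = 0"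
  shows "square_int f"
  unfolding square_int_def
proof
  show "f \<in> borel_measurable lborel"
    using assms(2) by (simp add: borel_measurable_continuous_onI)
  show "integrable lborel (\<lambda>x. (cmod (f x))\<^sup>2)"
    by (rule compact_support_integrable[OF assms(1)]) (use assms in \<open>auto intro!: continuous_intros\<close>)
qed

lemma test_function_square_int:
  assumes "test_function \<phi> \<phi>'"
  shows "square_int (\<lambda>x. of_real (\<phi> x))" "square_int (\<lambda>x. of_real (\<phi>' x v))"
proof -
  let ?K = "closure {x. \<phi> x \<noteq> 0}"
  have K: "compact ?K" using assms by (simp add: test_function_def)
  show "square_int (\<lambda>x. of_real (\<phi> x))"
    by (rule compact_support_square_int[OF K])
       (use test_function_continuous[OF assms] closure_subset[of "{x. \<phi> x \<noteq> 0}"] in \<open>auto intro!: continuous_intros\<close>)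
  have "continuous_on UNIV (\<lambda>x. \<phi>' x v)" using assms by (simp add: test_function_def)
  then show "square_int (\<lambda>x. of_real (\<phi>' x v))"
    by (intro compact_support_square_int[OF K])
       (auto intro!: continuous_intros simp: test_function_deriv_outside[OF assms])
qed

definition deriv_tests :: "'a::euclidean_space \<Rightarrow> ('a L2 \<times> 'a L2) set" where
  "deriv_tests v = {(abs_L2 (\<lambda>x. of_real (\<phi> x)), - abs_L2 (\<lambda>x. of_real (\<phi>' x v))) | \<phi> \<phi>'.
     test_function \<phi> \<phi>'}"

lemma cinner_minus_right: "cinner f (- g) = - cinner f g"
  using cinner_diff_right[of f 0 g] by simp

lemma has_weak_deriv_iff: "has_weak_deriv f v g \<longleftrightarrow> dual_rel (deriv_tests v) f g"
proof -
  obtain u where u: "square_int u" "f = abs_L2 u" by (rule L2_cases)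
  obtain k where k: "square_int k" "g = abs_L2 k" by (rule L2_cases)
  have "cinner f (abs_L2 (\<lambda>x. of_real (\<phi>' x v))) = (LINT x|lborel. u x * of_real (\<phi>' x v))"
    "cinner g (abs_L2 (\<lambda>x. of_real (\<phi> x))) = (LINT x|lborel. k x * of_real (\<phi> x))"
    if "test_function \<phi> \<phi>'" for \<phi> \<phi>'
    using that by (simp_all add: cinner_abs_L2 test_function_square_int u k)
  then show ?thesis
    unfolding dual_rel_def deriv_tests_def
    by (fastforce simp: u k has_weak_deriv.abs_eq cinner_minus_right)
qed

text \<open>The \<open>C\<^sup>1\<close> truncation from which all bump functions are built.\<close>

definition pos_sq :: "real \<Rightarrow> real" where "pos_sq t = (max 0 t)\<^sup>2"

lemma pos_sq_nonneg [simp]: "pos_sq t \<ge> 0" 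
  and pos_sq_eq_0 [simp]: "pos_sq t = 0 \<longleftrightarrow> t \<le> 0"
  by (auto simp: pos_sq_def)

lemma DERIV_pos_sq: "(pos_sq has_real_derivative 2 * max 0 t) (at t)"
proof (cases t "0::real" rule: linorder_cases)
  case less
  have "((\<lambda>_. 0) has_real_derivative 0) (at t)" by simp
  then have "(pos_sq has_real_derivative 0) (at t)"
    by (rule has_field_derivative_transform_within_open[of _ _ _ "{..<0}"]) (use less in \<open>auto simp: pos_sq_def\<close>)
  then show ?thesis using less by simp
next
  case greater
  have "((\<lambda>t. t\<^sup>2) has_real_derivative 2 * t) (at t)"
    by (auto intro!: derivative_eq_intros)
  then have "(pos_sq has_real_derivative 2 * t) (at t)"
    by (rule has_field_derivative_transform_within_open[of _ _ _ "{0<..}"]) (use greater in \<open>auto simp: pos_sq_def\<close>)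
  then show ?thesis using greater by simp
next
  case equal
  have "(\<lambda>h. (pos_sq (0 + h) - pos_sq 0) / h) \<midarrow>0\<rightarrow> 0"
  proof (rule Lim_null_comparison)
    show "\<forall>\<^sub>F h in at 0. norm ((pos_sq (0 + h) - pos_sq 0) / h) \<le> norm h"
      by (intro always_eventually) (auto simp: pos_sq_def max_def power2_eq_square)
    show "((\<lambda>h::real. norm h) \<longlongrightarrow> 0) (at 0)" by (rule tendsto_norm_zero) (rule tendsto_ident_at)
  qed
  then show ?thesis using equal by (simp add: DERIV_def)
qed

lemma has_derivative_pos_sq:
  "(g has_derivative g') (at x) \<Longrightarrow> ((\<lambda>x. pos_sq (g x)) has_derivative (\<lambda>h. g' h * (2 * max 0 (g x)))) (at x)"
  by (rule DERIV_compose_FDERIV[OF DERIV_pos_sq])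

lemma continuous_on_pos_sq [continuous_intros]:
  "continuous_on S f \<Longrightarrow> continuous_on S (\<lambda>x. pos_sq (f x))"
  unfolding pos_sq_def by (intro continuous_intros)

lemma box_test_function:
  fixes a c :: "'a::euclidean_space"
  obtains \<theta> \<theta>' where "test_function \<theta> \<theta>'" "\<And>x. \<theta> x \<ge> 0" "\<And>x. \<theta> x \<noteq> 0 \<longleftrightarrow> x \<in> box a c"
proof -
  define g where "g b x = pos_sq ((x - a) \<bullet> b) * pos_sq ((c - x) \<bullet> b)" for b x :: 'a
  define g' where "g' b x h = pos_sq ((x - a) \<bullet> b) * (- (h \<bullet> b) * (2 * max 0 ((c - x) \<bullet> b)))
      + (h \<bullet> b) * (2 * max 0 ((x - a) \<bullet> b)) * pos_sq ((c - x) \<bullet> b)" for b x h :: 'a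
  have g: "(g b has_derivative g' b x) (at x)" for b x
    unfolding g_def g'_def
    by (intro has_derivative_mult has_derivative_pos_sq) (auto intro!: derivative_eq_intros)
  define \<theta> where "\<theta> x = (\<Prod>b\<in>Basis. g b x)" for x
  define \<theta>' where "\<theta>' x h = (\<Sum>b\<in>Basis. g' b x h * (\<Prod>d\<in>Basis - {b}. g d x))" for x h
  have nz: "\<theta> x \<noteq> 0 \<longleftrightarrow> x \<in> box a c" for x
    by (auto simp: \<theta>_def g_def mem_box inner_diff_left)
  show ?thesis
  proof
    show "\<theta> x \<ge> 0" for x
      unfolding \<theta>_def g_def by (intro prod_nonneg) simp
    show "\<theta> x \<noteq> 0 \<longleftrightarrow> x \<in> box a c" for x by (rule nz)
    have "(\<theta> has_derivative \<theta>' x) (at x)" for x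
      unfolding \<theta>_def \<theta>'_def by (intro has_derivative_prod g)
    moreover have "continuous_on UNIV (\<lambda>x. \<theta>' x h)" for h
      unfolding \<theta>'_def g'_def g_def by (intro continuous_intros)
    moreover have "compact (closure {x. \<theta> x \<noteq> 0})"
      unfolding nz by (simp add: compact_closure bounded_box)
    ultimately show "test_function \<theta> \<theta>'"
      by (simp add: test_function_def)
  qed
qed

text \<open>Composition with \<open>t \<mapsto> 1 - exp (- c t)\<close> keeps a test function a test function, and for \<open>c \<rightarrow> \<infinity>\<close>
turns a nonnegative one into the indicator of the set where it is positive.\<close>

lemma test_function_saturate:
  assumes "test_function \<theta> \<theta>'"
  shows "test_function (\<lambda>x. 1 - exp (- (c * \<theta> x))) (\<lambda>x h. exp (- (c * \<theta> x)) * (c * \<theta>' x h))"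
proof -
  have "((\<lambda>x. 1 - exp (- (c * \<theta> x))) has_derivative (\<lambda>h. exp (- (c * \<theta> x)) * (c * \<theta>' x h))) (at x)" for x
    by (rule derivative_eq_intros refl | use assms in \<open>force simp: test_function_def\<close>)+
  moreover have "continuous_on UNIV (\<lambda>x. exp (- (c * \<theta> x)) * (c * \<theta>' x h))" for h
    using assms test_function_continuous[OF assms] by (intro continuous_intros) (auto simp: test_function_def)
  moreover have "compact (closure {x. 1 - exp (- (c * \<theta> x)) \<noteq> 0})"
    unfolding compact_closure
    by (rule bounded_subset[of "{x. \<theta> x \<noteq> 0}"]) (use assms in \<open>auto simp: test_function_def compact_closure\<close>)
  ultimately show ?thesis by (simp add: test_function_def)
qed

lemma cnj_indicator: "cnj (indicator A x) = indicator A x"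
  by (simp add: indicator_def)

lemma square_int_indicator_box: "square_int (indicator (box a c) :: 'a::euclidean_space \<Rightarrow> complex)"
proof -
  have "(\<lambda>x::'a. (cmod (indicator (box a c) x))\<^sup>2) = (indicator (box a c) :: 'a \<Rightarrow> real)"
    by (auto simp: indicator_def fun_eq_iff)
  moreover have "integrable lborel (indicator (box a c) :: 'a \<Rightarrow> real)"
    by (intro integrable_real_indicator emeasure_bounded_finite bounded_box) auto
  ultimately show ?thesis by (simp add: square_int_def)
qed

lemma integral_box_zero:
  assumes u: "square_int u"
    and test: "\<And>\<phi> \<phi>'. test_function \<phi> \<phi>' \<Longrightarrow> (LINT x|lborel. u x * of_real (\<phi> x)) = 0"
  shows "(LINT x|lborel. u x * indicator (box a c) x) = 0"
proof -
  obtain \<theta> \<theta>' where \<theta>: "test_function \<theta> \<theta>'" "\<And>x. \<theta> x \<ge> 0" "\<And>x. \<theta> x \<noteq> 0 \<longleftrightarrow> x \<in> box a c"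
    using box_test_function[of a c] by blast
  have [measurable]: "u \<in> borel_measurable lborel" using u by (auto simp: square_int_def)
  have [measurable]: "\<theta> \<in> borel_measurable borel"
    using test_function_continuous[OF \<theta>(1)] by (simp add: borel_measurable_continuous_onI)
  define f where "f n x = u x * of_real (1 - exp (- (real n * \<theta> x)))" for n x
  from integrable_mult_cnj[OF u square_int_indicator_box[of a c]]
  have i: "integrable lborel (\<lambda>x. u x * indicator (box a c) x)" 
    by (simp only: cnj_indicator)
  have "(\<lambda>n. LINT x|lborel. f n x) \<longlonglongrightarrow> (LINT x|lborel. u x * indicator (box a c) x)"
  proof (rule integral_dominated_convergence)
    show "integrable lborel (\<lambda>x. cmod (u x * indicator (box a c) x))"
      using i by (rule integrable_norm)
    show "AE x in lborel. (\<lambda>n. f n x) \<longlonglongrightarrow> u x * indicator (box a c) x"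
    proof (rule AE_I2)
      fix x
      show "(\<lambda>n. f n x) \<longlonglongrightarrow> u x * indicator (box a c) x"
      proof (cases "x \<in> box a c")
        case True
        then have pos: "\<theta> x > 0" using \<theta>(2,3) by (metis less_eq_real_def)
        have "(\<lambda>n. exp (- (real n * \<theta> x))) \<longlonglongrightarrow> 0"
          using pos by (intro filterlim_compose[OF exp_at_bot] filterlim_compose[OF filterlim_uminus_at_bot_at_top]
             filterlim_at_top_mult_tendsto_pos[OF tendsto_const] filterlim_real_sequentially)
        then have "(\<lambda>n. f n x) \<longlonglongrightarrow> u x * of_real (1 - 0)"
          unfolding f_def by (intro tendsto_intros)
        then show ?thesis using True by simp
      next
        case False
        then have "\<theta> x = 0" using \<theta>(3) by blast
        then show ?thesis using False by (simp add: f_def)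
      qed
    qed
    show "AE x in lborel. norm (f n x) \<le> cmod (u x * indicator (box a c) x)" for n
    proof (rule AE_I2)
      fix x
      have "\<theta> x = 0" if "x \<notin> box a c" using \<theta>(3) that by blast
      moreover have "\<bar>1 - exp (- (real n * \<theta> x))\<bar> \<le> 1"
        using mult_nonneg_nonneg[OF of_nat_0_le_iff \<theta>(2), of n x] by (auto simp: abs_le_iff intro: order_trans)
      moreover have "cmod (f n x) = cmod (u x) * \<bar>1 - exp (- (real n * \<theta> x))\<bar>"
        unfolding f_def norm_mult norm_of_real ..
      ultimately show "norm (f n x) \<le> cmod (u x * indicator (box a c) x)"
        by (cases "x \<in> box a c") (auto simp: norm_mult mult_left_le)
    qed
  qed (auto simp: f_def)
  moreover have "(LINT x|lborel. f n x) = 0" for n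
    unfolding f_def by (rule test[OF test_function_saturate[OF \<theta>(1)]])
  ultimately show ?thesis by (simp add: LIMSEQ_const_iff)
qed

text \<open>Boxes form a generator of the Borel sets that is stable under intersection. The sets on which the
integral vanishes are closed under complement (this is where the vanishing of the total integral
enters) and under disjoint unions.\<close>

lemma integral_boxes_zero_imp_AE:
  fixes u :: "'a::euclidean_space \<Rightarrow> real"
  assumes u: "integrable lborel u" and box: "\<And>a c. (LINT x|lborel. u x * indicator (box a c) x) = 0"
    and tot: "(LINT x|lborel. u x) = 0"
  shows "AE x in lborel. u x = 0"
proof (rule density_unique_real[OF u integrable_zero])
  fix A :: "'a set" assume "A \<in> sets lborel"
  have [measurable]: "u \<in> borel_measurable lborel" using u by auto
  have si: "set_integrable lborel A u" if "A \<in> sets lborel" for A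
    unfolding set_integrable_def using integrable_mult_indicator[OF that u] .
  have "A \<in> sigma_sets UNIV (range (\<lambda>(a, c). box a c :: 'a set))"
    using \<open>A \<in> sets lborel\<close> by (simp add: borel_eq_box)
  then have "(LINT x:A|lborel. u x) = 0"
  proof (rule sigma_sets_induct_disjoint[rotated 2])
    show "Int_stable (range (\<lambda>(a, c). box a c :: 'a set))"
      by (auto simp: Int_stable_def box_Int_box)
  next
    fix A :: "'a set" assume "A \<in> range (\<lambda>(a, c). box a c)"
    then show "(LINT x:A|lborel. u x) = 0" using box by (auto simp: set_lebesgue_integral_def mult.commute)
  next
    show "(LINT x:{}|lborel. u x) = 0" by (simp add: set_lebesgue_integral_def)
  next
    fix A assume compl: "A \<in> sigma_sets UNIV (range (\<lambda>(a, c). box a c :: 'a set))" "(LINT x:A|lborel. u x) = 0"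
    have A: "A \<in> sets lborel" using compl(1) by (simp add: borel_eq_box)
    have "(LINT x:A|lborel. u x) + (LINT x:- A|lborel. u x) = (LINT x:A \<union> - A|lborel. u x)"
      by (rule set_integral_Un[symmetric]) (use A si in auto)
    also have "\<dots> = 0" using tot by (simp add: set_lebesgue_integral_def)
    finally show "(LINT x:UNIV - A|lborel. u x) = 0" using compl(2) by (simp add: Compl_eq_Diff_UNIV)
  next
    fix A :: "nat \<Rightarrow> 'a set" assume union: "disjoint_family A"
      "range A \<subseteq> sigma_sets UNIV (range (\<lambda>(a, c). box a c))" "\<And>i. (LINT x:(A i)|lborel. u x) = 0"
    have A: "A i \<in> sets lborel" for i using union(2) by (auto simp: borel_eq_box)
    have "(LINT x:(\<Union>i. A i)|lborel. u x) = (\<Sum>i. (LINT x:(A i)|lborel. u x))"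
      by (rule lebesgue_integral_countable_add) (use A union(1) si in \<open>auto simp: disjoint_family_on_def\<close>)
    then show "(LINT x:(\<Union>i. A i)|lborel. u x) = 0" using union(3) by simp
  qed auto
  then show "(LINT x:A|lborel. u x) = (LINT x:A|lborel. 0)" by (simp add: set_lebesgue_integral_def)
qed

text \<open>The fundamental lemma of the calculus of variations. A square-integrable function need not be
integrable, so the argument runs on the boxes of an exhaustion.\<close>

lemma integral_tests_zero_imp_AE:
  assumes u: "square_int u"
    and test: "\<And>\<phi> \<phi>'. test_function \<phi> \<phi>' \<Longrightarrow> (LINT x|lborel. u x * of_real (\<phi> x)) = 0"
  shows "AE x in lborel. u x = 0"
proof -
  have [measurable]: "u \<in> borel_measurable lborel" using u by (auto simp: square_int_def)
  have "AE x in lborel. x \<in> box (- real n *\<^sub>R One) (real n *\<^sub>R One) \<longrightarrow> u x = 0" for n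
  proof -
    define B :: "'a set" where "B = box (- real n *\<^sub>R One) (real n *\<^sub>R One)"
    have sqB: "square_int (indicator B :: 'a \<Rightarrow> complex)"
      unfolding B_def by (rule square_int_indicator_box)
    from integrable_mult_cnj[OF u this]
    have i: "integrable lborel (\<lambda>x. u x * indicator B x)" 
      by (simp only: cnj_indicator)
    have zero: "(LINT x|lborel. u x * indicator B x * indicator (box a c) x) = 0" for a c
    proof -
      obtain a' c' where ac: "B \<inter> box a c = box a' c'" unfolding B_def box_Int_box by blast
      have eq: "(\<lambda>x. u x * indicator B x * indicator (box a c) x) = (\<lambda>x. u x * indicator (box a' c') x)"
        unfolding ac[symmetric] by (simp add: indicator_def fun_eq_iff)
      show ?thesis
        unfolding eq by (rule integral_box_zero[OF u]) (rule test)
    qed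
    have ii: "integrable lborel (\<lambda>x. u x * indicator B x * indicator (box a c) x)" for a c
    proof -
      have "integrable lborel (\<lambda>x. indicator (box a c) x *\<^sub>R (u x * indicator B x))"
        by (rule integrable_mult_indicator[OF _ i]) simp
      also have "(\<lambda>x. indicator (box a c) x *\<^sub>R (u x * indicator B x)) = (\<lambda>x. u x * indicator B x * indicator (box a c) x)"
        by (auto simp: indicator_def fun_eq_iff)
      finally show ?thesis .
    qed
    have tot: "(LINT x|lborel. u x * indicator B x) = 0"
      unfolding B_def by (rule integral_box_zero[OF u test])
    have re: "AE x in lborel. Re (u x * indicator B x) = 0"
    proof (rule integral_boxes_zero_imp_AE)
      show "integrable lborel (\<lambda>x. Re (u x * indicator B x))" using i by (rule integrable_Re)
      show "(LINT x|lborel. Re (u x * indicator B x)) = 0" using tot i by (simp only: integral_Re) simp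
      have "(LINT x|lborel. Re (u x * indicator B x * indicator (box a c) x)) = 0" for a c
        using zero[of a c] ii[of a c] by (simp only: integral_Re) simp
      moreover have "Re (u x * indicator B x * indicator (box a c) x)
         = Re (u x * indicator B x) * indicator (box a c) x" for a c x
        by (simp add: indicator_def)
      ultimately show "(LINT x|lborel. Re (u x * indicator B x) * indicator (box a c) x) = 0" for a c
        by simp
    qed
    have im: "AE x in lborel. Im (u x * indicator B x) = 0"
    proof (rule integral_boxes_zero_imp_AE)
      show "integrable lborel (\<lambda>x. Im (u x * indicator B x))" using i by (rule integrable_Im)
      show "(LINT x|lborel. Im (u x * indicator B x)) = 0" using tot i by (simp only: integral_Im) simp
      have "(LINT x|lborel. Im (u x * indicator B x * indicator (box a c) x)) = 0" for a c
        using zero[of a c] ii[of a c] by (simp only: integral_Im) simp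
      moreover have "Im (u x * indicator B x * indicator (box a c) x)
         = Im (u x * indicator B x) * indicator (box a c) x" for a c x
        by (simp add: indicator_def)
      ultimately show "(LINT x|lborel. Im (u x * indicator B x) * indicator (box a c) x) = 0" for a c
        by simp
    qed
    show ?thesis
      using re im unfolding B_def[symmetric] by eventually_elim (auto simp: complex_eq_iff)
  qed
  then have "AE x in lborel. \<forall>n. x \<in> box (- real n *\<^sub>R One) (real n *\<^sub>R One) \<longrightarrow> u x = 0"
    unfolding AE_all_countable by blast
  then show ?thesis
  proof eventually_elim
    case (elim x)
    obtain n where "norm x < real n" using reals_Archimedean2 by blast
    then have "x \<in> box (- real n *\<^sub>R One) (real n *\<^sub>R One)"
      using Basis_le_norm[of _ x] by (force simp: mem_box abs_less_iff abs_le_iff)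
    then show ?case using elim by blast
  qed
qed

lemma weak_deriv_unique:
  assumes "has_weak_deriv f v g" "has_weak_deriv f v g'"
  shows "g = g'"
proof -
  obtain k where k: "square_int k" "g - g' = abs_L2 k" by (rule L2_cases)
  have "(LINT x|lborel. k x * of_real (\<phi> x)) = 0" if t: "test_function \<phi> \<phi>'" for \<phi> \<phi>'
  proof -
    have "(LINT x|lborel. k x * of_real (\<phi> x)) = cinner (g - g') (abs_L2 (\<lambda>x. of_real (\<phi> x)))"
      unfolding k by (simp add: cinner_abs_L2 k test_function_square_int[OF t])
    also have "\<dots> = 0"
      using assms t unfolding has_weak_deriv_iff dual_rel_def deriv_tests_def cinner_diff_left by fastforce
    finally show ?thesis .
  qed
  from integral_tests_zero_imp_AE[OF k(1) this] have "abs_L2 k = abs_L2 (\<lambda>_. 0)"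
    by (simp add: abs_L2_eq_iff k square_int_zero)
  then show ?thesis using k by (simp flip: zero_L2_def)
qed

lemma has_weak_deriv_weak_deriv: "has_weak_deriv f v g \<Longrightarrow> weak_deriv v f = g"
  unfolding weak_deriv_def using weak_deriv_unique by (auto intro!: the_equality)

section \<open>The common domain of lowering and raising\<close>

text \<open>\<open>l\<close> and \<open>r\<close> are the images of \<open>f\<close> under lowering and raising. Stating this through the product with
the coordinate and the weak derivative records that \<open>f\<close> lies in both maximal domains, so that none
of the default values \<open>0\<close> of the total functions is involved.\<close>

definition ladder :: "'a::euclidean_space \<Rightarrow> 'a L2 \<Rightarrow> 'a L2 \<Rightarrow> 'a L2 \<Rightarrow> bool" where
  "ladder v f l r \<longleftrightarrow> mult_rel v f ((1 / sqrt 2) *\<^sub>R (l + r)) \<and> has_weak_deriv f v ((1 / sqrt 2) *\<^sub>R (l - r))"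

lemma half_sqrt2: "(1 / sqrt 2) * (1 / sqrt 2) = (1 / 2 :: real)"
  by (simp add: field_simps)

lemma ladder_lowering_raising:
  assumes "ladder v f l r" shows "lowering v f = l" "raising v f = r"
proof -
  have "coord_mult v f = (1 / sqrt 2) *\<^sub>R (l + r)" "weak_deriv v f = (1 / sqrt 2) *\<^sub>R (l - r)"
    using assms by (auto simp: ladder_def mult_rel_coord_mult has_weak_deriv_weak_deriv)
  moreover have "(1/sqrt 2) *\<^sub>R ((1 / sqrt 2) *\<^sub>R (l + r) + (1 / sqrt 2) *\<^sub>R (l - r)) = l"
    "(1/sqrt 2) *\<^sub>R ((1 / sqrt 2) *\<^sub>R (l + r) - (1 / sqrt 2) *\<^sub>R (l - r)) = r"
    unfolding scaleR_right_distrib scaleR_right_diff_distrib scaleR_scaleR half_sqrt2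
    by (simp_all flip: scaleR_left_distrib)
  ultimately show "lowering v f = l" "raising v f = r"
    by (simp_all add: lowering_def raising_def)
qed

lemma ladder_zero: "ladder v 0 0 0"
  by (simp add: ladder_def mult_rel_iff has_weak_deriv_iff dual_rel_zero)

lemma ladder_add: "ladder v f l r \<Longrightarrow> ladder v f' l' r' \<Longrightarrow> ladder v (f + f') (l + l') (r + r')"
  unfolding ladder_def mult_rel_iff has_weak_deriv_iff
  by (auto dest: dual_rel_add simp: algebra_simps)

lemma ladder_scaleC: "ladder v f l r \<Longrightarrow> ladder v (c *\<^sub>C f) (c *\<^sub>C l) (c *\<^sub>C r)"
  unfolding ladder_def mult_rel_iff has_weak_deriv_iff
  by (metis L2.scale_right_diff_distrib L2.scale_right_distrib dual_rel_scaleC scaleR_L2_scaleC_commute)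

lemma ladder_sum: "(\<And>i. i \<in> I \<Longrightarrow> ladder v (f i) (l i) (r i)) \<Longrightarrow>
   ladder v (\<Sum>i\<in>I. f i) (\<Sum>i\<in>I. l i) (\<Sum>i\<in>I. r i)"
  by (induction I rule: infinite_finite_induct) (auto simp: ladder_zero ladder_add)

lemma ladder_has_sum:
  assumes "(f has_sum F) A" "(l has_sum L) A" "(r has_sum R) A" "\<And>k. k \<in> A \<Longrightarrow> ladder v (f k) (l k) (r k)"
  shows "ladder v F L R"
proof -
  have "((\<lambda>k. (1 / sqrt 2) *\<^sub>R (l k + r k)) has_sum (1 / sqrt 2) *\<^sub>R (L + R)) A"
    by (intro has_sum_scaleR has_sum_add assms)
  moreover have "((\<lambda>k. - r k) has_sum - R) A"
    using assms(3) by (simp add: has_sum_uminus)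
  then have "((\<lambda>k. (1 / sqrt 2) *\<^sub>R (l k + - r k)) has_sum (1 / sqrt 2) *\<^sub>R (L + - R)) A"
    by (intro has_sum_scaleR has_sum_add assms)
  ultimately show ?thesis
    using assms(1,4) unfolding ladder_def mult_rel_iff has_weak_deriv_iff
    by (auto intro: dual_rel_has_sum)
qed

section \<open>Classical derivatives and integration by parts\<close>

lemma lborel_integral_translate:
  fixes f :: "'a::euclidean_space \<Rightarrow> real"
  assumes [measurable]: "f \<in> borel_measurable borel"
  shows "(LINT x|lborel. f (x + c)) = (LINT x|lborel. f x)"
proof -
  have "(LINT x|lborel. f x) = (LINT x|distr lborel borel ((+) c). f x)"
    by (simp add: lborel_distr_plus)
  also have "\<dots> = (LINT x|lborel. f (c + x))"
    by (rule integral_distr) auto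
  finally show ?thesis by (simp add: add.commute)
qed

lemma compact_support_bounded:
  fixes f :: "'a::euclidean_space \<Rightarrow> real"
  assumes "compact K" "continuous_on UNIV f" "\<And>x. x \<notin> K \<Longrightarrow> f x = 0"
  obtains C where "C \<ge> 0" "\<And>x. \<bar>f x\<bar> \<le> C"
proof -
  have "bounded (f ` K)"
    using assms by (intro compact_imp_bounded compact_continuous_image) (auto intro: continuous_on_subset)
  then obtain C where C: "\<And>x. x \<in> K \<Longrightarrow> \<bar>f x\<bar> \<le> C"
    by (auto simp: bounded_iff)
  have "\<bar>f x\<bar> \<le> max 0 C" for x
    using C[of x] assms(3)[of x] by (cases "x \<in> K") auto
  then show ?thesis using that[of "max 0 C"] by auto
qed

lemma has_derivative_along_line:
  fixes F :: "'a::real_normed_vector \<Rightarrow> real"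
  assumes "\<And>x. (F has_derivative F' x) (at x)"
  shows "((\<lambda>s. F (x + s *\<^sub>R v)) has_real_derivative F' (x + s *\<^sub>R v) v) (at s)"
proof -
  have "((\<lambda>s. x + s *\<^sub>R v) has_derivative (\<lambda>s. s *\<^sub>R v)) (at s)"
    by (auto intro!: derivative_eq_intros)
  from has_derivative_compose[OF this assms]
  have "((\<lambda>s. F (x + s *\<^sub>R v)) has_derivative (\<lambda>t. F' (x + s *\<^sub>R v) (t *\<^sub>R v))) (at s)" .
  moreover have "F' (x + s *\<^sub>R v) (t *\<^sub>R v) = F' (x + s *\<^sub>R v) v * t" for t
    using linear_scale[OF has_derivative_linear[OF assms]] by (simp add: mult.commute)
  ultimately show ?thesis by (simp add: has_field_derivative_def)
qed

lemma inverse_Suc_tendsto: "(\<lambda>n. 1 / real (Suc n)) \<longlonglongrightarrow> 0"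
  by (rule LIMSEQ_Suc[OF lim_1_over_n])

text \<open>By translation invariance all difference quotients of \<open>F\<close> have integral \<open>0\<close>. They converge boundedly
to the directional derivative, with supports in a common ball.\<close>

lemma test_function_integral_deriv:
  fixes F :: "'a::euclidean_space \<Rightarrow> real"
  assumes t: "test_function F F'"
  shows "(LINT x|lborel. F' x v) = 0"
proof -
  let ?K = "closure {x. F x \<noteq> 0}"
  have der: "(F has_derivative F' x) (at x)" for x using t by (simp add: test_function_def)
  have cont': "continuous_on UNIV (\<lambda>x. F' x v)" using t by (simp add: test_function_def)
  have K: "compact ?K" using t by (simp add: test_function_def)
  have F0: "F x = 0" if "x \<notin> ?K" for x using that closure_subset[of "{x. F x \<noteq> 0}"] by auto
  have cont: "continuous_on UNIV F" by (rule test_function_continuous[OF t])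
  then have [measurable]: "F \<in> borel_measurable borel" by (rule borel_measurable_continuous_onI)
  have [measurable]: "(\<lambda>x. F' x v) \<in> borel_measurable borel" using cont' by (rule borel_measurable_continuous_onI)
  obtain C where C: "C \<ge> 0" "\<And>x. \<bar>F' x v\<bar> \<le> C"
    using compact_support_bounded[OF K cont' test_function_deriv_outside[OF t]] by metis
  obtain R where R: "\<And>x. x \<in> ?K \<Longrightarrow> norm x \<le> R"
    using compact_imp_bounded[OF K] by (auto simp: bounded_iff)
  define h where "h n = 1 / real (Suc n)" for n
  have h: "h n > 0" "h n \<le> 1" for n by (auto simp: h_def)
  define D where "D n x = (F (x + h n *\<^sub>R v) - F x) / h n" for n x
  have [measurable]: "D n \<in> borel_measurable borel" for n unfolding D_def by measurable
  let ?B = "cball 0 (R + norm v) :: 'a set"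
  have "(\<lambda>n. LINT x|lborel. D n x) \<longlonglongrightarrow> (LINT x|lborel. F' x v)"
  proof (rule integral_dominated_convergence)
    show "integrable lborel (\<lambda>x. C * indicator ?B x)"
      by (intro integrable_mult_right integrable_real_indicator emeasure_bounded_finite) auto
    show "AE x in lborel. (\<lambda>n. D n x) \<longlonglongrightarrow> F' x v"
    proof (rule AE_I2)
      fix x
      have "((\<lambda>s. F (x + s *\<^sub>R v)) has_real_derivative F' x v) (at 0)"
        using has_derivative_along_line[OF der, of x v 0] by simp
      then have "(\<lambda>s. (F (x + s *\<^sub>R v) - F x) / s) \<midarrow>0\<rightarrow> F' x v"
        by (simp add: DERIV_def)
      moreover have "filterlim h (at 0) sequentially"
        unfolding filterlim_at
      proof
        show "\<forall>\<^sub>F n in sequentially. h n \<in> UNIV \<and> h n \<noteq> 0"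
          using h(1) by (intro always_eventually) (auto simp: less_imp_neq[symmetric])
        show "h \<longlonglongrightarrow> 0" unfolding h_def[abs_def] by (rule inverse_Suc_tendsto)
      qed
      ultimately show "(\<lambda>n. D n x) \<longlonglongrightarrow> F' x v"
        unfolding D_def by (rule filterlim_compose)
    qed
    show "AE x in lborel. norm (D n x) \<le> C * indicator ?B x" for n
    proof (rule AE_I2)
      fix x
      show "norm (D n x) \<le> C * indicator ?B x"
      proof (cases "x \<in> ?B")
        case True
        obtain z where "F (x + h n *\<^sub>R v) - F (x + 0 *\<^sub>R v) = (h n - 0) * F' (x + z *\<^sub>R v) v"
          using MVT2[OF h(1)[of n] has_derivative_along_line[OF der]] by blast
        then have "D n x = F' (x + z *\<^sub>R v) v" using h(1)[of n] by (simp add: D_def)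
        then show ?thesis using C True by simp
      next
        case False
        have "norm (h n *\<^sub>R v) \<le> norm v" using h[of n] by (simp add: mult_left_le_one_le)
        moreover have nx: "norm x > R + norm v" using False by simp
        moreover have "norm x \<le> norm (x + h n *\<^sub>R v) + norm (h n *\<^sub>R v)"
          using norm_triangle_ineq4[of "x + h n *\<^sub>R v" "h n *\<^sub>R v"] by simp
        ultimately have "norm (x + h n *\<^sub>R v) > R" "norm x > R"
          using norm_ge_zero[of v] by linarith+
        then have "F x = 0" "F (x + h n *\<^sub>R v) = 0" using R F0 by (meson not_le)+
        then show ?thesis using False by (simp add: D_def)
      qed
    qed
  qed auto
  moreover have "(LINT x|lborel. D n x) = 0" for n
  proof -
    have i: "integrable lborel F" by (rule compact_support_integrable[OF K cont F0])
    have "integrable lborel (\<lambda>x. F (x + h n *\<^sub>R v))"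
    proof (rule compact_support_integrable)
      show "compact ((\<lambda>x. x - h n *\<^sub>R v) ` ?K)"
        by (intro compact_continuous_image K continuous_intros)
      show "continuous_on UNIV (\<lambda>x. F (x + h n *\<^sub>R v))"
        by (rule continuous_on_compose2[OF cont]) (auto intro!: continuous_intros)
      show "F (x + h n *\<^sub>R v) = 0" if "x \<notin> (\<lambda>x. x - h n *\<^sub>R v) ` ?K" for x
        using that by (intro F0) (force simp: image_iff)
    qed
    then show ?thesis
      unfolding D_def using i by (simp add: lborel_integral_translate)
  qed
  ultimately show ?thesis by (simp add: LIMSEQ_const_iff)
qed

definition C1_function :: "('a::euclidean_space \<Rightarrow> real) \<Rightarrow> ('a \<Rightarrow> 'a \<Rightarrow> real) \<Rightarrow> bool" where
  "C1_function u u' \<longleftrightarrow> (\<forall>x. (u has_derivative u' x) (at x)) \<and> (\<forall>h. continuous_on UNIV (\<lambda>x. u' x h))"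

lemma C1_function_continuous: "C1_function u u' \<Longrightarrow> continuous_on UNIV u"
  unfolding C1_function_def
  by (auto intro!: continuous_at_imp_continuous_on has_derivative_continuous)

lemma test_function_mult:
  assumes u: "C1_function u u'" and t: "test_function \<phi> \<phi>'"
  shows "test_function (\<lambda>x. u x * \<phi> x) (\<lambda>x h. u x * \<phi>' x h + u' x h * \<phi> x)"
proof -
  have "((\<lambda>x. u x * \<phi> x) has_derivative (\<lambda>h. u x * \<phi>' x h + u' x h * \<phi> x)) (at x)" for x
    by (rule has_derivative_mult) (use u t in \<open>auto simp: C1_function_def test_function_def\<close>)
  moreover have "continuous_on UNIV (\<lambda>x. u x * \<phi>' x h + u' x h * \<phi> x)" for h
    using u t test_function_continuous[OF t] C1_function_continuous[OF u]
    by (intro continuous_intros) (auto simp: C1_function_def test_function_def)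
  moreover have "compact (closure {x. u x * \<phi> x \<noteq> 0})"
    unfolding compact_closure
    by (rule bounded_subset[of "{x. \<phi> x \<noteq> 0}"]) (use t in \<open>auto simp: test_function_def compact_closure\<close>)
  ultimately show ?thesis by (simp add: test_function_def)
qed

lemma C1_has_weak_deriv:
  assumes u: "C1_function u u'" "square_int (\<lambda>x. of_real (u x))" "square_int (\<lambda>x. of_real (u' x v))"
  shows "has_weak_deriv (abs_L2 (\<lambda>x. of_real (u x))) v (abs_L2 (\<lambda>x. of_real (u' x v)))"
proof -
  have "(LINT x|lborel. complex_of_real (u' x v) * of_real (\<phi> x)) = - (LINT x|lborel. of_real (u x) * of_real (\<phi>' x v))"
    if t: "test_function \<phi> \<phi>'" for \<phi> \<phi>'
  proof -
    have "(LINT x|lborel. u x * \<phi>' x v + u' x v * \<phi> x) = 0"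
      using test_function_integral_deriv[OF test_function_mult[OF u(1) t], of v] .
    then have "(LINT x|lborel. complex_of_real (u x * \<phi>' x v + u' x v * \<phi> x)) = 0"
      by (simp only: integral_complex_of_real of_real_0)
    moreover have "integrable lborel (\<lambda>x. complex_of_real (u x) * of_real (\<phi>' x v))"
      "integrable lborel (\<lambda>x. complex_of_real (u' x v) * of_real (\<phi> x))"
      using integrable_mult_cnj[OF u(2) test_function_square_int(2)[OF t, of v]]
        integrable_mult_cnj[OF u(3) test_function_square_int(1)[OF t]] by simp_all
    ultimately show ?thesis by (simp add: eq_neg_iff_add_eq_0 add.commute)
  qed
  then show ?thesis by (simp add: has_weak_deriv.abs_eq u)
qed

text \<open>Cutoffs that tend to \<open>1\<close> pointwise and whose derivatives are of order \<open>1 / n\<close>. The factor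
\<open>n + 1\<close> avoids the degenerate radius \<open>0\<close>.\<close>

definition cutoff :: "nat \<Rightarrow> 'a::euclidean_space \<Rightarrow> real" where
  "cutoff n x = pos_sq (1 - (x \<bullet> x) / (real (Suc n))\<^sup>2)"

definition cutoff' :: "nat \<Rightarrow> 'a::euclidean_space \<Rightarrow> 'a \<Rightarrow> real" where
  "cutoff' n x h = - (2 * (x \<bullet> h) / (real (Suc n))\<^sup>2) * (2 * max 0 (1 - (x \<bullet> x) / (real (Suc n))\<^sup>2))"

lemma test_function_cutoff: "test_function (cutoff n) (cutoff' n :: 'a::euclidean_space \<Rightarrow> _)"
proof -
  have "(cutoff n has_derivative cutoff' n x) (at x)" for x :: 'a
    unfolding cutoff_def[abs_def] cutoff'_def[abs_def]
    by (rule has_derivative_pos_sq) (auto intro!: derivative_eq_intros simp: inner_commute field_simps)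
  moreover have "continuous_on UNIV (\<lambda>x. cutoff' n x h)" for h :: 'a
    unfolding cutoff'_def by (intro continuous_intros) auto
  moreover have "compact (closure {x::'a. cutoff n x \<noteq> 0})"
    unfolding compact_closure
  proof (rule bounded_subset[OF bounded_cball[of 0 "real (Suc n)"]], clarify)
    fix x :: 'a assume "cutoff n x \<noteq> 0"
    then have "(x \<bullet> x) / (real (Suc n))\<^sup>2 < 1"
      by (simp add: cutoff_def)
    then have "(norm x)\<^sup>2 < (real (Suc n))\<^sup>2"
      by (simp add: power2_norm_eq_inner divide_less_eq del: of_nat_Suc)
    then have "norm x < real (Suc n)"
      by (rule power2_less_imp_less) simp
    then show "x \<in> cball 0 (real (Suc n))" by simp
  qed
  ultimately show ?thesis by (simp add: test_function_def)
qed

lemma cutoff_bound: "\<bar>cutoff n x\<bar> \<le> 1"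
proof -
  have "max 0 (1 - (x \<bullet> x) / (real (Suc n))\<^sup>2) \<le> 1" by simp
  from power_mono[OF this, of 2] show ?thesis by (simp add: cutoff_def pos_sq_def)
qed

lemma cutoff'_bound: "\<bar>cutoff' n x h\<bar> \<le> 4 * norm h / real (Suc n)"
proof -
  define N where "N = real (Suc n)"
  have N: "N > 0" by (simp add: N_def)
  show ?thesis
  proof (cases "norm x < N")
    case True
    have "\<bar>x \<bullet> h\<bar> \<le> norm x * norm h" by (rule Cauchy_Schwarz_ineq2)
    also have "\<dots> \<le> N * norm h" using True by (intro mult_right_mono) auto
    finally have "2 * \<bar>x \<bullet> h\<bar> / N\<^sup>2 \<le> 2 * (N * norm h) / N\<^sup>2"
      by (intro divide_right_mono) auto
    also have "\<dots> = 2 * norm h / N"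
      using N by (simp add: power2_eq_square)
    finally have 1: "2 * \<bar>x \<bullet> h\<bar> / N\<^sup>2 \<le> 2 * norm h / N" .
    have 2: "2 * max 0 (1 - (x \<bullet> x) / N\<^sup>2) \<le> 2" by simp
    have "\<bar>cutoff' n x h\<bar> = (2 * \<bar>x \<bullet> h\<bar> / N\<^sup>2) * (2 * max 0 (1 - (x \<bullet> x) / N\<^sup>2))"
      unfolding cutoff'_def N_def[symmetric] by (simp add: abs_mult)
    also have "\<dots> \<le> (2 * norm h / N) * 2"
      by (rule mult_mono[OF 1 2]) (use N in auto)
    finally show ?thesis unfolding N_def[symmetric] by simp
  next
    case False
    then have "N\<^sup>2 \<le> (norm x)\<^sup>2" using N by (intro power_mono) auto
    then have "1 \<le> (x \<bullet> x) / N\<^sup>2"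
      using N by (simp add: power2_norm_eq_inner le_divide_eq)
    then have "max 0 (1 - (x \<bullet> x) / N\<^sup>2) = 0" by simp
    then have "cutoff' n x h = 0"
      unfolding cutoff'_def N_def[symmetric] by simp
    then show ?thesis by simp
  qed
qed

lemma cutoff_tendsto: "(\<lambda>n. cutoff n x) \<longlonglongrightarrow> 1"
proof -
  have "(\<lambda>n. 1 - (x \<bullet> x) * (1 / real (Suc n))\<^sup>2) \<longlonglongrightarrow> 1 - (x \<bullet> x) * 0\<^sup>2"
    by (intro tendsto_diff tendsto_mult tendsto_power tendsto_const inverse_Suc_tendsto)
  then have "(\<lambda>n. pos_sq (1 - (x \<bullet> x) * (1 / real (Suc n))\<^sup>2)) \<longlonglongrightarrow> pos_sq (1 - (x \<bullet> x) * 0\<^sup>2)"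
    by (rule isCont_tendsto_compose[OF DERIV_isCont[OF DERIV_pos_sq]])
  moreover have "pos_sq (1 - (x \<bullet> x) * 0\<^sup>2) = 1" by (simp add: pos_sq_def)
  ultimately show ?thesis by (simp add: cutoff_def power_divide del: of_nat_Suc)
qed

lemma cutoff'_tendsto: "(\<lambda>n. cutoff' n x h) \<longlonglongrightarrow> 0"
proof (rule Lim_null_comparison)
  show "\<forall>\<^sub>F n in sequentially. norm (cutoff' n x h) \<le> 4 * norm h * (1 / real (Suc n))"
    using cutoff'_bound[of _ x h] by (intro always_eventually) simp
  have "(\<lambda>n. 4 * norm h * (1 / real (Suc n))) \<longlonglongrightarrow> 4 * norm h * 0"
    by (intro tendsto_intros inverse_Suc_tendsto)
  then show "(\<lambda>n. 4 * norm h * (1 / real (Suc n))) \<longlonglongrightarrow> 0" by simp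
qed

lemma le_divide_Suc: "0 \<le> c \<Longrightarrow> c / real (Suc n) \<le> c"
  using divide_left_mono[of 1 "real (Suc n)" c] by simp

lemma integral_mult_tendsto:
  fixes f :: "'a::euclidean_space \<Rightarrow> complex"
  assumes f: "integrable lborel f" and [measurable]: "\<And>n. m n \<in> borel_measurable borel"
    and b: "\<And>n x. \<bar>m n x\<bar> \<le> C" and l: "\<And>x. (\<lambda>n. m n x) \<longlonglongrightarrow> c"
  shows "(\<lambda>n. LINT x|lborel. f x * of_real (m n x)) \<longlonglongrightarrow> (LINT x|lborel. f x) * of_real c"
proof -
  have [measurable]: "f \<in> borel_measurable lborel" using f by auto
  have "(\<lambda>n. LINT x|lborel. f x * of_real (m n x)) \<longlonglongrightarrow> (LINT x|lborel. f x * of_real c)"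
  proof (rule integral_dominated_convergence)
    show "integrable lborel (\<lambda>x. cmod (f x) * C)" using f by (intro integrable_mult_left integrable_norm)
    show "AE x in lborel. (\<lambda>n. f x * of_real (m n x)) \<longlonglongrightarrow> f x * of_real c"
      by (intro AE_I2 tendsto_intros l)
    show "AE x in lborel. norm (f x * of_real (m n x)) \<le> cmod (f x) * C" for n
      using b by (intro AE_I2) (simp add: norm_mult mult_left_mono)
  qed auto
  then show ?thesis by simp
qed

text \<open>The definition of a weak derivative tests against compactly supported functions only. Hermite
functions are not of this kind, so \<open>w\<close> is multiplied by a cutoff; the error contains the derivative
of the cutoff and disappears in the limit.\<close>

lemma weak_deriv_adjoint:
  assumes fg: "has_weak_deriv f v g"
    and w: "C1_function w w'" "square_int (\<lambda>x. of_real (w x))" "square_int (\<lambda>x. of_real (w' x v))"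
  shows "cinner g (abs_L2 (\<lambda>x. of_real (w x))) = - cinner f (abs_L2 (\<lambda>x. of_real (w' x v)))"
proof -
  obtain u where u: "square_int u" "f = abs_L2 u" by (rule L2_cases)
  obtain k where k: "square_int k" "g = abs_L2 k" by (rule L2_cases)
  have [measurable]: "cutoff n \<in> borel_measurable borel" for n
    by (rule borel_measurable_continuous_onI[OF test_function_continuous[OF test_function_cutoff]])
  have [measurable]: "(\<lambda>x. cutoff' n x v) \<in> borel_measurable borel" for n
    using test_function_cutoff[of n, where 'a='a] by (intro borel_measurable_continuous_onI) (simp add: test_function_def)
  have i1: "integrable lborel (\<lambda>x. k x * of_real (w x))"
    and i2: "integrable lborel (\<lambda>x. u x * of_real (w x))"
    and i3: "integrable lborel (\<lambda>x. u x * of_real (w' x v))"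
    using integrable_mult_cnj[OF k(1) w(2)] integrable_mult_cnj[OF u(1) w(2)] integrable_mult_cnj[OF u(1) w(3)]
    by simp_all
  have eq: "(LINT x|lborel. k x * of_real (w x) * of_real (cutoff n x))
     = - ((LINT x|lborel. u x * of_real (w x) * of_real (cutoff' n x v)) + (LINT x|lborel. u x * of_real (w' x v) * of_real (cutoff n x)))" for n
  proof -
    have t: "test_function (\<lambda>x. w x * cutoff n x) (\<lambda>x h. w x * cutoff' n x h + w' x h * cutoff n x)"
      by (rule test_function_mult[OF w(1) test_function_cutoff])
    have "(LINT x|lborel. k x * of_real (w x * cutoff n x)) = - (LINT x|lborel. u x * of_real (w x * cutoff' n x v + w' x v * cutoff n x))"
      using fg t unfolding u(2) k(2) has_weak_deriv.abs_eq[OF l2_eq_refl[THEN iffD2, OF u(1)] l2_eq_refl[THEN iffD2, OF k(1)]]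
      by blast
    moreover have "integrable lborel (\<lambda>x. u x * of_real (w x) * of_real (cutoff' n x v))"
    proof (rule Bochner_Integration.integrable_bound)
      show "integrable lborel (\<lambda>x. (u x * of_real (w x)) * of_real (4 * norm v))"
        using i2 by (rule integrable_mult_left)
      have "\<bar>cutoff' n x v\<bar> \<le> 4 * norm v" for x
        by (rule order_trans[OF cutoff'_bound le_divide_Suc]) simp
      then show "AE x in lborel. norm (u x * of_real (w x) * of_real (cutoff' n x v)) \<le> norm ((u x * of_real (w x)) * of_real (4 * norm v))"
        by (intro AE_I2) (simp add: norm_mult mult_left_mono)
    qed (use i2 in auto)
    moreover have "integrable lborel (\<lambda>x. u x * of_real (w' x v) * of_real (cutoff n x))"
    proof (rule Bochner_Integration.integrable_bound[OF i3])
      show "AE x in lborel. norm (u x * of_real (w' x v) * of_real (cutoff n x)) \<le> norm (u x * of_real (w' x v))"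
        using cutoff_bound[of n] by (intro AE_I2) (auto simp: norm_mult intro!: mult_left_le)
    qed (use i3 in auto)
    ultimately show ?thesis by (simp add: distrib_left mult_ac)
  qed
  have "(\<lambda>n. LINT x|lborel. k x * of_real (w x) * of_real (cutoff n x)) \<longlonglongrightarrow> (LINT x|lborel. k x * of_real (w x)) * of_real 1"
    by (rule integral_mult_tendsto[OF i1, where C=1]) (auto simp: cutoff_bound cutoff_tendsto)
  moreover have "(\<lambda>n. LINT x|lborel. k x * of_real (w x) * of_real (cutoff n x)) \<longlonglongrightarrow>
      - ((LINT x|lborel. u x * of_real (w x)) * of_real 0 + (LINT x|lborel. u x * of_real (w' x v)) * of_real 1)"
    unfolding eq
  proof (intro tendsto_minus tendsto_add)
    have "\<bar>cutoff' n x v\<bar> \<le> 4 * norm v" for n x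
      by (rule order_trans[OF cutoff'_bound le_divide_Suc]) simp
    then show "(\<lambda>n. LINT x|lborel. u x * of_real (w x) * of_real (cutoff' n x v)) \<longlonglongrightarrow> (LINT x|lborel. u x * of_real (w x)) * of_real 0"
      by (intro integral_mult_tendsto[OF i2, where C="4 * norm v"]) (auto simp: cutoff'_tendsto)
    show "(\<lambda>n. LINT x|lborel. u x * of_real (w' x v) * of_real (cutoff n x)) \<longlonglongrightarrow> (LINT x|lborel. u x * of_real (w' x v)) * of_real 1"
      by (rule integral_mult_tendsto[OF i3, where C=1]) (auto simp: cutoff_bound cutoff_tendsto)
  qed
  ultimately have "(LINT x|lborel. k x * of_real (w x)) * of_real 1
     = - ((LINT x|lborel. u x * of_real (w x)) * of_real 0 + (LINT x|lborel. u x * of_real (w' x v)) * of_real 1)"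
    by (rule LIMSEQ_unique)
  then show ?thesis by (simp add: u k w cinner_abs_L2)
qed

section \<open>Hermite functions\<close>

lemma hermite_Suc: "hermite (Suc n) x = 2 * x * hermite n x - 2 * real n * hermite (n - 1) x"
  by (cases n) auto

lemma DERIV_hermite: "(hermite n has_real_derivative 2 * real n * hermite (n - 1) x) (at x)"
proof (induction n rule: induct_nat_012)
  case 0
  have "hermite 0 = (\<lambda>x. 1)" by (simp add: fun_eq_iff)
  then show ?case by simp
next
  case 1
  have "hermite (Suc 0) = (\<lambda>x. 2 * x)" by (simp add: fun_eq_iff)
  then show ?case by (auto intro!: derivative_eq_intros)
next
  case (ge2 n)
  have eq: "hermite (Suc (Suc n)) = (\<lambda>x. 2 * x * hermite (Suc n) x - 2 * real (Suc n) * hermite n x)"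
    by (simp add: fun_eq_iff)
  have "((\<lambda>x. 2 * x * hermite (Suc n) x - 2 * real (Suc n) * hermite n x) has_real_derivative
      2 * hermite (Suc n) x + 2 * x * (2 * real (Suc n) * hermite n x)
        - 2 * real (Suc n) * (2 * real n * hermite (n - 1) x)) (at x)"
    by (rule derivative_eq_intros refl ge2[simplified])+ (simp add: algebra_simps)
  also have "2 * hermite (Suc n) x + 2 * x * (2 * real (Suc n) * hermite n x)
        - 2 * real (Suc n) * (2 * real n * hermite (n - 1) x)
      = 2 * hermite (Suc n) x + 2 * real (Suc n) * (2 * x * hermite n x - 2 * real n * hermite (n - 1) x)"
    by (simp add: algebra_simps)
  also have "\<dots> = 2 * real (Suc (Suc n)) * hermite (Suc (Suc n) - 1) x"
    unfolding hermite_Suc[symmetric] by (simp add: algebra_simps)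
  finally show ?case unfolding eq .
qed

definition hermite_norm :: "nat \<Rightarrow> real" where
  "hermite_norm n = sqrt (2 ^ n * fact n * sqrt pi)"

lemma hermite_norm_pos: "hermite_norm n > 0"
  by (simp add: hermite_norm_def)

lemma hermite_norm_Suc: "hermite_norm (Suc n) = sqrt (2 * real (Suc n)) * hermite_norm n"
  unfolding hermite_norm_def real_sqrt_mult[symmetric] by (simp add: mult_ac)

lemma hermite_fun_alt: "hermite_fun n x = hermite n x * exp (- x\<^sup>2 / 2) / hermite_norm n"
  by (simp add: hermite_fun_def hermite_norm_def)

lemma sqrt_hermite_fun_Suc:
  "sqrt (real (Suc n)) * hermite_fun (Suc n) x = (hermite (Suc n) x * exp (- x\<^sup>2 / 2) / hermite_norm n) / sqrt 2"
  unfolding hermite_fun_alt hermite_norm_Suc real_sqrt_mult by simp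

lemma sqrt_hermite_fun_pred:
  "sqrt (real n) * hermite_fun (n - 1) x = sqrt 2 * (real n * hermite (n - 1) x * exp (- x\<^sup>2 / 2) / hermite_norm n)"
proof (cases n)
  case (Suc m)
  have s: "sqrt (real (Suc m)) * sqrt (real (Suc m)) = real (Suc m)" by (rule real_sqrt_mult_self[THEN trans]) simp
  have "sqrt 2 * real n / hermite_norm n = sqrt (real n) / hermite_norm m"
    unfolding Suc hermite_norm_Suc real_sqrt_mult
    using hermite_norm_pos[of m] s by (simp add: field_simps del: of_nat_Suc)
  moreover have "sqrt 2 * (real n * hermite (n - 1) x * exp (- x\<^sup>2 / 2) / hermite_norm n)
      = (sqrt 2 * real n / hermite_norm n) * (hermite (n - 1) x * exp (- x\<^sup>2 / 2))"
    by simp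
  ultimately show ?thesis
    unfolding hermite_fun_alt by (simp add: Suc del: of_nat_Suc)
qed simp

lemma sqrt2_cancel:
  fixes a b :: real
  shows "(1 / sqrt 2) * (sqrt 2 * a + b / sqrt 2) = a + b / 2" "(1 / sqrt 2) * (sqrt 2 * a - b / sqrt 2) = a - b / 2"
proof -
  have "1 / sqrt 2 * (sqrt 2 * a) = a" "1 / sqrt 2 * (b / sqrt 2) = b / 2"
    using half_sqrt2 by simp_all
  then show "(1 / sqrt 2) * (sqrt 2 * a + b / sqrt 2) = a + b / 2" "(1 / sqrt 2) * (sqrt 2 * a - b / sqrt 2) = a - b / 2"
    unfolding distrib_left right_diff_distrib by simp_all
qed

lemma mult_hermite_fun:
  "x * hermite_fun n x = (1 / sqrt 2) * (sqrt (real n) * hermite_fun (n - 1) x + sqrt (real (Suc n)) * hermite_fun (Suc n) x)"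
  unfolding sqrt_hermite_fun_Suc sqrt_hermite_fun_pred sqrt2_cancel
  unfolding hermite_fun_alt hermite_Suc
  using hermite_norm_pos[of n] by (simp add: field_simps)

lemma DERIV_hermite_fun:
  "(hermite_fun n has_real_derivative
     (1 / sqrt 2) * (sqrt (real n) * hermite_fun (n - 1) x - sqrt (real (Suc n)) * hermite_fun (Suc n) x)) (at x)"
proof -
  have "((\<lambda>x. hermite n x * exp (- x\<^sup>2 / 2) / hermite_norm n) has_real_derivative
      (2 * real n * hermite (n - 1) x * exp (- x\<^sup>2 / 2) + hermite n x * (exp (- x\<^sup>2 / 2) * (- x))) / hermite_norm n) (at x)"
    by (rule derivative_eq_intros refl DERIV_hermite | use hermite_norm_pos[of n] in simp)+
  also have "(2 * real n * hermite (n - 1) x * exp (- x\<^sup>2 / 2) + hermite n x * (exp (- x\<^sup>2 / 2) * (- x))) / hermite_norm n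
     = (1 / sqrt 2) * (sqrt (real n) * hermite_fun (n - 1) x - sqrt (real (Suc n)) * hermite_fun (Suc n) x)"
    unfolding sqrt_hermite_fun_Suc sqrt_hermite_fun_pred sqrt2_cancel hermite_Suc
    using hermite_norm_pos[of n] by (simp add: field_simps)
  finally show ?thesis unfolding hermite_fun_alt[abs_def] .
qed

lemma continuous_on_hermite_fun [continuous_intros]:
  "continuous_on S f \<Longrightarrow> continuous_on S (\<lambda>x. hermite_fun n (f x))"
  by (rule continuous_on_compose2[OF _ _ subset_UNIV])
     (intro continuous_at_imp_continuous_on ballI DERIV_isCont[OF DERIV_hermite_fun])

section \<open>Hermite products on phase space\<close>

text \<open>The \<open>2 d\<close> coordinates of phase space are indexed by the sum type: positions on the left,
momenta on the right. This treats the operators \<open>a\<close> and \<open>b\<close> alike.\<close>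

fun dir :: "'d::finite + 'd \<Rightarrow> 'd phase" where
  "dir (Inl i) = q_dir i"
| "dir (Inr i) = p_dir i"

lemma inner_dir: "dir j \<bullet> dir k = (if j = k then 1 else 0)"
  by (cases j; cases k) (auto simp: q_dir_def p_dir_def inner_axis_axis)

definition ket_fun :: "('d::finite + 'd \<Rightarrow> nat) \<Rightarrow> 'd phase \<Rightarrow> real" where
  "ket_fun c x = (\<Prod>j\<in>UNIV. hermite_fun (c j) (x \<bullet> dir j))"

definition ketc :: "('d::finite + 'd \<Rightarrow> nat) \<Rightarrow> 'd phase L2" where
  "ketc c = ket (\<lambda>i. c (Inl i)) (\<lambda>i. c (Inr i))"

lemma ket_fun_prod:
  "ket_fun c (q, p) = (\<Prod>i\<in>UNIV. hermite_fun (c (Inl i)) (q $ i)) * (\<Prod>i\<in>UNIV. hermite_fun (c (Inr i)) (p $ i))"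
  unfolding ket_fun_def UNIV_Plus_UNIV[symmetric]
  by (subst prod.Plus) (simp_all add: q_dir_def p_dir_def inner_axis)

lemma ket_square_int:
  fixes c :: "'d::finite + 'd \<Rightarrow> nat"
  shows "square_int (\<lambda>x. complex_of_real (ket_fun c x))" "ketc c = abs_L2 (\<lambda>x. of_real (ket_fun c x))"
proof -
  have eq: "(\<lambda>x. complex_of_real (ket_fun c x)) = (\<lambda>(q, p). complex_of_real
        ((\<Prod>i\<in>UNIV. hermite_fun (c (Inl i)) (q $ i)) * (\<Prod>i\<in>UNIV. hermite_fun (c (Inr i)) (p $ i))))"
    by (auto simp: fun_eq_iff ket_fun_prod)
  show "square_int (\<lambda>x. complex_of_real (ket_fun c x))"
    unfolding eq l2_eq_refl[symmetric] by (rule ket.rsp[unfolded rel_fun_def, rule_format]) simp_all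
  show "ketc c = abs_L2 (\<lambda>x. of_real (ket_fun c x))"
    unfolding eq ketc_def by (rule ket.abs_eq)
qed

lemma ket_fun_upd:
  "ket_fun (c(j := m)) x = hermite_fun m (x \<bullet> dir j) * (\<Prod>k\<in>UNIV - {j}. hermite_fun (c k) (x \<bullet> dir k))"
proof -
  have "(\<Prod>k\<in>UNIV - {j}. hermite_fun ((c(j := m)) k) (x \<bullet> dir k)) = (\<Prod>k\<in>UNIV - {j}. hermite_fun (c k) (x \<bullet> dir k))"
    by (rule prod.cong) auto
  then show ?thesis
    unfolding ket_fun_def by (subst prod.remove[of _ j]) auto
qed

lemma ket_fun_remove:
  "ket_fun c x = hermite_fun (c j) (x \<bullet> dir j) * (\<Prod>k\<in>UNIV - {j}. hermite_fun (c k) (x \<bullet> dir k))"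
  using ket_fun_upd[of c j "c j" x] by simp

lemma mult_ket_fun:
  "(x \<bullet> dir j) * ket_fun c x = (1 / sqrt 2) * (sqrt (real (c j)) * ket_fun (c(j := c j - 1)) x
     + sqrt (real (Suc (c j))) * ket_fun (c(j := Suc (c j))) x)"
proof -
  have "(x \<bullet> dir j) * ket_fun c x = ((x \<bullet> dir j) * hermite_fun (c j) (x \<bullet> dir j)) * (\<Prod>k\<in>UNIV - {j}. hermite_fun (c k) (x \<bullet> dir k))"
    by (simp add: ket_fun_remove[of c x j])
  then show ?thesis
    unfolding mult_hermite_fun ket_fun_upd by (simp add: algebra_simps del: of_nat_Suc)
qed

definition ket_fun' :: "('d::finite + 'd \<Rightarrow> nat) \<Rightarrow> 'd phase \<Rightarrow> 'd phase \<Rightarrow> real" where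
  "ket_fun' c x h = (\<Sum>j\<in>UNIV. (h \<bullet> dir j) * ((1 / sqrt 2) * (sqrt (real (c j)) * hermite_fun (c j - 1) (x \<bullet> dir j)
       - sqrt (real (Suc (c j))) * hermite_fun (Suc (c j)) (x \<bullet> dir j))) * (\<Prod>k\<in>UNIV - {j}. hermite_fun (c k) (x \<bullet> dir k)))"

lemma C1_ket_fun: "C1_function (ket_fun c) (ket_fun' c)"
proof -
  have "(ket_fun c has_derivative ket_fun' c x) (at x)" for x
    unfolding ket_fun_def[abs_def] ket_fun'_def
    by (intro has_derivative_prod DERIV_compose_FDERIV[OF DERIV_hermite_fun]) (auto intro!: derivative_eq_intros)
  moreover have "continuous_on UNIV (\<lambda>x. ket_fun' c x h)" for h
    unfolding ket_fun'_def by (intro continuous_intros)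
  ultimately show ?thesis by (simp add: C1_function_def)
qed

lemma ket_fun'_dir:
  "ket_fun' c x (dir j) = (1 / sqrt 2) * (sqrt (real (c j)) * ket_fun (c(j := c j - 1)) x
     - sqrt (real (Suc (c j))) * ket_fun (c(j := Suc (c j))) x)"
proof -
  have "ket_fun' c x (dir j) = (\<Sum>l\<in>{j}. (dir j \<bullet> dir l) * ((1 / sqrt 2) * (sqrt (real (c l)) * hermite_fun (c l - 1) (x \<bullet> dir l)
       - sqrt (real (Suc (c l))) * hermite_fun (Suc (c l)) (x \<bullet> dir l))) * (\<Prod>k\<in>UNIV - {l}. hermite_fun (c k) (x \<bullet> dir k)))"
    unfolding ket_fun'_def by (rule sum.mono_neutral_right) (auto simp: inner_dir)
  then show ?thesis
    unfolding ket_fun_upd by (simp add: inner_dir algebra_simps del: of_nat_Suc)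
qed

text \<open>For \<open>c j = 0\<close> the truncated predecessor \<open>c j - 1\<close> is harmless, since the coefficient is \<open>0\<close>.\<close>

definition ket_lower :: "('d::finite + 'd) \<Rightarrow> ('d + 'd \<Rightarrow> nat) \<Rightarrow> 'd phase L2" where
  "ket_lower j c = sqrt (real (c j)) *\<^sub>R ketc (c(j := c j - 1))"

definition ket_raise :: "('d::finite + 'd) \<Rightarrow> ('d + 'd \<Rightarrow> nat) \<Rightarrow> 'd phase L2" where
  "ket_raise j c = sqrt (real (Suc (c j))) *\<^sub>R ketc (c(j := Suc (c j)))"

lemma ket_combination:
  fixes c c' :: "'d::finite + 'd \<Rightarrow> nat"
  shows "square_int (\<lambda>x. complex_of_real (k * (s * ket_fun c x + t * ket_fun c' x)))"
    "k *\<^sub>R (s *\<^sub>R ketc c + t *\<^sub>R ketc c') = abs_L2 (\<lambda>x. complex_of_real (k * (s * ket_fun c x + t * ket_fun c' x)))"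
  unfolding scaleR_scaleC ket_square_int(2) of_real_mult of_real_add
  by (simp_all add: abs_L2_scaleC abs_L2_add square_int_add square_int_scale ket_square_int(1))

lemma mult_rel_ketc: "mult_rel (dir j) (ketc c) ((1 / sqrt 2) *\<^sub>R (ket_lower j c + ket_raise j c))"
  unfolding mult_rel_def
proof (intro exI conjI)
  have eq: "(\<lambda>x. complex_of_real (x \<bullet> dir j) * of_real (ket_fun c x)) =
      (\<lambda>x. of_real ((1 / sqrt 2) * (sqrt (real (c j)) * ket_fun (c(j := c j - 1)) x
         + sqrt (real (Suc (c j))) * ket_fun (c(j := Suc (c j))) x)))"
    by (simp only: mult_ket_fun flip: of_real_mult)
  show "square_int (\<lambda>x. complex_of_real (ket_fun c x))" "ketc c = abs_L2 (\<lambda>x. of_real (ket_fun c x))"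
    by (rule ket_square_int)+
  show "square_int (\<lambda>x. complex_of_real (x \<bullet> dir j) * of_real (ket_fun c x))"
    unfolding eq by (rule ket_combination)
  show "(1 / sqrt 2) *\<^sub>R (ket_lower j c + ket_raise j c) = abs_L2 (\<lambda>x. complex_of_real (x \<bullet> dir j) * of_real (ket_fun c x))"
    unfolding eq ket_lower_def ket_raise_def by (rule ket_combination)
qed

lemma ket_deriv:
  fixes c :: "'d::finite + 'd \<Rightarrow> nat"
  shows "square_int (\<lambda>x. complex_of_real (ket_fun' c x (dir j)))"
    "(1 / sqrt 2) *\<^sub>R (ket_lower j c - ket_raise j c) = abs_L2 (\<lambda>x. of_real (ket_fun' c x (dir j)))"
proof -
  have eq: "(\<lambda>x. complex_of_real (ket_fun' c x (dir j))) =
     (\<lambda>x. complex_of_real ((1 / sqrt 2) * (sqrt (real (c j)) * ket_fun (c(j := c j - 1)) x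
         + (- sqrt (real (Suc (c j)))) * ket_fun (c(j := Suc (c j))) x)))"
    by (simp add: ket_fun'_dir del: of_nat_Suc)
  show "square_int (\<lambda>x. complex_of_real (ket_fun' c x (dir j)))"
    unfolding eq by (rule ket_combination)
  have "ket_lower j c - ket_raise j c = sqrt (real (c j)) *\<^sub>R ketc (c(j := c j - 1)) + (- sqrt (real (Suc (c j)))) *\<^sub>R ketc (c(j := Suc (c j)))"
    by (simp add: ket_lower_def ket_raise_def del: of_nat_Suc)
  then show "(1 / sqrt 2) *\<^sub>R (ket_lower j c - ket_raise j c) = abs_L2 (\<lambda>x. of_real (ket_fun' c x (dir j)))"
    unfolding eq by (simp only: ket_combination(2))
qed

text \<open>A basis vector is a product of one-dimensional Hermite functions, and only the factor in direction
\<open>j\<close> is affected by the coordinate and the derivative in that direction.\<close>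

lemma ladder_ketc: "ladder (dir j) (ketc c) (ket_lower j c) (ket_raise j c)"
  unfolding ladder_def
proof
  show "mult_rel (dir j) (ketc c) ((1 / sqrt 2) *\<^sub>R (ket_lower j c + ket_raise j c))"
    by (rule mult_rel_ketc)
  show "has_weak_deriv (ketc c) (dir j) ((1 / sqrt 2) *\<^sub>R (ket_lower j c - ket_raise j c))"
    unfolding ket_square_int(2) ket_deriv(2)
    by (rule C1_has_weak_deriv[OF C1_ket_fun ket_square_int(1) ket_deriv(1)])
qed

text \<open>Multiplication by a coordinate is symmetric and differentiation is antisymmetric. Sum and difference
of the two identities give the mutual adjointness of lowering and raising, with only the second
argument restricted to basis vectors.\<close>

lemma ladder_ket_adjoint:
  assumes "ladder (dir j) f l r"
  shows "cinner l (ketc c) = cinner f (ket_raise j c)" "cinner r (ketc c) = cinner f (ket_lower j c)"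
proof -
  define s where "s = complex_of_real (1 / sqrt 2)"
  have s: "s \<noteq> 0" "cnj s = s" by (simp_all add: s_def)
  have X: "s * (cinner l (ketc c) + cinner r (ketc c)) = s * (cinner f (ket_lower j c) + cinner f (ket_raise j c))"
  proof -
    obtain u where u: "square_int u" "square_int (\<lambda>x. of_real (x \<bullet> dir j) * u x)"
      "ketc c = abs_L2 u" "(1 / sqrt 2) *\<^sub>R (ket_lower j c + ket_raise j c) = abs_L2 (\<lambda>x. of_real (x \<bullet> dir j) * u x)"
      using mult_rel_ketc[of j c] unfolding mult_rel_def by blast
    have "dual_rel (mult_tests (dir j)) f ((1 / sqrt 2) *\<^sub>R (l + r))"
      using assms by (simp add: ladder_def mult_rel_iff)
    then have "cinner ((1 / sqrt 2) *\<^sub>R (l + r)) (ketc c) = cinner f ((1 / sqrt 2) *\<^sub>R (ket_lower j c + ket_raise j c))"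
      unfolding dual_rel_def mult_tests_def u(3,4) using u(1,2) by blast
    then show ?thesis
      by (simp only: cinner_scaleR_left cinner_scaleR_right cinner_add_left cinner_add_right s_def)
  qed
  have D: "s * (cinner l (ketc c) - cinner r (ketc c)) = - (s * (cinner f (ket_lower j c) - cinner f (ket_raise j c)))"
  proof -
    have "has_weak_deriv f (dir j) ((1 / sqrt 2) *\<^sub>R (l - r))" using assms by (simp add: ladder_def)
    from weak_deriv_adjoint[OF this C1_ket_fun ket_square_int(1) ket_deriv(1)]
    have "cinner ((1 / sqrt 2) *\<^sub>R (l - r)) (ketc c) = - cinner f ((1 / sqrt 2) *\<^sub>R (ket_lower j c - ket_raise j c))"
      unfolding ket_square_int(2)[symmetric] ket_deriv(2)[symmetric] .
    then show ?thesis
      by (simp only: cinner_scaleR_left cinner_scaleR_right cinner_diff_left cinner_diff_right s_def)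
  qed
  from X D s have X': "cinner l (ketc c) + cinner r (ketc c) = cinner f (ket_lower j c) + cinner f (ket_raise j c)"
    and D': "cinner l (ketc c) - cinner r (ketc c) = - (cinner f (ket_lower j c) - cinner f (ket_raise j c))"
    by (simp_all flip: mult_minus_right)
  show "cinner l (ketc c) = cinner f (ket_raise j c)" "cinner r (ketc c) = cinner f (ket_lower j c)"
    using X' D' by algebra+
qed

section \<open>Joint eigenspaces of the number operators\<close>

definition lower :: "('d::finite + 'd) \<Rightarrow> 'd phase L2 \<Rightarrow> 'd phase L2" where "lower j = lowering (dir j)"
definition raise :: "('d::finite + 'd) \<Rightarrow> 'd phase L2 \<Rightarrow> 'd phase L2" where "raise j = raising (dir j)"

definition ladder_dom :: "('d::finite + 'd) \<Rightarrow> 'd phase L2 set" where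
  "ladder_dom j = {f. ladder (dir j) f (lower j f) (raise j f)}"

lemma op_lower_raise: "op_a i = lower (Inl i)" "op_a' i = raise (Inl i)" "op_b i = lower (Inr i)" "op_b' i = raise (Inr i)"
  by (simp_all add: op_a_def op_a'_def op_b_def op_b'_def lower_def raise_def)

lemma ladder_domI:
  assumes "ladder (dir j) f l r" shows "f \<in> ladder_dom j" "lower j f = l" "raise j f = r"
  using assms ladder_lowering_raising[OF assms] by (simp_all add: ladder_dom_def lower_def raise_def)

lemma ladder_dom_zero: "0 \<in> ladder_dom j" "lower j 0 = 0" "raise j 0 = 0"
  using ladder_domI[OF ladder_zero, of j] by simp_all

lemma ladder_dom_add:
  assumes "f \<in> ladder_dom j" "g \<in> ladder_dom j"
  shows "f + g \<in> ladder_dom j" "lower j (f + g) = lower j f + lower j g" "raise j (f + g) = raise j f + raise j g"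
  using assms ladder_domI[OF ladder_add, of j f _ _ g] by (auto simp: ladder_dom_def)

lemma ladder_dom_scaleC:
  assumes "f \<in> ladder_dom j"
  shows "c *\<^sub>C f \<in> ladder_dom j" "lower j (c *\<^sub>C f) = c *\<^sub>C lower j f" "raise j (c *\<^sub>C f) = c *\<^sub>C raise j f"
  using assms ladder_domI[OF ladder_scaleC, of j f _ _ c] by (auto simp: ladder_dom_def)

lemma ladder_dom_scaleR:
  assumes "f \<in> ladder_dom j"
  shows "c *\<^sub>R f \<in> ladder_dom j" "lower j (c *\<^sub>R f) = c *\<^sub>R lower j f" "raise j (c *\<^sub>R f) = c *\<^sub>R raise j f"
  using ladder_dom_scaleC[OF assms] by (simp_all add: scaleR_scaleC)

lemma ladder_dom_linear_combination:
  assumes "\<And>i. i \<in> I \<Longrightarrow> f i \<in> ladder_dom j"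
  shows "(\<Sum>i\<in>I. c i *\<^sub>C f i) \<in> ladder_dom j"
    "lower j (\<Sum>i\<in>I. c i *\<^sub>C f i) = (\<Sum>i\<in>I. c i *\<^sub>C lower j (f i))"
    "raise j (\<Sum>i\<in>I. c i *\<^sub>C f i) = (\<Sum>i\<in>I. c i *\<^sub>C raise j (f i))"
proof -
  have "ladder (dir j) (\<Sum>i\<in>I. c i *\<^sub>C f i) (\<Sum>i\<in>I. c i *\<^sub>C lower j (f i)) (\<Sum>i\<in>I. c i *\<^sub>C raise j (f i))"
    using assms by (intro ladder_sum ladder_scaleC) (auto simp: ladder_dom_def)
  then show "(\<Sum>i\<in>I. c i *\<^sub>C f i) \<in> ladder_dom j"
    "lower j (\<Sum>i\<in>I. c i *\<^sub>C f i) = (\<Sum>i\<in>I. c i *\<^sub>C lower j (f i))"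
    "raise j (\<Sum>i\<in>I. c i *\<^sub>C f i) = (\<Sum>i\<in>I. c i *\<^sub>C raise j (f i))"
    by (fact ladder_domI)+
qed

lemma ladder_dom_ketc: "ketc c \<in> ladder_dom j" "lower j (ketc c) = ket_lower j c" "raise j (ketc c) = ket_raise j c"
  by (fact ladder_domI[OF ladder_ketc])+

definition deg :: "('d::finite + 'd \<Rightarrow> nat) \<Rightarrow> int \<times> int" where
  "deg c = (int (\<Sum>i\<in>UNIV. c (Inl i)), int (\<Sum>i\<in>UNIV. c (Inr i)))"

fun step :: "'d + 'd \<Rightarrow> int \<times> int" where
  "step (Inl i) = (1, 0)"
| "step (Inr i) = (0, 1)"

text \<open>\<open>sector (A, B)\<close> is \<open>F_AB A B\<close>. Indexing by integers makes lowering and raising shifts of the index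
that are valid without exception: a sector with a negative index is \<open>{0}\<close>.\<close>

definition sector :: "int \<times> int \<Rightarrow> 'd::finite phase L2 set" where
  "sector p = L2.span (ketc ` {c. deg c = p})"

lemma sector_subspace: "L2.subspace (sector p)" by (simp add: sector_def)

lemmas sector_zero = L2.subspace_0[OF sector_subspace]
lemmas sector_add = L2.subspace_add[OF sector_subspace]
lemmas sector_scale = L2.subspace_scale[OF sector_subspace]

lemma sector_scaleR: "f \<in> sector p \<Longrightarrow> c *\<^sub>R f \<in> sector p"
  by (simp add: scaleR_scaleC sector_scale)

lemma ketc_sector: "ketc c \<in> sector (deg c)"
  by (auto simp: sector_def intro: L2.span_base)

lemma deg_Suc: "deg (c(j := Suc (c j))) = deg c + step j"
proof (cases j)
  case (Inl i)
  have "(\<Sum>k\<in>UNIV. (c(j := Suc (c j))) (Inl k)) = Suc (\<Sum>k\<in>UNIV. c (Inl k))"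
    unfolding Inl by (subst (1 2) sum.remove[of _ i]) (auto intro!: sum.cong)
  then show ?thesis by (simp add: deg_def Inl)
next
  case (Inr i)
  have "(\<Sum>k\<in>UNIV. (c(j := Suc (c j))) (Inr k)) = Suc (\<Sum>k\<in>UNIV. c (Inr k))"
    unfolding Inr by (subst (1 2) sum.remove[of _ i]) (auto intro!: sum.cong)
  then show ?thesis by (simp add: deg_def Inr)
qed

lemma deg_pred: "c j > 0 \<Longrightarrow> deg (c(j := c j - 1)) = deg c - step j"
  using deg_Suc[of "c(j := c j - 1)" j] by (simp add: eq_diff_eq)

lemma sector_induct [consumes 1, case_names zero add scale ket]:
  assumes "f \<in> sector p" "P 0" "\<And>f g. f \<in> sector p \<Longrightarrow> g \<in> sector p \<Longrightarrow> P f \<Longrightarrow> P g \<Longrightarrow> P (f + g)"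
    "\<And>c f. f \<in> sector p \<Longrightarrow> P f \<Longrightarrow> P (c *\<^sub>C f)" "\<And>c. deg c = p \<Longrightarrow> P (ketc c)"
  shows "P f"
proof -
  have sub: "L2.subspace {f. f \<in> sector p \<and> P f}"
    by (rule L2.subspaceI) (simp_all add: assms(2-4) sector_zero sector_add sector_scale)
  have "ketc ` {c. deg c = p} \<subseteq> {f. f \<in> sector p \<and> P f}"
    using assms(5) ketc_sector by auto
  then have "sector p \<subseteq> {f. f \<in> sector p \<and> P f}"
    unfolding sector_def[of p] by (rule L2.span_minimal[OF _ sub[unfolded sector_def[of p]]])
  then show ?thesis using assms(1) by blast
qed

lemma sector_ladder:
  assumes "f \<in> sector p" shows "f \<in> ladder_dom j" "lower j f \<in> sector (p - step j)" "raise j f \<in> sector (p + step j)"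
proof -
  have "f \<in> ladder_dom j \<and> lower j f \<in> sector (p - step j) \<and> raise j f \<in> sector (p + step j)"
    using assms
  proof (induction rule: sector_induct)
    case (ket c)
    have "ket_lower j c \<in> sector (p - step j)"
    proof (cases "c j = 0")
      case False
      then show ?thesis
        using ketc_sector[of "c(j := c j - 1)"] ket deg_pred[of c j] by (simp add: ket_lower_def sector_scaleR)
    qed (simp add: ket_lower_def sector_zero)
    moreover have "ket_raise j c \<in> sector (p + step j)"
      using ketc_sector[of "c(j := Suc (c j))"] ket by (simp add: ket_raise_def deg_Suc sector_scaleR del: of_nat_Suc)
    ultimately show ?case by (simp add: ladder_dom_ketc)
  qed (auto simp: ladder_dom_zero ladder_dom_add ladder_dom_scaleC sector_zero intro: sector_add sector_scale)
  then show "f \<in> ladder_dom j" "lower j f \<in> sector (p - step j)" "raise j f \<in> sector (p + step j)" by auto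
qed

lemma raise_lower_ketc: "raise j (lower j (ketc c)) = real (c j) *\<^sub>R ketc c"
proof (cases "c j = 0")
  case True
  then show ?thesis by (simp add: ladder_dom_ketc ket_lower_def ladder_dom_zero)
next
  case False
  then have e: "Suc (c j - Suc 0) = c j" by simp
  have "ket_raise j (c(j := c j - 1)) = sqrt (real (c j)) *\<^sub>R ketc c"
    by (simp add: ket_raise_def e del: of_nat_Suc)
  then show ?thesis
    by (simp add: ladder_dom_ketc ket_lower_def ladder_dom_scaleR)
qed

lemma lower_raise_ketc: "lower j (raise j (ketc c)) = real (Suc (c j)) *\<^sub>R ketc c"
  by (simp add: ladder_dom_ketc ket_lower_def ket_raise_def ladder_dom_scaleR)

lemma sector_commutator:
  assumes "f \<in> sector p" shows "lower j (raise j f) = raise j (lower j f) + f"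
  using assms
proof (induction rule: sector_induct)
  case (ket c)
  show ?case by (simp add: raise_lower_ketc lower_raise_ketc scaleR_left_distrib)
next
  case (add f g)
  then show ?case
    using sector_ladder[of f p j] sector_ladder[of g p j] sector_ladder(1)[of _ "p - step j" j] sector_ladder(1)[of _ "p + step j" j]
    by (simp add: ladder_dom_add)
next
  case (scale c f)
  then show ?case
    using sector_ladder[of f p j] sector_ladder(1)[of _ "p - step j" j] sector_ladder(1)[of _ "p + step j" j]
    by (simp add: ladder_dom_scaleC L2.scale_right_distrib)
qed (simp add: ladder_dom_zero)

lemma sector_adjoint:
  assumes f: "f \<in> ladder_dom j" and g: "g \<in> sector p"
  shows "cinner (lower j f) g = cinner f (raise j g)" "cinner (raise j f) g = cinner f (lower j g)"
proof -
  have "cinner (lower j f) g = cinner f (raise j g) \<and> cinner (raise j f) g = cinner f (lower j g)"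
    using g
  proof (induction rule: sector_induct)
    case (ket c)
    show ?case using f ladder_ket_adjoint[of j f] by (simp add: ladder_dom_ketc ladder_dom_def)
  next
    case (add g h)
    then show ?case using sector_ladder(1)[of _ p j] by (simp add: ladder_dom_add cinner_add_right)
  next
    case (scale c g)
    then show ?case using sector_ladder(1)[of _ p j] by (simp add: ladder_dom_scaleC)
  qed (simp add: ladder_dom_zero)
  then show "cinner (lower j f) g = cinner f (raise j g)" "cinner (raise j f) g = cinner f (lower j g)" by auto
qed

lemma raise_lower_linear:
  assumes "f \<in> sector p" "g \<in> sector q"
  shows "raise j (lower j (f + g)) = raise j (lower j f) + raise j (lower j g)" "raise j (lower j (c *\<^sub>C f)) = c *\<^sub>C raise j (lower j f)"
  using sector_ladder[OF assms(1), of j] sector_ladder[OF assms(2), of j] sector_ladder(1)[of _ "p - step j" j] sector_ladder(1)[of _ "q - step j" j]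
  by (simp_all add: ladder_dom_add ladder_dom_scaleC)

text \<open>The total number operators act as scalars on a sector. This, rather than an explicit expansion,
is what the orthogonality and the norm bounds below rest on.\<close>

lemma sector_number:
  assumes "f \<in> sector p"
  shows "(\<Sum>i\<in>UNIV. raise (Inl i) (lower (Inl i) f)) = of_int (fst p) *\<^sub>R f"
    "(\<Sum>i\<in>UNIV. raise (Inr i) (lower (Inr i) f)) = of_int (snd p) *\<^sub>R f"
proof -
  have "(\<Sum>i\<in>UNIV. raise (Inl i) (lower (Inl i) f)) = of_int (fst p) *\<^sub>R f
    \<and> (\<Sum>i\<in>UNIV. raise (Inr i) (lower (Inr i) f)) = of_int (snd p) *\<^sub>R f"
    using assms
  proof (induction rule: sector_induct)
    case (ket c)
    then show ?case by (auto simp: raise_lower_ketc deg_def simp flip: scaleR_left.sum)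
  next
    case (add f g)
    then show ?case by (simp add: raise_lower_linear sum.distrib scaleR_right_distrib)
  next
    case (scale c f)
    then show ?case by (simp add: raise_lower_linear scaleR_L2_scaleC_commute flip: L2.scale_sum_right)
  qed (simp add: ladder_dom_zero)
  then show "(\<Sum>i\<in>UNIV. raise (Inl i) (lower (Inl i) f)) = of_int (fst p) *\<^sub>R f"
    "(\<Sum>i\<in>UNIV. raise (Inr i) (lower (Inr i) f)) = of_int (snd p) *\<^sub>R f" by auto
qed

lemma sector_raise_lower_symmetric:
  assumes "f \<in> sector p" "g \<in> sector q"
  shows "cinner (raise j (lower j f)) g = cinner f (raise j (lower j g))"
  using sector_adjoint(2)[OF sector_ladder(1)[OF sector_ladder(2)[OF assms(1)]] assms(2), of j]
    sector_adjoint(1)[OF sector_ladder(1)[OF assms(1)] sector_ladder(2)[OF assms(2)], of j] by simp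

text \<open>Eigenvectors of a symmetric operator for different eigenvalues are orthogonal; one of the two total
number operators separates the sectors.\<close>

lemma sector_orthogonal:
  assumes f: "f \<in> sector p" and g: "g \<in> sector q" and pq: "p \<noteq> q"
  shows "cinner f g = 0"
proof -
  have "cinner (of_int (fst p) *\<^sub>R f) g = cinner f (of_int (fst q) *\<^sub>R g)"
    unfolding sector_number(1)[OF f, symmetric] sector_number(1)[OF g, symmetric]
    by (simp add: cinner_sum_left cinner_sum_right sector_raise_lower_symmetric[OF f g])
  moreover have "cinner (of_int (snd p) *\<^sub>R f) g = cinner f (of_int (snd q) *\<^sub>R g)"
    unfolding sector_number(2)[OF f, symmetric] sector_number(2)[OF g, symmetric]
    by (simp add: cinner_sum_left cinner_sum_right sector_raise_lower_symmetric[OF f g])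
  ultimately show ?thesis using pq by (auto simp: prod_eq_iff)
qed

definition level :: "int \<times> int \<Rightarrow> real" where "level p = of_int (fst p + snd p)"

text \<open>\<open>\<Sum>j. \<parallel>lower j f\<parallel>\<^sup>2 = \<langle>f, \<Sum>j. raise j (lower j f)\<rangle>\<close>, and the sum on the right is the total number
operator.\<close>

lemma sector_lower_norms:
  assumes f: "f \<in> sector p"
  shows "(\<Sum>j\<in>UNIV. (norm (lower j f))\<^sup>2) = level p * (norm f)\<^sup>2"
proof -
  have "complex_of_real ((norm (lower j f))\<^sup>2) = cinner f (raise j (lower j f))" for j
    unfolding cinner_self[symmetric] by (rule sector_adjoint[OF sector_ladder(1)[OF f] sector_ladder(2)[OF f]])
  then have "complex_of_real (\<Sum>j\<in>UNIV. (norm (lower j f))\<^sup>2) = cinner f (\<Sum>j\<in>UNIV. raise j (lower j f))"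
    by (simp only: of_real_sum cinner_sum_right)
  also have "(\<Sum>j\<in>UNIV. raise j (lower j f)) = (\<Sum>i\<in>UNIV. raise (Inl i) (lower (Inl i) f)) + (\<Sum>i\<in>UNIV. raise (Inr i) (lower (Inr i) f))"
    unfolding UNIV_Plus_UNIV[symmetric] by (subst sum.Plus) simp_all
  also have "\<dots> = level p *\<^sub>R f"
    unfolding sector_number[OF f] level_def by (simp add: scaleR_left_distrib)
  also have "cinner f (level p *\<^sub>R f) = of_real (level p * (norm f)\<^sup>2)"
    by (simp add: cinner_self)
  finally show ?thesis by (simp only: of_real_eq_iff)
qed

lemma sector_lower_bound: "f \<in> sector p \<Longrightarrow> (norm (lower j f))\<^sup>2 \<le> level p * (norm f)\<^sup>2"
  unfolding sector_lower_norms[symmetric] by (rule member_le_sum) auto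

lemma sector_level_nonneg:
  assumes "f \<in> sector p" "f \<noteq> 0" shows "level p \<ge> 0"
proof -
  have "0 \<le> level p * (norm f)\<^sup>2"
    unfolding sector_lower_norms[OF assms(1), symmetric] by (intro sum_nonneg) auto
  then show ?thesis using assms(2) by (simp add: zero_le_mult_iff)
qed

text \<open>The commutation relation gives \<open>\<parallel>raise j f\<parallel>\<^sup>2 = \<parallel>lower j f\<parallel>\<^sup>2 + \<parallel>f\<parallel>\<^sup>2\<close>.\<close>

lemma sector_raise_bound:
  assumes f: "f \<in> sector p" shows "(norm (raise j f))\<^sup>2 \<le> (level p + 1) * (norm f)\<^sup>2"
proof -
  have "complex_of_real ((norm (raise j f))\<^sup>2) = cinner f (lower j (raise j f))"
    unfolding cinner_self[symmetric] by (rule sector_adjoint[OF sector_ladder(1)[OF f] sector_ladder(3)[OF f]])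
  also have "\<dots> = cinner f (raise j (lower j f)) + cinner f f"
    by (simp add: sector_commutator[OF f] cinner_add_right)
  also have "cinner f (raise j (lower j f)) = cinner (lower j f) (lower j f)"
    by (rule sector_adjoint[OF sector_ladder(1)[OF f] sector_ladder(2)[OF f], symmetric])
  finally have "complex_of_real ((norm (raise j f))\<^sup>2) = of_real ((norm (lower j f))\<^sup>2 + (norm f)\<^sup>2)"
    by (simp only: cinner_self of_real_add)
  then have "(norm (raise j f))\<^sup>2 = (norm (lower j f))\<^sup>2 + (norm f)\<^sup>2" by (simp only: of_real_eq_iff)
  then show ?thesis using sector_lower_bound[OF f, of j] by (simp add: algebra_simps)
qed

lemma level_step: "level (p + step j) = level p + 1" "level (p - step j) = level p - 1"
  by (cases j; simp add: level_def)+

datatype 'a ladder_op = Lower 'a | Raise 'a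

fun apply_op :: "('d::finite + 'd) ladder_op \<Rightarrow> 'd phase L2 \<Rightarrow> 'd phase L2" where
  "apply_op (Lower j) = lower j" | "apply_op (Raise j) = raise j"

fun shift :: "('d + 'd) ladder_op \<Rightarrow> int \<times> int" where
  "shift (Lower j) = - step j" | "shift (Raise j) = step j"

lemma sector_apply_op: "f \<in> sector p \<Longrightarrow> apply_op Z f \<in> sector (p + shift Z)"
  by (cases Z) (simp_all add: sector_ladder)

lemma sector_apply_op_bound:
  assumes "f \<in> sector p" shows "(norm (apply_op Z f))\<^sup>2 \<le> (level p + 1) * (norm f)\<^sup>2"
proof (cases Z)
  case (Lower j)
  have "level p * (norm f)\<^sup>2 \<le> (level p + 1) * (norm f)\<^sup>2" by (simp add: mult_right_mono)
  then show ?thesis using sector_lower_bound[OF assms, of j] by (simp add: Lower)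
next
  case (Raise j)
  then show ?thesis using sector_raise_bound[OF assms] by simp
qed

lemma level_shift: "level (p + shift Z) \<le> level p + 1"
  by (cases Z) (simp_all add: level_step)

lemma sector_apply_op2_bound:
  assumes f: "f \<in> sector p" shows "(norm (apply_op Y (apply_op Z f)))\<^sup>2 \<le> (level p + 2)\<^sup>2 * (norm f)\<^sup>2"
proof (cases "f = 0")
  case True
  have "apply_op Z' 0 = 0" for Z' :: "('a + 'a) ladder_op" by (cases Z') (simp_all add: ladder_dom_zero)
  then show ?thesis using True by simp
next
  case False
  have p: "level p \<ge> 0" by (rule sector_level_nonneg[OF f False])
  have "(norm (apply_op Y (apply_op Z f)))\<^sup>2 \<le> (level (p + shift Z) + 1) * (norm (apply_op Z f))\<^sup>2"
    by (rule sector_apply_op_bound[OF sector_apply_op[OF f]])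
  also have "\<dots> \<le> (level p + 2) * ((level p + 2) * (norm f)\<^sup>2)"
  proof (rule mult_mono)
    show "level (p + shift Z) + 1 \<le> level p + 2" using level_shift[of p Z] by simp
    have "(level p + 1) * (norm f)\<^sup>2 \<le> (level p + 2) * (norm f)\<^sup>2" by (simp add: mult_right_mono)
    then show "(norm (apply_op Z f))\<^sup>2 \<le> (level p + 2) * (norm f)\<^sup>2"
      using sector_apply_op_bound[OF f, of Z] by linarith
  qed (use p in auto)
  finally show ?thesis by (simp add: power2_eq_square mult_ac)
qed

text \<open>The weaker weight matches the bound for two operators, so that a single summability condition
serves both orders.\<close>

lemma sector_apply_op_bound':
  assumes f: "f \<in> sector p" shows "(norm (apply_op Z f))\<^sup>2 \<le> (level p + 2)\<^sup>2 * (norm f)\<^sup>2"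
proof (cases "f = 0")
  case True
  have "apply_op Z' 0 = 0" for Z' :: "('a + 'a) ladder_op" by (cases Z') (simp_all add: ladder_dom_zero)
  then show ?thesis using True by simp
next
  case False
  have p: "level p \<ge> 0" by (rule sector_level_nonneg[OF f False])
  have "level p + 1 \<le> (level p + 2)\<^sup>2" using p by (simp add: power2_eq_square algebra_simps)
  then have "(level p + 1) * (norm f)\<^sup>2 \<le> (level p + 2)\<^sup>2 * (norm f)\<^sup>2" by (simp add: mult_right_mono)
  then show ?thesis using sector_apply_op_bound[OF f, of Z] by linarith
qed

lemma sector_summable:
  assumes g: "\<And>k. g k \<in> sector (\<pi> k)" and inj: "inj \<pi>" and s: "(\<lambda>k. (norm (g k))\<^sup>2) summable_on UNIV"
  shows "g summable_on UNIV"
proof (rule orthogonal_summable[OF _ s])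
  show "inner (g i) (g j) = 0" if "i \<noteq> j" for i j
    using sector_orthogonal[OF g g, of i j] inj that by (auto simp: inner_L2_def inj_eq)
qed

text \<open>An orthogonal series may be lowered and raised termwise when the resulting series converge: their
terms lie in distinct sectors again, and the relation is closed.\<close>

lemma graded_ladder:
  assumes g: "\<And>k. g k \<in> sector (\<pi> k)" and inj: "inj \<pi>" and f: "(g has_sum f) UNIV"
    and s: "\<And>Z. (\<lambda>k. (norm (apply_op Z (g k)))\<^sup>2) summable_on UNIV"
  shows "f \<in> ladder_dom j" "((\<lambda>k. apply_op Z (g k)) has_sum apply_op Z f) UNIV"
proof -
  have su: "(\<lambda>k. apply_op Z (g k)) summable_on UNIV" for Z
    by (rule sector_summable[where \<pi>="\<lambda>k. \<pi> k + shift Z"]) (use g inj s in \<open>auto simp: sector_apply_op inj_def\<close>)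
  have L: "ladder (dir j) f (infsum (\<lambda>k. lower j (g k)) UNIV) (infsum (\<lambda>k. raise j (g k)) UNIV)" for j
    by (rule ladder_has_sum[OF f has_sum_infsum has_sum_infsum])
       (use su[of "Lower j"] su[of "Raise j"] sector_ladder(1)[OF g] in \<open>auto simp: ladder_dom_def\<close>)
  show "f \<in> ladder_dom j" by (rule ladder_domI(1)[OF L])
  have "apply_op Z f = infsum (\<lambda>k. apply_op Z (g k)) UNIV"
    using ladder_domI[OF L] by (cases Z) auto
  then show "((\<lambda>k. apply_op Z (g k)) has_sum apply_op Z f) UNIV" using su by simp
qed

lemma F_AB_sector: "F_AB A B = (sector (int A, int B) :: 'd::finite phase L2 set)"
proof -
  have "{ket a b | a b. (\<Sum>i\<in>UNIV. a i) = A \<and> (\<Sum>i\<in>UNIV. b i) = B}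
      = (ketc ` {c. deg c = (int A, int B)} :: 'd phase L2 set)"
  proof (intro set_eqI iffI)
    fix x :: "'d phase L2" assume "x \<in> {ket a b | a b. (\<Sum>i\<in>UNIV. a i) = A \<and> (\<Sum>i\<in>UNIV. b i) = B}"
    then obtain a b where "x = ket a b" "(\<Sum>i\<in>UNIV. a i) = A" "(\<Sum>i\<in>UNIV. b i) = B" by blast
    then have "x = ketc (case_sum a b)" "deg (case_sum a b) = (int A, int B)"
      by (simp_all add: ketc_def deg_def)
    then show "x \<in> ketc ` {c. deg c = (int A, int B)}" by blast
  next
    fix x :: "'d phase L2" assume "x \<in> ketc ` {c. deg c = (int A, int B)}"
    then obtain c where "x = ketc c" "deg c = (int A, int B)" by blast
    then show "x \<in> {ket a b | a b. (\<Sum>i\<in>UNIV. a i) = A \<and> (\<Sum>i\<in>UNIV. b i) = B}"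
      by (auto simp: ketc_def deg_def simp flip: of_nat_sum)
  qed
  then show ?thesis by (simp add: F_AB_def sector_def)
qed

section \<open>Eigenspaces of the operator N and the energy space\<close>

lemma subspace_cinner_left: "L2.subspace {f. cinner f g = 0}"
  by (rule L2.subspaceI) (simp_all add: cinner_add_left)

lemma subspace_cinner_right: "L2.subspace {g. cinner f g = 0}"
  by (rule L2.subspaceI) (simp_all add: cinner_add_right)

lemma closed_cinner_left: "closed {f. cinner f g = 0}"
  by (intro closed_Collect_eq continuous_intros linear_continuous_on bounded_linear_cinner_left)

lemma closed_cinner_right: "closed {g. cinner f g = 0}"
  by (intro closed_Collect_eq continuous_intros linear_continuous_on bounded_linear_cinner_right)

lemma subspace_closure:
  assumes S: "L2.subspace S" shows "L2.subspace (closure S)"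
proof (rule L2.subspaceI)
  show "0 \<in> closure S" using L2.subspace_0[OF S] closure_subset by blast
next
  fix x y assume "x \<in> closure S" "y \<in> closure S"
  then obtain u w where u: "\<And>n. u n \<in> S" "u \<longlonglongrightarrow> x" and w: "\<And>n. w n \<in> S" "w \<longlonglongrightarrow> y"
    by (auto simp: closure_sequential)
  then show "x + y \<in> closure S"
    unfolding closure_sequential using L2.subspace_add[OF S]
    by (intro exI[of _ "\<lambda>n. u n + w n"]) (auto intro: tendsto_add)
next
  fix c x assume "x \<in> closure S"
  then obtain u where u: "\<And>n. u n \<in> S" "u \<longlonglongrightarrow> x"
    by (auto simp: closure_sequential)
  then show "c *\<^sub>C x \<in> closure S"
    unfolding closure_sequential using L2.subspace_scale[OF S]
    by (intro exI[of _ "\<lambda>n. c *\<^sub>C u n"]) (auto intro: bounded_linear.tendsto[OF bounded_linear_scaleC])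
qed

lemma F_N_subspace: "L2.subspace (F_N N)"
  unfolding F_N_def by (intro subspace_closure L2.subspace_span)

lemma F_N_induct_closed:
  assumes "f \<in> F_N N" "closed T" "L2.subspace T" "\<And>p. snd p - fst p = N \<Longrightarrow> sector p \<subseteq> T"
  shows "f \<in> T"
proof -
  have "L2.span (\<Union>{F_AB A B | A B. int B - int A = N}) \<subseteq> T"
    by (rule L2.span_minimal[OF _ assms(3)]) (use assms(4) in \<open>fastforce simp: F_AB_sector\<close>)
  then have "F_N N \<subseteq> T"
    unfolding F_N_def by (rule closure_minimal[OF _ assms(2)])
  then show ?thesis using assms(1) by blast
qed

lemma F_N_orthogonal_sector:
  assumes f: "f \<in> F_N N" and g: "g \<in> sector p" and "snd p - fst p \<noteq> N"
  shows "cinner f g = 0"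
proof -
  have "f \<in> {f. cinner f g = 0}"
    by (rule F_N_induct_closed[OF f closed_cinner_left subspace_cinner_left])
       (use assms(3) sector_orthogonal[OF _ g] in auto)
  then show ?thesis by simp
qed

lemma F_N_orthogonal:
  assumes f: "f \<in> F_N N" and g: "g \<in> F_N M" and "N \<noteq> M"
  shows "cinner f g = 0"
proof -
  have "g \<in> {g. cinner f g = 0}"
    by (rule F_N_induct_closed[OF g closed_cinner_right subspace_cinner_right])
       (use assms(3) F_N_orthogonal_sector[OF f] in auto)
  then show ?thesis by simp
qed

lemma has_sum_finite_sum:
  fixes f :: "'i \<Rightarrow> 'k \<Rightarrow> 'b::real_normed_vector"
  assumes "\<And>i. i \<in> I \<Longrightarrow> (f i has_sum F i) A"
  shows "((\<lambda>k. \<Sum>i\<in>I. f i k) has_sum (\<Sum>i\<in>I. F i)) A"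
  using assms by (induction I rule: infinite_finite_induct) (auto intro: has_sum_add)

lemma has_sum_diff':
  fixes f :: "'k \<Rightarrow> 'b::real_normed_vector"
  assumes "(f has_sum F) A" "(g has_sum G) A"
  shows "((\<lambda>k. f k - g k) has_sum (F - G)) A"
proof -
  have "((\<lambda>k. - g k) has_sum - G) A"
    using assms(2) by (simp add: has_sum_uminus)
  from has_sum_add[OF assms(1) this] show ?thesis by simp
qed

definition int_pair :: "nat \<times> nat \<Rightarrow> int \<times> int" where "int_pair k = (int (fst k), int (snd k))"

lemma inj_int_pair: "inj int_pair" by (auto simp: inj_def int_pair_def prod_eq_iff)

text \<open>The weight bounds the images of the terms under any two ladder operators; it is equivalent to the
one in \<^const>\<open>V_space\<close> except at the term of index \<open>(0, 0)\<close>, where the latter vanishes.\<close>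

definition graded_expansion :: "(nat \<times> nat \<Rightarrow> 'd::finite phase L2) \<Rightarrow> 'd phase L2 \<Rightarrow> bool" where
  "graded_expansion g f \<longleftrightarrow> (\<forall>k. g k \<in> sector (int_pair k)) \<and> (g has_sum f) UNIV \<and>
     (\<lambda>k. (level (int_pair k) + 2)\<^sup>2 * (norm (g k))\<^sup>2) summable_on UNIV"

lemma expansion_sector: "graded_expansion g f \<Longrightarrow> g k \<in> sector (int_pair k)"
  unfolding graded_expansion_def by blast

lemma V_space_expansion:
  assumes "f \<in> V_space" obtains g where "graded_expansion g f"
proof -
  obtain g where g: "\<And>A B. g (A, B) \<in> F_AB A B" "(g has_sum f) UNIV"
    and s: "(\<lambda>(A, B). (real A ^ 2 + real B ^ 2) * (norm (g (A, B)))\<^sup>2) summable_on UNIV"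
    using assms unfolding V_space_def by blast
  have E: "g k \<in> sector (int_pair k)" for k using g(1)[of "fst k" "snd k"] by (simp add: F_AB_sector int_pair_def)
  \<comment> \<open>\<open>(A + B + 2)\<^sup>2 \<le> 9 (A + B)\<^sup>2 \<le> 18 (A\<^sup>2 + B\<^sup>2)\<close> unless \<open>A = B = 0\<close>; that index gets its own term\<close>
  define h where "h k = 18 * ((real (fst k) ^ 2 + real (snd k) ^ 2) * (norm (g k))\<^sup>2)
     + (if k = (0, 0) then 4 * (norm (g k))\<^sup>2 else 0)" for k
  have "(\<lambda>k. (real (fst k) ^ 2 + real (snd k) ^ 2) * (norm (g k))\<^sup>2) summable_on UNIV"
    using s by (simp add: case_prod_unfold)
  moreover have "(\<lambda>k. if k = (0, 0) then 4 * (norm (g k))\<^sup>2 else 0) summable_on (UNIV :: (nat \<times> nat) set)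
      \<longleftrightarrow> (\<lambda>k. if k = (0, 0) then 4 * (norm (g k))\<^sup>2 else 0) summable_on {(0, 0)}"
    by (rule summable_on_cong_neutral) auto
  ultimately have hs: "h summable_on UNIV"
    unfolding h_def by (intro summable_on_add summable_on_cmult_right) auto
  have le: "(level (int_pair k) + 2)\<^sup>2 * (norm (g k))\<^sup>2 \<le> h k" for k
  proof -
    obtain A B where k: "k = (A, B)" by (cases k)
    show ?thesis
    proof (cases "k = (0, 0)")
      case False
      then have "1 \<le> A + B" using k by auto
      then have "1 \<le> real A + real B" by linarith
      then have "(real A + real B + 2)\<^sup>2 \<le> (3 * (real A + real B))\<^sup>2" by (intro power_mono) auto
      also have "\<dots> \<le> 18 * (real A ^ 2 + real B ^ 2)"
        using sum_squares_bound[of "real A" "real B"] by (simp add: power2_sum power_mult_distrib)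
      finally show ?thesis
        using False k by (simp add: h_def level_def int_pair_def mult_right_mono mult.assoc[symmetric] del: mult.assoc)
    qed (simp add: h_def level_def int_pair_def)
  qed
  have "(\<lambda>k. (level (int_pair k) + 2)\<^sup>2 * (norm (g k))\<^sup>2) summable_on UNIV"
    by (rule summable_on_comparison_test[OF hs le]) simp
  then show ?thesis using that E g(2) unfolding graded_expansion_def by blast
qed

lemma expansion_ladder:
  assumes "graded_expansion g f"
  shows "f \<in> ladder_dom j" "((\<lambda>k. apply_op Z (g k)) has_sum apply_op Z f) UNIV"
    "apply_op Z f \<in> ladder_dom j" "((\<lambda>k. apply_op Y (apply_op Z (g k))) has_sum apply_op Y (apply_op Z f)) UNIV"
proof -
  have E: "g k \<in> sector (int_pair k)" for k by (rule expansion_sector[OF assms])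
  have hs: "(g has_sum f) UNIV" and s: "(\<lambda>k. (level (int_pair k) + 2)\<^sup>2 * (norm (g k))\<^sup>2) summable_on UNIV"
    using assms by (auto simp: graded_expansion_def)
  have compare: "(\<lambda>k. (norm (h k))\<^sup>2) summable_on UNIV" if "\<And>k. (norm (h k))\<^sup>2 \<le> (level (int_pair k) + 2)\<^sup>2 * (norm (g k))\<^sup>2" for h :: "nat \<times> nat \<Rightarrow> 'a phase L2"
    by (rule summable_on_comparison_test[OF s that]) simp
  have s1: "(\<lambda>k. (norm (apply_op Z (g k)))\<^sup>2) summable_on UNIV" for Z
    by (rule compare) (rule sector_apply_op_bound'[OF E])
  have s2: "(\<lambda>k. (norm (apply_op Y (apply_op Z (g k))))\<^sup>2) summable_on UNIV" for Y Z
    by (rule compare) (rule sector_apply_op2_bound[OF E])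
  show "f \<in> ladder_dom j" and l: "((\<lambda>k. apply_op Z (g k)) has_sum apply_op Z f) UNIV" for j Z
    by (rule graded_ladder[OF E inj_int_pair hs s1])+
  have inj: "inj (\<lambda>k. int_pair k + shift Z)" using inj_int_pair by (simp add: inj_def)
  show "apply_op Z f \<in> ladder_dom j" "((\<lambda>k. apply_op Y (apply_op Z (g k))) has_sum apply_op Y (apply_op Z f)) UNIV"
    by (rule graded_ladder[OF sector_apply_op[OF E] inj l s2])+
qed

lemma V_space_ladder_dom:
  assumes "f \<in> V_space"
  shows "f \<in> ladder_dom j" "lower i f \<in> ladder_dom j" "raise i f \<in> ladder_dom j"
proof -
  obtain g where g: "graded_expansion g f" using V_space_expansion[OF assms] by blast
  show "f \<in> ladder_dom j" "lower i f \<in> ladder_dom j" "raise i f \<in> ladder_dom j"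
    using expansion_ladder(1)[OF g] expansion_ladder(3)[OF g, of "Lower i"] expansion_ladder(3)[OF g, of "Raise i"] by auto
qed

text \<open>The operator in the second term of \<^const>\<open>X_H\<close>. It raises the eigenvalue of \<^const>\<open>op_N\<close> by \<open>2\<close>.\<close>

definition op_K :: "'d::finite phase L2 \<Rightarrow> 'd phase L2" where
  "op_K f = (\<Sum>i\<in>UNIV. op_b' i (op_b' i f) - op_a i (op_a i f))"

lemma V_space_op_linear:
  assumes "\<And>i. i \<in> I \<Longrightarrow> f i \<in> V_space"
  shows "op_N (\<Sum>i\<in>I. c i *\<^sub>C f i) = (\<Sum>i\<in>I. c i *\<^sub>C op_N (f i))"
    "op_K (\<Sum>i\<in>I. c i *\<^sub>C f i) = (\<Sum>i\<in>I. c i *\<^sub>C op_K (f i))"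
proof -
  have 1: "raise j (lower j (\<Sum>i\<in>I. c i *\<^sub>C f i)) = (\<Sum>i\<in>I. c i *\<^sub>C raise j (lower j (f i)))" for j
    using assms by (subst ladder_dom_linear_combination, simp add: V_space_ladder_dom)+ simp
  have 2: "raise j (raise j (\<Sum>i\<in>I. c i *\<^sub>C f i)) = (\<Sum>i\<in>I. c i *\<^sub>C raise j (raise j (f i)))" for j
    using assms by (subst ladder_dom_linear_combination, simp add: V_space_ladder_dom)+ simp
  have 3: "lower j (lower j (\<Sum>i\<in>I. c i *\<^sub>C f i)) = (\<Sum>i\<in>I. c i *\<^sub>C lower j (lower j (f i)))" for j
    using assms by (subst ladder_dom_linear_combination, simp add: V_space_ladder_dom)+ simp
  show "op_N (\<Sum>i\<in>I. c i *\<^sub>C f i) = (\<Sum>i\<in>I. c i *\<^sub>C op_N (f i))"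
    unfolding op_N_def op_lower_raise 1 L2.scale_sum_right L2.scale_right_diff_distrib
    unfolding sum_subtractf by (subst (1 2) sum.swap) (rule refl)
  show "op_K (\<Sum>i\<in>I. c i *\<^sub>C f i) = (\<Sum>i\<in>I. c i *\<^sub>C op_K (f i))"
    unfolding op_K_def op_lower_raise 2 3 L2.scale_sum_right L2.scale_right_diff_distrib
    unfolding sum_subtractf by (subst (1 2) sum.swap) (rule refl)
qed

text \<open>\<open>\<parallel>g k\<parallel>\<^sup>2 = \<langle>f, g k\<rangle>\<close> by orthogonality of the expansion, and \<open>F_N N\<close> is orthogonal to the sectors of
a different index.\<close>

lemma expansion_vanishes:
  assumes g: "graded_expansion g f" and f: "f \<in> F_N N" and k: "snd (int_pair k) - fst (int_pair k) \<noteq> N"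
  shows "g k = 0"
proof -
  have E: "g k \<in> sector (int_pair k)" for k by (rule expansion_sector[OF g])
  have "((\<lambda>i. cinner (g i) (g k)) has_sum cinner f (g k)) UNIV"
    by (rule has_sum_bounded_linear[OF bounded_linear_cinner_left]) (use g in \<open>simp add: graded_expansion_def\<close>)
  also have "?this \<longleftrightarrow> ((\<lambda>i. cinner (g i) (g k)) has_sum cinner f (g k)) {k}"
    by (rule has_sum_cong_neutral) (use sector_orthogonal[OF E E] inj_int_pair in \<open>auto simp: inj_eq\<close>)
  finally have "cinner f (g k) = cinner (g k) (g k)"
    using has_sum_unique[OF _ has_sum_finite[of "{k}" "\<lambda>i. cinner (g i) (g k)"]] by simp
  moreover have "cinner f (g k) = 0" by (rule F_N_orthogonal_sector[OF f E k])
  ultimately show ?thesis by (simp add: cinner_self)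
qed

text \<open>Every nonzero term of the expansion lies in a sector \<open>(A, B)\<close> with \<open>B - A = N\<close>, where \<^const>\<open>op_N\<close> is
multiplication by \<open>N\<close>; the operator is applied termwise.\<close>

lemma F_N_eigenvector:
  assumes V: "f \<in> V_space" and f: "f \<in> F_N N"
  shows "op_N f = of_int N *\<^sub>R f"
proof -
  obtain g where g: "graded_expansion g f" using V_space_expansion[OF V] by blast
  have E: "g k \<in> sector (int_pair k)" for k by (rule expansion_sector[OF g])
  have "((\<lambda>k. op_N (g k)) has_sum op_N f) UNIV"
    unfolding op_N_def op_lower_raise
    using expansion_ladder(4)[OF g, of "Raise _" "Lower _"] by (intro has_sum_finite_sum has_sum_diff') simp_all
  moreover have "op_N (g k) = of_int N *\<^sub>R g k" for k
  proof (cases "snd (int_pair k) - fst (int_pair k) = N")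
    case True
    have "op_N (g k) = of_int (snd (int_pair k) - fst (int_pair k)) *\<^sub>R g k"
      unfolding op_N_def op_lower_raise sum_subtractf sector_number[OF E] by (simp add: scaleR_left_diff_distrib)
    then show ?thesis by (simp add: True)
  next
    case False
    then show ?thesis using expansion_vanishes[OF g f] by (simp add: op_N_def op_lower_raise ladder_dom_zero)
  qed
  moreover have "((\<lambda>k. of_int N *\<^sub>R g k) has_sum of_int N *\<^sub>R f) UNIV"
    using g by (intro has_sum_scaleR) (simp add: graded_expansion_def)
  ultimately show ?thesis using has_sum_unique by simp
qed

text \<open>Applied termwise, \<^const>\<open>op_K\<close> moves every term into sectors whose index difference is \<open>N + 2\<close>.\<close>

lemma F_N_op_K_orthogonal:
  assumes V: "f \<in> V_space" and f: "f \<in> F_N N"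
  shows "cinner f (op_K f) = 0"
proof -
  obtain g where g: "graded_expansion g f" using V_space_expansion[OF V] by blast
  have E: "g k \<in> sector (int_pair k)" for k by (rule expansion_sector[OF g])
  have "((\<lambda>k. op_K (g k)) has_sum op_K f) UNIV"
    unfolding op_K_def op_lower_raise
    using expansion_ladder(4)[OF g, of "Raise _" "Raise _"] expansion_ladder(4)[OF g, of "Lower _" "Lower _"]
    by (intro has_sum_finite_sum has_sum_diff') simp_all
  then have hs: "((\<lambda>k. cinner f (op_K (g k))) has_sum cinner f (op_K f)) UNIV"
    by (rule has_sum_bounded_linear[OF bounded_linear_cinner_right])
  have "cinner f (op_K (g k)) = 0" for k
  proof (cases "snd (int_pair k) - fst (int_pair k) = N")
    case True
    have "cinner f (raise (Inr i) (raise (Inr i) (g k))) = 0" "cinner f (lower (Inl i) (lower (Inl i) (g k))) = 0" for i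
      using F_N_orthogonal_sector[OF f sector_ladder(3)[OF sector_ladder(3)[OF E]], of k "Inr i" "Inr i"]
        F_N_orthogonal_sector[OF f sector_ladder(2)[OF sector_ladder(2)[OF E]], of k "Inl i" "Inl i"] True
      by simp_all
    then show ?thesis
      unfolding op_K_def op_lower_raise by (simp add: cinner_sum_right cinner_diff_right)
  next
    case False
    then show ?thesis using expansion_vanishes[OF g f] by (simp add: op_K_def op_lower_raise ladder_dom_zero)
  qed
  then show ?thesis using hs has_sum_unique[OF has_sum_0_simp] by (metis (no_types, lifting) has_sum_cong)
qed

section \<open>Minimal centered subspaces\<close>

lemma span_Union_decomposition:
  fixes C :: "'i \<Rightarrow> 'a::euclidean_space L2 set"
  assumes C: "\<And>N. L2.subspace (C N)" and x: "x \<in> L2.span (\<Union>N. C N)"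
  obtains S g where "finite S" "\<And>N. N \<in> S \<Longrightarrow> g N \<in> C N" "\<And>N. N \<in> S \<Longrightarrow> g N \<noteq> 0" "x = (\<Sum>N\<in>S. g N)"
proof -
  let ?T = "{x. \<exists>S g. finite S \<and> (\<forall>N. g N \<in> C N) \<and> x = (\<Sum>N\<in>S. g N)}"
  have "L2.subspace ?T"
  proof (rule L2.subspaceI)
    show "0 \<in> ?T" using L2.subspace_0[OF C] by (auto intro!: exI[of _ "{}"] exI[of _ "\<lambda>_. 0"])
  next
    fix x y assume "x \<in> ?T" "y \<in> ?T"
    then obtain S g S' g' where *: "finite S" "\<And>N. g N \<in> C N" "x = (\<Sum>N\<in>S. g N)"
      "finite S'" "\<And>N. g' N \<in> C N" "y = (\<Sum>N\<in>S'. g' N)" by blast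
    define h where "h N = (if N \<in> S then g N else 0) + (if N \<in> S' then g' N else 0)" for N
    have "h N \<in> C N" for N
      unfolding h_def using *(2,5) L2.subspace_0[OF C] by (intro L2.subspace_add[OF C]) auto
    moreover have "(\<Sum>N\<in>S \<union> S'. h N) = x + y"
      unfolding h_def sum.distrib using * by (simp add: sum.If_cases Int_absorb1 Int_absorb2)
    ultimately show "x + y \<in> ?T" using *(1,4) by (intro CollectI exI[of _ "S \<union> S'"] exI[of _ h]) auto
  next
    fix c x assume "x \<in> ?T"
    then obtain S g where *: "finite S" "\<And>N. g N \<in> C N" "x = (\<Sum>N\<in>S. g N)" by blast
    then show "c *\<^sub>C x \<in> ?T"
      using L2.subspace_scale[OF C]
      by (intro CollectI exI[of _ S] exI[of _ "\<lambda>N. c *\<^sub>C g N"]) (auto simp: L2.scale_sum_right)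
  qed
  moreover have "(\<Union>N. C N) \<subseteq> ?T"
  proof safe
    fix N x assume "x \<in> C N"
    then show "\<exists>S g. finite S \<and> (\<forall>N. g N \<in> C N) \<and> x = (\<Sum>N\<in>S. g N)"
      using L2.subspace_0[OF C] by (intro exI[of _ "{N}"] exI[of _ "\<lambda>M. if M = N then x else 0"]) auto
  qed
  ultimately have "x \<in> ?T" using x L2.span_minimal[of "\<Union>N. C N" ?T] by blast
  then obtain S g where *: "finite S" "\<And>N. g N \<in> C N" "x = (\<Sum>N\<in>S. g N)" by blast
  show ?thesis
  proof (rule that[of "{N\<in>S. g N \<noteq> 0}" g])
    show "x = (\<Sum>N\<in>{N\<in>S. g N \<noteq> 0}. g N)"
      unfolding *(3) by (rule sum.mono_neutral_right) (use *(1) in auto)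
  qed (use * in auto)
qed

lemma component_subspace: "L2.subspace W \<Longrightarrow> L2.subspace (component W N)"
  unfolding component_def by (rule L2.subspace_inter) (auto intro: F_N_subspace)

text \<open>The dimension of a subspace that is not finitely generated is \<open>0\<close> by convention, hence the finite
spanning set.\<close>

lemma dim_positive:
  assumes "L2.subspace V" "x \<in> V" "x \<noteq> 0" "V \<subseteq> L2.span S" "finite S"
  shows "L2.dim V > 0"
proof -
  obtain B where B: "B \<subseteq> V" "\<not> L2.dependent B" "V \<subseteq> L2.span B" "card B = L2.dim V"
    using L2.basis_exists[of V] by blast
  have "finite B"
    using L2.independent_span_bound[OF assms(5) B(2)] B(1) assms(4) by blast
  moreover have "B \<noteq> {}" using B(3) assms(2,3) by auto
  ultimately show ?thesis using B(4) card_gt_0_iff by metis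
qed

lemma orthogonal_coefficient:
  assumes "finite S" "N \<in> S" and orth: "\<And>M N. M \<in> S \<Longrightarrow> N \<in> S \<Longrightarrow> M \<noteq> N \<Longrightarrow> cinner (b M) (b N) = 0"
  shows "cinner (\<Sum>M\<in>S. c M *\<^sub>C b M) (b N) = c N * of_real ((norm (b N))\<^sup>2)"
proof -
  have "cinner (\<Sum>M\<in>S. c M *\<^sub>C b M) (b N) = (\<Sum>M\<in>{N}. c M * cinner (b M) (b N))"
    unfolding cinner_sum_left cinner_scaleC_left
    by (rule sum.mono_neutral_right) (use assms in auto)
  then show ?thesis by (simp add: cinner_self)
qed

lemma span_image_representation:
  assumes "finite S" "x \<in> L2.span (b ` S)" obtains c where "x = (\<Sum>N\<in>S. c N *\<^sub>C b N)"
proof -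
  let ?T = "{x. \<exists>c. x = (\<Sum>N\<in>S. c N *\<^sub>C b N)}"
  have "L2.subspace ?T"
  proof (rule L2.subspaceI)
    show "0 \<in> ?T" by (auto intro!: exI[of _ "\<lambda>_. 0"])
  next
    fix x y assume "x \<in> ?T" "y \<in> ?T"
    then obtain c d where "x = (\<Sum>N\<in>S. c N *\<^sub>C b N)" "y = (\<Sum>N\<in>S. d N *\<^sub>C b N)" by blast
    then show "x + y \<in> ?T"
      by (auto intro!: exI[of _ "\<lambda>N. c N + d N"] simp: L2.scale_left_distrib sum.distrib)
  next
    fix k x assume "x \<in> ?T"
    then obtain c where "x = (\<Sum>N\<in>S. c N *\<^sub>C b N)" by blast
    then show "k *\<^sub>C x \<in> ?T"
      by (auto intro!: exI[of _ "\<lambda>N. k * c N"] simp: L2.scale_sum_right)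
  qed
  moreover have "b ` S \<subseteq> ?T"
  proof safe
    fix N assume "N \<in> S"
    have "(\<Sum>M\<in>S. (if M = N then 1 else 0) *\<^sub>C b M) = (\<Sum>M\<in>{N}. (if M = N then 1 else 0) *\<^sub>C b M)"
      by (rule sum.mono_neutral_right) (use assms(1) \<open>N \<in> S\<close> in auto)
    then show "\<exists>c. b N = (\<Sum>N\<in>S. c N *\<^sub>C b N)" by (intro exI[of _ "\<lambda>M. if M = N then 1 else 0"]) simp
  qed
  ultimately have "x \<in> ?T" using assms(2) L2.span_minimal[of "b ` S" ?T] by blast
  then show ?thesis using that by blast
qed

text \<open>The difference of the two sides is orthogonal to itself: it lies in \<open>F_N M\<close> and is a combination of
vectors from the other eigenspaces.\<close>

lemma F_N_coefficients:
  assumes S: "finite S" and b: "\<And>N. N \<in> S \<Longrightarrow> b N \<in> F_N N" and x: "x = (\<Sum>N\<in>S. c N *\<^sub>C b N)" "x \<in> F_N M"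
  shows "x = (if M \<in> S then c M *\<^sub>C b M else 0)"
proof -
  define y where "y = (if M \<in> S then c M *\<^sub>C b M else 0)"
  have y: "y \<in> F_N M"
    unfolding y_def using b L2.subspace_scale[OF F_N_subspace] L2.subspace_0[OF F_N_subspace] by auto
  have eq: "x - y = (\<Sum>N\<in>S - {M}. c N *\<^sub>C b N)"
    unfolding x(1) y_def using S by (auto simp: sum_diff1)
  have d: "x - y \<in> F_N M" using L2.subspace_diff[OF F_N_subspace x(2) y] .
  have zero: "cinner (c N *\<^sub>C b N) (x - y) = 0" if "N \<in> S - {M}" for N
    using F_N_orthogonal[OF b d] that by simp
  have "cinner (x - y) (x - y) = (\<Sum>N\<in>S - {M}. cinner (c N *\<^sub>C b N) (x - y))"
    by (subst (1) eq) (rule cinner_sum_left)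
  also have "\<dots> = 0" by (rule sum.neutral) (use zero in blast)
  finally have "cinner (x - y) (x - y) = 0" .
  then have "x - y = 0" by (simp add: cinner_self)
  then show ?thesis by (simp add: y_def)
qed

lemma enat_Inf_attained:
  assumes "Inf A = enat J" shows "enat J \<in> A"
proof -
  have "A \<noteq> {}" using assms by (auto simp: Inf_enat_def)
  then show ?thesis using assms LeastI_ex[of "\<lambda>x. x \<in> A"] by (auto simp: Inf_enat_def)
qed

lemma centeredD:
  assumes "centered W"
  shows "L2.subspace W" "\<exists>S. finite S \<and> W = L2.span S" "W \<subseteq> V_space" "W = L2.span (\<Union>N. component W N)"
    "\<And>\<beta> i. \<beta> \<in> W \<Longrightarrow> Re (cinner \<beta> (op_a i \<beta>)) = 0"
    "\<And>\<beta> i. \<beta> \<in> W \<Longrightarrow> Re (cinner \<beta> (op_b i \<beta>)) = 0"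
  using assms unfolding centered_def by blast+

text \<open>The span of the components of \<open>\<beta>\<^sub>0\<close> is a centered subspace of \<open>W\<close> containing \<open>\<beta>\<^sub>0\<close>, hence all of
\<open>W\<close>. Its nonzero eigencomponents are the lines through the \<open>b N\<close>. The oscillation index is an
attained infimum, which gives \<open>J \<le> card S\<close> at once. Conversely a centered \<open>U\<close> that attains it contains
\<open>W\<close> and so has the indices in \<open>S\<close>; for \<open>J = 1\<close> the set of its indices has cardinality \<open>1\<close>,
hence is finite, and \<open>S\<close> is a singleton.\<close>

lemma minimal_centered_structure:
  assumes norm: "norm \<beta>\<^sub>0 = 1" and ind: "ind_osc \<beta>\<^sub>0 = enat J" and min: "minimal_centered W \<beta>\<^sub>0"
  obtains S b where "finite S" "S \<noteq> {}" "\<And>N. N \<in> S \<Longrightarrow> b N \<in> F_N N" "\<And>N. N \<in> S \<Longrightarrow> b N \<in> W"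
    "\<And>N. N \<in> S \<Longrightarrow> b N \<noteq> 0" "\<beta>\<^sub>0 = (\<Sum>N\<in>S. b N)" "{N. L2.dim (component W N) > 0} = S"
    "J \<le> card S" "J = 1 \<Longrightarrow> card S = 1"
proof -
  have W: "centered W" "\<beta>\<^sub>0 \<in> W" using min by (auto simp: minimal_centered_def)
  note sub = centeredD(1)[OF W(1)] and V = centeredD(3)[OF W(1)] and sp = centeredD(4)[OF W(1)]
    and re = centeredD(5,6)[OF W(1)]
  have "\<beta>\<^sub>0 \<in> L2.span (\<Union>N. component W N)"
    by (rule subst[OF sp, of "\<lambda>X. \<beta>\<^sub>0 \<in> X"]) (rule W(2))
  then obtain S b where S: "finite S" and b: "\<And>N. N \<in> S \<Longrightarrow> b N \<in> component W N" "\<And>N. N \<in> S \<Longrightarrow> b N \<noteq> 0"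
    and sum: "\<beta>\<^sub>0 = (\<Sum>N\<in>S. b N)"
    by (rule span_Union_decomposition[OF component_subspace[OF sub]]) blast
  have bW: "b N \<in> W" "b N \<in> F_N N" if "N \<in> S" for N using b(1)[OF that] by (auto simp: component_def)
  \<comment> \<open>inherits the vanishing of the first moments from \<open>W\<close>, and is centered\<close>
  define W' where "W' = L2.span (b ` S)"
  have W'W: "W' \<subseteq> W" unfolding W'_def by (rule L2.span_minimal[OF _ sub]) (use bW in auto)
  have sub': "L2.subspace W'" by (simp add: W'_def)
  have "centered W'"
    unfolding centered_def
  proof (intro conjI)
    show "\<exists>S. finite S \<and> W' = L2.span S" using S W'_def by blast
    show "W' = L2.span (\<Union>N. component W' N)"
    proof
      have "b ` S \<subseteq> (\<Union>N. component W' N)"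
        using bW L2.span_base[of _ "b ` S"] by (auto simp: component_def W'_def)
      then show "W' \<subseteq> L2.span (\<Union>N. component W' N)"
        unfolding W'_def by (rule L2.span_mono)
      show "L2.span (\<Union>N. component W' N) \<subseteq> W'"
        by (rule L2.span_minimal[OF _ sub']) (auto simp: component_def)
    qed
  qed (use sub' W'W V re in auto)
  moreover have "\<beta>\<^sub>0 \<in> W'"
    unfolding sum W'_def by (intro L2.span_sum L2.span_base) auto
  ultimately have eq: "W = W'" using min W'W by (auto simp: minimal_centered_def)
  have dimW: "{N. L2.dim (component W N) > 0} = S"
  proof (intro set_eqI iffI CollectI)
    fix N assume "N \<in> S"
    then show "L2.dim (component W N) > 0"
      using b S by (intro dim_positive[OF component_subspace[OF sub], of "b N" _ "b ` S"])
        (auto simp: component_def eq W'_def)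
  next
    fix N assume N: "N \<in> {N. L2.dim (component W N) > 0}"
    show "N \<in> S"
    proof (rule ccontr)
      assume "N \<notin> S"
      have "component W N \<subseteq> {0}"
      proof
        fix x assume "x \<in> component W N"
        then have x: "x \<in> F_N N" "x \<in> L2.span (b ` S)" by (auto simp: component_def eq W'_def)
        from S x(2) obtain c where "x = (\<Sum>N\<in>S. c N *\<^sub>C b N)" by (rule span_image_representation)
        from F_N_coefficients[OF S bW(2) this x(1)] \<open>N \<notin> S\<close> show "x \<in> {0}" by simp
      qed
      then have "L2.dim (component W N) \<le> 0"
        using L2.dim_le_card[of "component W N" "{}"] by simp
      then show False using N by simp
    qed
  qed
  have "enat J \<in> {enat (ind_dec W) | W. centered W \<and> \<beta>\<^sub>0 \<in> W}"
    using ind unfolding ind_osc_def by (rule enat_Inf_attained)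
  then obtain U where U: "centered U" "\<beta>\<^sub>0 \<in> U" "J = ind_dec U" by auto
  show ?thesis
  proof
    show "S \<noteq> {}" using norm sum by auto
    have "ind_osc \<beta>\<^sub>0 \<le> enat (ind_dec W)"
      unfolding ind_osc_def using W by (intro Inf_lower) auto
    then show "J \<le> card S" unfolding ind ind_dec_def dimW by simp
    show "card S = 1" if "J = 1"
    proof -
      have WU: "W \<subseteq> U" using min U by (auto simp: minimal_centered_def)
      obtain T where T: "finite T" "U = L2.span T" using centeredD(2)[OF U(1)] by blast
      have "S \<subseteq> {N. L2.dim (component U N) > 0}"
      proof (intro subsetI CollectI)
        fix N assume "N \<in> S"
        then show "L2.dim (component U N) > 0"
          using b bW WU T by (intro dim_positive[OF component_subspace[OF centeredD(1)[OF U(1)]], of "b N" _ T])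
            (auto simp: component_def)
      qed
      moreover have c: "card {N. L2.dim (component U N) > 0} = 1"
        using U(3) that by (simp add: ind_dec_def)
      moreover have "finite {N. L2.dim (component U N) > 0}" by (rule card_ge_0_finite) (simp add: c)
      ultimately have "card S \<le> 1" using card_mono by metis
      moreover have "card S > 0" using S \<open>S \<noteq> {}\<close> by (simp add: card_gt_0_iff)
      ultimately show ?thesis by simp
    qed
  qed (use S b bW sum dimW in auto)
qed

section \<open>The explicit solution\<close>

text \<open>The integers \<open>d\<close> with \<open>d x\<close> integral form an ideal, so by Bezout it contains \<open>D\<close> iff it contains the
gcd of \<open>D\<close>.\<close>

lemma Gcd_multiples_integral:
  fixes x :: real and D :: "int set"
  assumes "finite D"
  shows "(\<forall>d\<in>D. of_int d * x \<in> \<int>) \<longleftrightarrow> of_int (Gcd D) * x \<in> \<int>"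
proof
  assume "\<forall>d\<in>D. of_int d * x \<in> \<int>"
  with assms show "of_int (Gcd D) * x \<in> \<int>"
  proof (induction D rule: finite_induct)
    case (insert a A)
    obtain u v where uv: "u * a + v * Gcd A = gcd a (Gcd A)" using bezout_int by blast
    have "of_int (Gcd (insert a A)) * x = of_int u * (of_int a * x) + of_int v * (of_int (Gcd A) * x)"
      unfolding Gcd_insert uv[symmetric] by (simp add: algebra_simps)
    also have "\<dots> \<in> \<int>"
      using insert.prems insert.IH by (auto intro!: Ints_add Ints_mult[OF Ints_of_int, of "of_int _ * x"])
    finally show ?case .
  qed simp
next
  assume g: "of_int (Gcd D) * x \<in> \<int>"
  show "\<forall>d\<in>D. of_int d * x \<in> \<int>"
  proof
    fix d assume "d \<in> D"
    then obtain k where k: "d = Gcd D * k" using Gcd_dvd by (auto elim!: dvdE)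
    have eq: "of_int d * x = of_int k * (of_int (Gcd D) * x)" by (subst k) simp
    show "of_int d * x \<in> \<int>" unfolding eq by (rule Ints_mult[OF Ints_of_int g])
  qed
qed

lemma cis_eq_1_Ints: "cis x = 1 \<longleftrightarrow> x / (2 * pi) \<in> \<int>"
proof -
  have "x = of_int n * (2 * pi) \<longleftrightarrow> x / (2 * pi) = of_int n" for n
    by (auto simp: field_simps)
  then show ?thesis unfolding cis_eq_1_iff by (auto simp: Ints_def image_iff)
qed

lemma has_vector_derivative_cis:
  assumes "(f has_real_derivative f') (at t)"
  shows "((\<lambda>t. cis (f t)) has_vector_derivative (of_real f' * \<i> * cis (f t))) (at t)"
proof -
  have "(f has_derivative (\<lambda>h. f' * h)) (at t)" using assms by (simp add: has_field_derivative_def)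
  from has_derivative_cis[OF this]
  show ?thesis by (simp add: has_vector_derivative_def scaleR_conv_of_real mult_ac)
qed

lemma circle_orbit_eq_iff: "circle_orbit f = circle_orbit g \<longleftrightarrow> (\<exists>z. cmod z = 1 \<and> f = z *\<^sub>C g)"
proof
  assume "circle_orbit f = circle_orbit g"
  moreover have "f \<in> circle_orbit f" unfolding circle_orbit_def by (auto intro!: exI[of _ 1])
  ultimately show "\<exists>z. cmod z = 1 \<and> f = z *\<^sub>C g" by (auto simp: circle_orbit_def)
next
  assume "\<exists>z. cmod z = 1 \<and> f = z *\<^sub>C g"
  then obtain z where z: "cmod z = 1" "f = z *\<^sub>C g" by blast
  show "circle_orbit f = circle_orbit g"
  proof (intro set_eqI iffI)
    fix h assume "h \<in> circle_orbit f"
    then obtain w where "cmod w = 1" "h = (w * z) *\<^sub>C g" by (auto simp: circle_orbit_def z)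
    then show "h \<in> circle_orbit g" using z by (auto simp: circle_orbit_def norm_mult intro!: exI[of _ "w * z"])
  next
    fix h assume "h \<in> circle_orbit g"
    then obtain w where "cmod w = 1" "h = w *\<^sub>C g" by (auto simp: circle_orbit_def)
    moreover have "z \<noteq> 0" using z(1) by auto
    ultimately show "h \<in> circle_orbit f"
      by (auto simp: circle_orbit_def z norm_divide intro!: exI[of _ "w / z"])
  qed
qed

text \<open>The situation provided by a minimal centered subspace, with the subspace replaced by the family of
modes that spans it.\<close>

locale hartree_modes =
  fixes S :: "int set" and b :: "int \<Rightarrow> 'd::finite phase L2"
  assumes finS: "finite S" and neS: "S \<noteq> {}"
    and bF: "\<And>N. N \<in> S \<Longrightarrow> b N \<in> F_N N" and bV: "\<And>N. N \<in> S \<Longrightarrow> b N \<in> V_space"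
    and b0: "\<And>N. N \<in> S \<Longrightarrow> b N \<noteq> 0" and norm_sum: "norm (\<Sum>N\<in>S. b N) = 1"
    and span_V: "\<And>c. (\<Sum>N\<in>S. c N *\<^sub>C b N) \<in> V_space"
    and centered_a: "\<And>c i. Re (cinner (\<Sum>N\<in>S. c N *\<^sub>C b N) (op_a i (\<Sum>N\<in>S. c N *\<^sub>C b N))) = 0"
    and centered_b: "\<And>c i. Re (cinner (\<Sum>N\<in>S. c N *\<^sub>C b N) (op_b i (\<Sum>N\<in>S. c N *\<^sub>C b N))) = 0"
begin

definition mode_sum :: "(int \<Rightarrow> complex) \<Rightarrow> 'd phase L2" where "mode_sum c = (\<Sum>N\<in>S. c N *\<^sub>C b N)"

lemma orth: "M \<in> S \<Longrightarrow> N \<in> S \<Longrightarrow> M \<noteq> N \<Longrightarrow> cinner (b M) (b N) = 0"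
  by (rule F_N_orthogonal[OF bF bF])

lemma mode_sum_coefficient: "N \<in> S \<Longrightarrow> cinner (mode_sum c) (b N) = c N * of_real ((norm (b N))\<^sup>2)"
  unfolding mode_sum_def by (rule orthogonal_coefficient[OF finS _ orth])

lemma mode_sum_inject: assumes "mode_sum c = mode_sum d" "N \<in> S" shows "c N = d N"
proof -
  have "c N * of_real ((norm (b N))\<^sup>2) = d N * of_real ((norm (b N))\<^sup>2)"
    using assms mode_sum_coefficient by metis
  then show ?thesis using b0[OF assms(2)] by simp
qed

lemma mode_sum_scale: "mode_sum (\<lambda>N. z * c N) = z *\<^sub>C mode_sum c"
  by (simp add: mode_sum_def L2.scale_sum_right)

lemma op_N_mode_sum: "op_N (mode_sum c) = (\<Sum>N\<in>S. (of_int N * c N) *\<^sub>C b N)"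
proof -
  have "op_N (mode_sum c) = (\<Sum>N\<in>S. c N *\<^sub>C op_N (b N))"
    unfolding mode_sum_def by (rule V_space_op_linear[OF bV])
  also have "\<dots> = (\<Sum>N\<in>S. (of_int N * c N) *\<^sub>C b N)"
    by (rule sum.cong) (simp_all add: F_N_eigenvector[OF bV bF] scaleR_scaleC mult.commute)
  finally show ?thesis .
qed

lemma cinner_mode_sum: "cinner (mode_sum c) (mode_sum d) = (\<Sum>N\<in>S. c N * cnj (d N) * of_real ((norm (b N))\<^sup>2))"
  unfolding mode_sum_def[of d] cinner_sum_right cinner_scaleC_right
  by (rule sum.cong) (simp_all add: mode_sum_coefficient mult_ac)

definition mean_N :: real where "mean_N = (\<Sum>N\<in>S. of_int N * (norm (b N))\<^sup>2)"

lemma unit_cnj: "cmod z = 1 \<Longrightarrow> z * cnj z = 1"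
  using complex_norm_square[of z] by simp

lemma norm_mode_sum_unimodular:
  assumes "\<And>N. N \<in> S \<Longrightarrow> cmod (c N) = 1" shows "norm (mode_sum c) = 1"
proof -
  have "cinner (mode_sum c) (mode_sum c) = (\<Sum>N\<in>S. of_real ((norm (b N))\<^sup>2))"
    unfolding cinner_mode_sum by (rule sum.cong) (simp_all add: unit_cnj assms)
  also have "\<dots> = cinner (mode_sum (\<lambda>_. 1)) (mode_sum (\<lambda>_. 1))"
    unfolding cinner_mode_sum by simp
  also have "\<dots> = 1" by (simp add: cinner_self mode_sum_def norm_sum)
  finally have "complex_of_real ((norm (mode_sum c))\<^sup>2) = of_real 1" unfolding cinner_self by simp
  then have "(norm (mode_sum c))\<^sup>2 = 1" by (simp only: of_real_eq_iff)
  then show ?thesis by (simp add: power2_eq_1_iff) (metis norm_ge_zero not_one_le_zero neg_0_le_iff_le zero_le_one)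
qed

lemma cinner_op_N_mode_sum:
  assumes "\<And>N. N \<in> S \<Longrightarrow> cmod (c N) = 1" shows "cinner (mode_sum c) (op_N (mode_sum c)) = of_real mean_N"
proof -
  have "cinner (mode_sum c) (mode_sum (\<lambda>N. of_int N * c N)) = (\<Sum>N\<in>S. of_int N * of_real ((norm (b N))\<^sup>2))"
    unfolding cinner_mode_sum by (rule sum.cong) (use assms unit_cnj in \<open>simp_all add: mult.left_commute\<close>)
  then show ?thesis unfolding op_N_mode_sum mode_sum_def[of "\<lambda>N. of_int N * c N", symmetric] by (simp add: mean_N_def)
qed

definition kappa :: "int \<Rightarrow> int \<Rightarrow> complex" where "kappa M N = cinner (b M) (op_K (b N))"

lemma kappa_diagonal: "N \<in> S \<Longrightarrow> kappa N N = 0"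
  unfolding kappa_def by (rule F_N_op_K_orthogonal[OF bV bF])

lemma cinner_op_K_mode_sum: "cinner (mode_sum c) (op_K (mode_sum c)) = (\<Sum>M\<in>S. \<Sum>N\<in>S. c M * cnj (c N) * kappa M N)"
proof -
  have "op_K (mode_sum c) = (\<Sum>N\<in>S. c N *\<^sub>C op_K (b N))"
    unfolding mode_sum_def by (rule V_space_op_linear[OF bV])
  then show ?thesis
    unfolding mode_sum_def[of c] kappa_def
    by - (rule trans[OF _ sum.swap], simp add: cinner_sum_left cinner_sum_right sum_distrib_left mult_ac)
qed

text \<open>The value of \<open>Re \<langle>\<beta>, op_K \<beta>\<rangle>\<close> along the solution. A phase common to all modes cancels, which is why
it is an explicit function of time and the phase can be found by integration.\<close>

definition osc :: "real \<Rightarrow> real" where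
  "osc t = Re (\<Sum>M\<in>S. \<Sum>N\<in>S. cis (- (of_int (M - N) * t)) * kappa M N)"

text \<open>The primitive of the trigonometric polynomial above. In the terms with \<open>M = N\<close> the division by \<open>0\<close>
yields \<open>0\<close>, in agreement with the vanishing of \<open>kappa N N\<close>.\<close>

definition osc_integral :: "real \<Rightarrow> complex" where
  "osc_integral t = (\<Sum>M\<in>S. \<Sum>N\<in>S. (cis (- (of_int (M - N) * t)) - 1) * (kappa M N / (- \<i> * of_int (M - N))))"

definition phase_shift :: "real \<Rightarrow> real" where
  "phase_shift t = mean_N / 2 * t + Re (osc_integral t) / 2"

definition sol :: "real \<Rightarrow> 'd phase L2" where
  "sol t = mode_sum (\<lambda>N. cis (- (of_int N * t + phase_shift t)))"

lemma DERIV_phase_shift: "(phase_shift has_real_derivative (mean_N / 2 + osc t / 2)) (at t)"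
proof -
  have "(osc_integral has_vector_derivative
     (\<Sum>M\<in>S. \<Sum>N\<in>S. (of_real (- of_int (M - N)) * \<i> * cis (- (of_int (M - N) * t)) - 0) * (kappa M N / (- \<i> * of_int (M - N))))) (at t)"
    unfolding osc_integral_def[abs_def]
    by (intro has_vector_derivative_sum has_vector_derivative_mult_left has_vector_derivative_diff
        has_vector_derivative_const has_vector_derivative_cis) (auto intro!: derivative_eq_intros)
  also have "(\<Sum>M\<in>S. \<Sum>N\<in>S. (of_real (- of_int (M - N)) * \<i> * cis (- (of_int (M - N) * t)) - 0) * (kappa M N / (- \<i> * of_int (M - N))))
      = (\<Sum>M\<in>S. \<Sum>N\<in>S. cis (- (of_int (M - N) * t)) * kappa M N)"
  proof (intro sum.cong refl)
    fix M N assume "M \<in> S" "N \<in> S"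
    show "(of_real (- of_int (M - N)) * \<i> * cis (- (of_int (M - N) * t)) - 0) * (kappa M N / (- \<i> * of_int (M - N)))
       = cis (- (of_int (M - N) * t)) * kappa M N"
    proof (cases "M = N")
      case True
      then show ?thesis using kappa_diagonal \<open>N \<in> S\<close> by simp
    next
      case False
      define z where "z = complex_of_int (M - N)"
      have z: "z \<noteq> 0" "complex_of_real (- of_int (M - N)) = - z" using False by (simp_all add: z_def)
      then show ?thesis unfolding z_def[symmetric] z(2) by (simp add: field_simps)
    qed
  qed
  finally have "((\<lambda>t. Re (osc_integral t)) has_vector_derivative osc t) (at t)"
    unfolding osc_def by (rule bounded_linear.has_vector_derivative[OF bounded_linear_Re])
  then have D: "((\<lambda>t. Re (osc_integral t)) has_real_derivative osc t) (at t)"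
    by (simp add: has_real_derivative_iff_has_vector_derivative)
  show ?thesis
    unfolding phase_shift_def[abs_def] by (intro DERIV_add DERIV_cdivide D DERIV_cmult_Id)
qed

lemma phase_shift_0: "phase_shift 0 = 0"
  by (simp add: phase_shift_def osc_integral_def)

lemma sol_0: "sol 0 = (\<Sum>N\<in>S. b N)"
  by (simp add: sol_def mode_sum_def phase_shift_0)

lemma norm_sol: "norm (sol t) = 1"
  unfolding sol_def by (rule norm_mode_sum_unimodular) simp

text \<open>With the first moments and \<open>\<parallel>\<beta>\<parallel>\<^sup>2 - 1\<close> gone, the field is \<open>- \<i>\<close> times \<^const>\<open>op_N\<close> plus a real
scalar, applied to the solution.\<close>

lemma X_H_sol: "X_H (sol t) = (\<Sum>N\<in>S. (- \<i> * of_real (of_int N + mean_N / 2 + osc t / 2) * cis (- (of_int N * t + phase_shift t))) *\<^sub>C b N)"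
proof -
  define c where "c N = cis (- (of_int N * t + phase_shift t))" for N :: int
  have s: "sol t = mode_sum c"
    unfolding sol_def by (rule arg_cong[of _ _ mode_sum]) (simp add: c_def fun_eq_iff)
  have c: "cmod (c N) = 1" for N by (simp add: c_def)
  have a: "Re (cinner (sol t) (op_a i (sol t))) = 0" and b: "Re (cinner (sol t) (op_b i (sol t))) = 0" for i
    unfolding s mode_sum_def by (rule centered_a centered_b)+
  have "cinner (sol t) (op_K (sol t)) = (\<Sum>M\<in>S. \<Sum>N\<in>S. cis (- (of_int (M - N) * t)) * kappa M N)"
    unfolding s cinner_op_K_mode_sum by (intro sum.cong refl) (simp add: c_def cis_cnj cis_mult algebra_simps)
  then have K: "Re (cinner (sol t) (\<Sum>i\<in>UNIV. op_b' i (op_b' i (sol t)) - op_a i (op_a i (sol t)))) = osc t"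
    by (simp add: osc_def op_K_def)
  have N: "cinner (sol t) (op_N (sol t)) = of_real mean_N"
    unfolding s by (rule cinner_op_N_mode_sum) (rule c)
  have i2: "1 / (2 * \<i>) = - \<i> / 2" by (simp add: field_simps)
  have "X_H (sol t) = (1 / \<i>) *\<^sub>C (op_N (sol t) + (1 / 2 * of_real mean_N) *\<^sub>C sol t) + (1 / (2 * \<i>) * of_real (osc t)) *\<^sub>C sol t"
    unfolding X_H_def K N a b norm_sol by simp
  also have "\<dots> = (\<Sum>N\<in>S. (- \<i> * of_real (of_int N + mean_N / 2 + osc t / 2) * c N) *\<^sub>C b N)"
    unfolding s op_N_mode_sum i2
    unfolding mode_sum_def L2.scale_right_distrib L2.scale_sum_right L2.scale_scale
      sum.distrib[symmetric] L2.scale_left_distrib[symmetric]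
    by (intro sum.cong refl arg_cong2[of _ _ _ _ scaleC]) (simp add: algebra_simps)
  finally show ?thesis by (simp add: c_def)
qed

lemma sol_derivative: "(sol has_vector_derivative X_H (sol t)) (at t)"
proof -
  have D: "((\<lambda>t. \<Sum>N\<in>S. cis (- (of_int N * t + phase_shift t)) *\<^sub>C b N) has_vector_derivative
     (\<Sum>N\<in>S. (of_real (- (of_int N + (mean_N / 2 + osc t / 2))) * \<i> * cis (- (of_int N * t + phase_shift t))) *\<^sub>C b N)) (at t)"
  proof (intro has_vector_derivative_sum bounded_linear.has_vector_derivative[OF bounded_linear_scaleC_left] has_vector_derivative_cis)
    fix N show "((\<lambda>t. - (of_int N * t + phase_shift t)) has_real_derivative - (of_int N + (mean_N / 2 + osc t / 2))) (at t)"
      by (rule derivative_eq_intros DERIV_phase_shift refl)+ simp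
  qed
  have eq: "of_real (- (of_int N + (mean_N / 2 + osc t / 2))) * \<i> * cis (- (of_int N * t + phase_shift t))
     = - \<i> * of_real (of_int N + mean_N / 2 + osc t / 2) * cis (- (of_int N * t + phase_shift t))" for N
    by (simp add: algebra_simps)
  have s: "sol = (\<lambda>t. \<Sum>N\<in>S. cis (- (of_int N * t + phase_shift t)) *\<^sub>C b N)"
    by (rule ext) (simp only: sol_def mode_sum_def)
  show ?thesis
    unfolding X_H_sol unfolding s using D unfolding eq .
qed

lemma global_solution_sol: "global_solution sol"
  unfolding global_solution_def using sol_derivative span_V by (auto simp: sol_def mode_sum_def)

section \<open>Relative and classical periods\<close>

definition common_period :: "real \<Rightarrow> bool" where
  "common_period T \<longleftrightarrow> (\<forall>M\<in>S. \<forall>N\<in>S. cis (of_int (M - N) * T) = 1)"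

text \<open>All frequencies of this trigonometric sum are differences of elements of \<open>S\<close>.\<close>

lemma osc_integral_period:
  assumes "common_period T" shows "osc_integral (t + T) = osc_integral t"
  unfolding osc_integral_def
proof (intro sum.cong refl)
  fix M N assume "M \<in> S" "N \<in> S"
  then have "cis (of_int (N - M) * T) = 1" using assms by (simp add: common_period_def)
  moreover have "cis (- (of_int (M - N) * (t + T))) = cis (- (of_int (M - N) * t)) * cis (of_int (N - M) * T)"
    by (simp add: cis_mult algebra_simps)
  ultimately show "(cis (- (of_int (M - N) * (t + T))) - 1) * (kappa M N / (- \<i> * of_int (M - N)))
     = (cis (- (of_int (M - N) * t)) - 1) * (kappa M N / (- \<i> * of_int (M - N)))" by simp
qed

text \<open>The choice of \<open>N0\<close> is immaterial, since the factors for different elements of \<open>S\<close> agree when \<open>T\<close> is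
a common period.\<close>

lemma sol_shift:
  assumes T: "common_period T" and N0: "N0 \<in> S"
  shows "sol (t + T) = cis (- ((of_int N0 + mean_N / 2) * T)) *\<^sub>C sol t"
proof -
  have shift: "phase_shift (t + T) = phase_shift t + mean_N / 2 * T"
    unfolding phase_shift_def osc_integral_period[OF T] by (simp add: algebra_simps)
  have "cis (- (of_int N * (t + T) + phase_shift (t + T)))
     = cis (- ((of_int N0 + mean_N / 2) * T)) * cis (- (of_int N * t + phase_shift t))" if "N \<in> S" for N
  proof -
    have "cis (- (of_int N * (t + T) + phase_shift (t + T)))
      = cis (of_int (N0 - N) * T) * (cis (- ((of_int N0 + mean_N / 2) * T)) * cis (- (of_int N * t + phase_shift t)))"
      unfolding shift by (simp add: cis_mult algebra_simps)
    also have "cis (of_int (N0 - N) * T) = 1" using T N0 that by (simp add: common_period_def)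
    finally show ?thesis by simp
  qed
  then show ?thesis
    unfolding sol_def unfolding mode_sum_scale[symmetric] unfolding mode_sum_def by (intro sum.cong refl) simp
qed

text \<open>If the orbits at times \<open>0\<close> and \<open>T\<close> agree, then all modes have acquired the same phase at time \<open>T\<close>,
because they are linearly independent.\<close>

lemma orbit_period_iff: "has_period (\<lambda>t. circle_orbit (sol t)) T \<longleftrightarrow> T > 0 \<and> common_period T"
proof
  assume h: "has_period (\<lambda>t. circle_orbit (sol t)) T"
  then have "circle_orbit (sol (0 + T)) = circle_orbit (sol 0)" unfolding has_period_def by blast
  then obtain z where "sol T = z *\<^sub>C sol 0" unfolding circle_orbit_eq_iff by auto
  then have eq: "mode_sum (\<lambda>N. cis (- (of_int N * T + phase_shift T))) = mode_sum (\<lambda>N. z * 1)"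
    unfolding mode_sum_scale by (simp add: sol_def phase_shift_0)
  have "cis (of_int (M - N) * T) = 1" if "M \<in> S" "N \<in> S" for M N
  proof -
    have "cis (of_int (M - N) * T) = cis (- (of_int N * T + phase_shift T)) / cis (- (of_int M * T + phase_shift T))"
      unfolding cis_divide by (simp add: algebra_simps)
    also have "cis (- (of_int N * T + phase_shift T)) = cis (- (of_int M * T + phase_shift T))"
      using mode_sum_inject[OF eq that(1)] mode_sum_inject[OF eq that(2)] by simp
    finally show ?thesis by simp
  qed
  then show "T > 0 \<and> common_period T" using h by (simp add: common_period_def has_period_def)
next
  assume T: "T > 0 \<and> common_period T"
  obtain N0 where "N0 \<in> S" using neS by blast
  then have "circle_orbit (sol (t + T)) = circle_orbit (sol t)" for t
    using sol_shift T unfolding circle_orbit_eq_iff by (intro exI[of _ "cis (- ((of_int N0 + mean_N / 2) * T))"]) simp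
  then show "has_period (\<lambda>t. circle_orbit (sol t)) T" using T by (simp add: has_period_def)
qed

lemma period_iff:
  assumes N0: "N0 \<in> S"
  shows "has_period sol T \<longleftrightarrow> T > 0 \<and> common_period T \<and> cis ((of_int N0 + mean_N / 2) * T) = 1"
proof
  assume h: "has_period sol T"
  then have "has_period (\<lambda>t. circle_orbit (sol t)) T" by (simp add: has_period_def)
  then have T: "T > 0" "common_period T" by (simp_all add: orbit_period_iff)
  have "sol (0 + T) = sol 0" using h unfolding has_period_def by blast
  then have "cis (- ((of_int N0 + mean_N / 2) * T)) *\<^sub>C sol 0 = 1 *\<^sub>C sol 0"
    using sol_shift[OF T(2) N0, of 0] by simp
  moreover have "sol 0 \<noteq> 0" using norm_sol[of 0] by auto
  ultimately have "cis (- ((of_int N0 + mean_N / 2) * T)) = 1" using L2.scale_right_imp_eq by blast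
  then have "inverse (cis ((of_int N0 + mean_N / 2) * T)) = 1" by simp
  then show "T > 0 \<and> common_period T \<and> cis ((of_int N0 + mean_N / 2) * T) = 1" using T by (simp del: cis_inverse)
next
  assume T: "T > 0 \<and> common_period T \<and> cis ((of_int N0 + mean_N / 2) * T) = 1"
  then have "cis (- ((of_int N0 + mean_N / 2) * T)) = 1" by (metis cis_inverse inverse_1)
  then show "has_period sol T" using T sol_shift[OF _ N0] by (simp add: has_period_def)
qed

definition gap :: int where "gap = Gcd {\<bar>N - M\<bar> | N M. M \<in> S \<and> N \<in> S}"

lemma common_period_iff: "common_period T \<longleftrightarrow> of_int gap * (T / (2 * pi)) \<in> \<int>"
proof -
  have eq: "{\<bar>N - M\<bar> | N M. M \<in> S \<and> N \<in> S} = (\<lambda>(M, N). \<bar>N - M\<bar>) ` (S \<times> S)" by auto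
  have fin: "finite {\<bar>N - M\<bar> | N M. M \<in> S \<and> N \<in> S}" unfolding eq using finS by simp
  have "(\<forall>d\<in>{\<bar>N - M\<bar> | N M. M \<in> S \<and> N \<in> S}. of_int d * (T / (2 * pi)) \<in> \<int>)
     \<longleftrightarrow> (\<forall>M\<in>S. \<forall>N\<in>S. cis (of_int (M - N) * T) = 1)"
  proof -
    have "of_int \<bar>N - M\<bar> * (T / (2 * pi)) \<in> \<int> \<longleftrightarrow> cis (of_int (M - N) * T) = 1" for M N :: int
    proof -
      have "of_int \<bar>N - M\<bar> * (T / (2 * pi)) = of_int (M - N) * T / (2 * pi)
         \<or> of_int \<bar>N - M\<bar> * (T / (2 * pi)) = - (of_int (M - N) * T / (2 * pi))"
        by (cases "N \<le> M") (auto simp: abs_if field_simps)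
      then show ?thesis unfolding cis_eq_1_Ints by (metis Ints_minus minus_minus)
    qed
    then show ?thesis by blast
  qed
  then show ?thesis unfolding common_period_def gap_def Gcd_multiples_integral[OF fin] by simp
qed

lemma gap_pos: assumes "card S \<ge> 2" shows "gap > 0"
proof -
  obtain M N where MN: "M \<in> S" "N \<in> S" "M \<noteq> N"
    using assms finS by (metis card_2_iff' card_le_Suc0_iff_eq not_less_eq_eq numeral_2_eq_2)
  then have "gap dvd \<bar>N - M\<bar>" unfolding gap_def by (intro Gcd_dvd) blast
  then have "gap \<noteq> 0" using MN by auto
  moreover have "gap \<ge> 0" by (simp add: gap_def)
  ultimately show ?thesis by simp
qed

lemma common_period_multiple:
  assumes "card S \<ge> 2" "T > 0"
  shows "common_period T \<longleftrightarrow> (\<exists>k::nat. k \<ge> 1 \<and> T = of_nat k * (2 * pi / of_int gap))"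
proof
  have g: "gap > 0" by (rule gap_pos[OF assms(1)])
  assume "common_period T"
  then obtain k where k: "of_int gap * (T / (2 * pi)) = of_int k"
    unfolding common_period_iff by (auto elim: Ints_cases)
  then have T: "T = of_int k * (2 * pi / of_int gap)" using g by (simp add: field_simps)
  have "real_of_int k > 0" unfolding k[symmetric] using g assms(2) by simp
  then have "k > 0" by simp
  then show "\<exists>k::nat. k \<ge> 1 \<and> T = of_nat k * (2 * pi / of_int gap)"
    using T by (intro exI[of _ "nat k"]) auto
next
  have g: "gap > 0" by (rule gap_pos[OF assms(1)])
  assume "\<exists>k::nat. k \<ge> 1 \<and> T = of_nat k * (2 * pi / of_int gap)"
  then show "common_period T" unfolding common_period_iff using g by auto
qed

lemma relative_period_sol: assumes "card S \<ge> 2" shows "relative_period sol (2 * pi / of_int gap)"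
proof -
  have g: "gap > 0" by (rule gap_pos[OF assms])
  have 0: "2 * pi / of_int gap > 0" using g by simp
  have "has_period (\<lambda>t. circle_orbit (sol t)) (2 * pi / of_int gap)"
    unfolding orbit_period_iff using common_period_multiple[OF assms 0] 0 by (auto intro!: exI[of _ 1])
  moreover have "2 * pi / of_int gap \<le> T" if h: "has_period (\<lambda>t. circle_orbit (sol t)) T" for T
  proof -
    have T: "T > 0" "common_period T" using h by (simp_all add: orbit_period_iff)
    then obtain k :: nat where k: "k \<ge> 1" "T = of_nat k * (2 * pi / of_int gap)"
      using common_period_multiple[OF assms T(1)] by blast
    show ?thesis using k(1) mult_right_mono[of 1 "real k" "2 * pi / of_int gap"] 0 unfolding k(2) by simp
  qed
  ultimately show ?thesis by (simp add: relative_period_def minimal_period_def)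
qed

lemma relatively_constant_sol: assumes "card S = 1" shows "relatively_constant sol"
proof -
  obtain N where N: "S = {N}" using assms by (auto simp: card_1_singleton_iff)
  have "circle_orbit (sol t) = circle_orbit (b N)" for t
  proof -
    have "mode_sum c = c N *\<^sub>C b N" for c unfolding mode_sum_def using N by simp
    then show ?thesis unfolding circle_orbit_eq_iff sol_def by (intro exI conjI) auto
  qed
  then show ?thesis by (simp add: relatively_constant_def)
qed

text \<open>From a period \<open>T\<close>: two distinct modes make \<open>T / 2\<pi>\<close> rational and nonzero, and then
\<open>(N0 + mean_N / 2) T / 2\<pi>\<close> being integral makes \<open>mean_N\<close> rational; with a single mode \<open>mean_N\<close> is an
integer. Conversely, if \<open>q mean_N\<close> is an integer, then \<open>4\<pi>q\<close> is a period.\<close>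

lemma periodic_sol_iff: "periodic sol \<longleftrightarrow> mean_N \<in> \<rat>"
proof
  obtain N0 where N0: "N0 \<in> S" using neS by blast
  assume "periodic sol"
  then obtain T where T: "T > 0" "common_period T" "cis ((of_int N0 + mean_N / 2) * T) = 1"
    unfolding periodic_def period_iff[OF N0] by blast
  show "mean_N \<in> \<rat>"
  proof (cases "S = {N0}")
    case True
    then have "norm (b N0) = 1" using norm_sum by simp
    then show ?thesis unfolding mean_N_def using True by simp
  next
    case False
    then obtain M where M: "M \<in> S" "M \<noteq> N0" using N0 by blast
    then have "of_int (M - N0) * T / (2 * pi) \<in> \<int>" using T(2) N0 by (simp add: common_period_def flip: cis_eq_1_Ints)
    then obtain j where j: "of_int (M - N0) * T / (2 * pi) = of_int j" by (auto elim: Ints_cases)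
    obtain m where m: "(of_int N0 + mean_N / 2) * T / (2 * pi) = of_int m"
      using T(3) unfolding cis_eq_1_Ints by (auto elim: Ints_cases)
    have x: "T / (2 * pi) = of_int j / of_int (M - N0)" using j M(2) by (simp add: field_simps)
    then have j0: "of_int j / of_int (M - N0) \<noteq> (0::real)" using T(1) by auto
    have "(of_int N0 + mean_N / 2) * (T / (2 * pi)) = of_int m" using m by simp
    then have "(of_int N0 + mean_N / 2) * (of_int j / of_int (M - N0)) = of_int m" unfolding x .
    then have "mean_N = 2 * (of_int m / (of_int j / of_int (M - N0)) - of_int N0)"
      using j0 by (simp add: field_simps)
    also have "\<dots> \<in> \<rat>" by (intro Rats_mult Rats_diff Rats_divide) auto
    finally show ?thesis .
  qed
next
  obtain N0 where N0: "N0 \<in> S" using neS by blast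
  assume "mean_N \<in> \<rat>"
  then obtain p q :: int where pq: "q > 0" "mean_N = of_int p / of_int q"
    by (metis Rats_cases' )
  have "has_period sol (4 * pi * of_int q)"
    unfolding period_iff[OF N0] common_period_def cis_eq_1_Ints
  proof (intro conjI ballI)
    show "4 * pi * of_int q > 0" using pq by simp
    have "of_int (M - N) * (4 * pi * of_int q) / (2 * pi) = of_int (2 * (M - N) * q)" for M N by simp
    then show "of_int (M - N) * (4 * pi * of_int q) / (2 * pi) \<in> \<int>" for M N by (metis Ints_of_int)
    have "(of_int N0 + mean_N / 2) * (4 * pi * of_int q) / (2 * pi) = of_int (2 * N0 * q + p)"
      using pq by (simp add: field_simps)
    then show "(of_int N0 + mean_N / 2) * (4 * pi * of_int q) / (2 * pi) \<in> \<int>" by (metis Ints_of_int)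
  qed
  then show "periodic sol" unfolding periodic_def by blast
qed

text \<open>Classical periods are relative periods, hence multiples of \<open>T\<close>, and among the positive multiples
there is a least one.\<close>

lemma minimal_period_multiple:
  assumes S: "card S \<ge> 2" and per: "periodic sol" and T: "relative_period sol T"
  shows "\<exists>k::nat. k \<ge> 1 \<and> minimal_period sol (real k * T)"
proof -
  have "T = 2 * pi / of_int gap"
    using T relative_period_sol[OF S] unfolding relative_period_def minimal_period_def by (meson order_antisym)
  moreover have "has_period (\<lambda>t. circle_orbit (sol t)) R" if "has_period sol R" for R
    using that by (simp add: has_period_def)
  ultimately have mult: "\<exists>k::nat. k \<ge> 1 \<and> R = real k * T" if "has_period sol R" for R
    using that common_period_multiple[OF S] unfolding orbit_period_iff by blast
  define P where "P k \<longleftrightarrow> k \<ge> 1 \<and> has_period sol (real k * T)" for k :: nat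
  obtain k where "P k" using per mult unfolding periodic_def P_def by blast
  then have L: "P (LEAST k. P k)" by (rule LeastI)
  have T0: "T > 0" using T by (simp add: relative_period_def minimal_period_def has_period_def)
  have "real (LEAST k. P k) * T \<le> R" if R: "has_period sol R" for R
  proof -
    obtain l :: nat where l: "l \<ge> 1" "R = real l * T" using mult[OF R] by blast
    then have "(LEAST k. P k) \<le> l" using R by (intro Least_le) (simp add: P_def)
    then show ?thesis unfolding l(2) using T0 by (intro mult_right_mono) auto
  qed
  then show ?thesis using L unfolding P_def minimal_period_def by blast
qed

end

theorem theorem3p9:
  fixes \<beta>\<^sub>0 :: "'d::finite phase L2" and W :: "'d phase L2 set" and J :: nat
  assumes "norm \<beta>\<^sub>0 = 1"
    and "ind_osc \<beta>\<^sub>0 = enat J"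
    and "minimal_centered W \<beta>\<^sub>0"
  shows "\<exists>\<beta> :: real \<Rightarrow> 'd phase L2.
    global_solution \<beta> \<and> \<beta> 0 = \<beta>\<^sub>0 \<and>
    (\<forall>t. \<beta> t \<in> W \<and> norm (\<beta> t) = 1) \<and>
    (J > 1 \<longrightarrow> relatively_periodic \<beta>) \<and>
    (J = 1 \<longrightarrow> relatively_constant \<beta>) \<and>
    (J \<ge> 2 \<longrightarrow> relative_period \<beta>
       (2 * pi / real_of_int (Gcd {\<bar>N - M\<bar> | N M.
          L2.dim (component W M) > 0 \<and> L2.dim (component W N) > 0}))) \<and>
    (\<Sum>i\<in>UNIV. cinner \<beta>\<^sub>0 (op_b' i (op_b i \<beta>\<^sub>0) - op_a' i (op_a i \<beta>\<^sub>0)))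
      = cinner \<beta>\<^sub>0 (op_N \<beta>\<^sub>0) \<and>
    (periodic \<beta> \<longleftrightarrow> cinner \<beta>\<^sub>0 (op_N \<beta>\<^sub>0) \<in> \<rat>) \<and>
    (\<forall>T. J \<ge> 2 \<and> periodic \<beta> \<and> relative_period \<beta> T \<longrightarrow>
       (\<exists>k::nat. k \<ge> 1 \<and> minimal_period \<beta> (real k * T)))"
proof -
  \<comment> \<open>the modes of \<open>\<beta>\<^sub>0\<close>; the solution is the one constructed from them\<close>
  obtain S b where S: "finite S" "S \<noteq> {}" and bF: "\<And>N. N \<in> S \<Longrightarrow> b N \<in> F_N N"
    and bW: "\<And>N. N \<in> S \<Longrightarrow> b N \<in> W" and b0: "\<And>N. N \<in> S \<Longrightarrow> b N \<noteq> 0"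
    and sum: "\<beta>\<^sub>0 = (\<Sum>N\<in>S. b N)" and dimW: "{N. L2.dim (component W N) > 0} = S"
    and J: "J \<le> card S" "J = 1 \<Longrightarrow> card S = 1"
    by (rule minimal_centered_structure[OF assms]) blast
  have W: "centered W" using assms(3) by (simp add: minimal_centered_def)
  have comb_W: "(\<Sum>N\<in>S. c N *\<^sub>C b N) \<in> W" for c
    by (intro L2.subspace_sum L2.subspace_scale centeredD(1)[OF W] bW)
  interpret hartree_modes S b
  proof
    show "b N \<in> V_space" if "N \<in> S" for N using bW[OF that] centeredD(3)[OF W] by blast
    show "(\<Sum>N\<in>S. c N *\<^sub>C b N) \<in> V_space" for c using comb_W centeredD(3)[OF W] by blast
  qed (use S bF b0 assms(1) sum centeredD(5,6)[OF W comb_W] in auto)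
  have Gcd: "{\<bar>N - M\<bar> | N M. L2.dim (component W M) > 0 \<and> L2.dim (component W N) > 0}
     = {\<bar>N - M\<bar> | N M. M \<in> S \<and> N \<in> S}"
    unfolding dimW[symmetric] by simp
  have mean_N: "cinner \<beta>\<^sub>0 (op_N \<beta>\<^sub>0) = of_real mean_N"
    using cinner_op_N_mode_sum[of "\<lambda>_. 1"] by (simp add: mode_sum_def sum)
  have rel: "relatively_periodic sol" if "J > 1"
    using relative_period_sol J(1) that
    unfolding relatively_periodic_def periodic_def relative_period_def minimal_period_def by auto
  show ?thesis
    unfolding Gcd gap_def[symmetric]
  proof (intro exI[of _ sol] conjI allI impI)
    show "sol 0 = \<beta>\<^sub>0" by (simp add: sol_0 sum)
    show "sol t \<in> W" for t unfolding sol_def mode_sum_def by (rule comb_W)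
    show "(\<Sum>i\<in>UNIV. cinner \<beta>\<^sub>0 (op_b' i (op_b i \<beta>\<^sub>0) - op_a' i (op_a i \<beta>\<^sub>0))) = cinner \<beta>\<^sub>0 (op_N \<beta>\<^sub>0)"
      by (simp add: op_N_def cinner_sum_right)
    show "periodic sol \<longleftrightarrow> cinner \<beta>\<^sub>0 (op_N \<beta>\<^sub>0) \<in> \<rat>"
      by (simp add: mean_N periodic_sol_iff)
  qed (use global_solution_sol norm_sol rel relatively_constant_sol relative_period_sol minimal_period_multiple J in auto)
qed

end
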